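(* Let $\mathcal C$ be a monoidal category with a $G$-grading, and let $(\omega,\gamma)\in Z^3_{\mathrm{ab}}(G,K^\times)$ be an abelian $3$-cocycle on $G$. Then there is a braided tensor equivalence $$F:\mathcal Z(\mathcal C_\omega)\xrightarrow{\ \sim\ }\mathcal Z(\mathcal C)^{(\omega,\gamma)}$$ given on objects by $(X,\varphi)\mapsto(X,\varphi^\gamma)$, where $\varphi^\gamma_Y=\gamma(g,h)\cdot\varphi_Y$ for $X\in\mathcal C_g$ and $Y\in\mathcal C_h$.
   Context: $K$ is an algebraically closed field and $G$ is an (abelian) group. A $G$-grading on the ($K$-linear) monoidal category $\mathcal C$ is a decomposition $\mathcal C=\bigoplus_{g\in G}\mathcal C_g$ into a direct sum of full $K$-linear subcategories with $\mathbf 1\in\mathcal C_e$ and $X\otimes Y\in\mathcal C_{gh}$ for $X\in\mathcal C_g$, $Y\in\mathcal C_h$. An abelian $3$-cocycle on $G$ is a pair of functions $\omega:G^3\to K^\times$, $\gamma:G^2\to K^\times$ such that for all $g_i\in G$: $\omega(g_1,g_2,g_3)\,\omega(g_1,g_2g_3,g_4)\,\omega(g_2,g_3,g_4)=\omega(g_1g_2,g_3,g_4)\,\omega(g_1,g_2,g_3g_4)$; $\omega(g_2,g_3,g_1)\,\gamma(g_1,g_2g_3)\,\omega(g_1,g_2,g_3)=\gamma(g_1,g_3)\,\omega(g_2,g_1,g_3)\,\gamma(g_1,g_2)$; $\omega(g_3,g_1,g_2)^{-1}\gamma(g_1g_2,g_3)\,\omega(g_1,g_2,g_3)^{-1}=\gamma(g_1,g_3)\,\omega(g_1,g_3,g_2)^{-1}\gamma(g_2,g_3)$.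 The set of these is $Z^3_{\mathrm{ab}}(G,K^\times)$. Twists. $\mathcal C_\omega$ is $\mathcal C$ with its associator $\alpha:(-\otimes-)\otimes-\to-\otimes(-\otimes-)$ replaced by $\alpha^\omega_{X_1,X_2,X_3}=\omega(g_1,g_2,g_3)\,\alpha_{X_1,X_2,X_3}$ for $X_i\in\mathcal C_{g_i}$. For a $G$-graded braided monoidal category $\mathcal B$ with associator $\alpha$ and braiding $\sigma$, $\mathcal B^{(\omega,\gamma)}$ is $\mathcal B$ with associator $\alpha^\omega$ and braiding $\sigma^\gamma_{X_1,X_2}=\gamma(g_1,g_2)\,\sigma_{X_1,X_2}$ for $X_i\in\mathcal B_{g_i}$. Drinfeld center. A half-braiding on $X$ is a natural isomorphism $\varphi:X\otimes-\Rightarrow-\otimes X$ with $\alpha_{Y,Z,X}\circ\varphi_{Y\otimes Z}\circ\alpha_{X,Y,Z}=(\mathrm{id}_Y\otimes\varphi_Z)\circ\alpha_{Y,X,Z}\circ(\varphi_Y\otimes\mathrm{id}_Z)$ for all $Y,Z$. The Drinfeld center $\mathcal Z(\mathcal C)$ has as objects the pairs $(X,\varphi)$ with $\varphi$ a half-braiding on $X$, and as morphisms the morphisms of $\mathcal C$ compatible with the half-braidings; $(X,\varphi)\otimes(X',\varphi')$ is $X\otimes X'$ with half-braiding $\alpha_{-,X,X'}\circ(\varphi\otimes\mathrm{id}_{X'})\circ\alpha^{-1}_{X,-,X'}\circ(\mathrm{id}_X\otimes\varphi')\circ\alpha_{X,X',-}$, with associator inherited from $\mathcal C$; the braiding $(X,\varphi)\otimes(X',\varphi')\to(X',\varphi')\otimes(X,\varphi)$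 is $\varphi_{X'}$. $\mathcal Z(\mathcal C)$ inherits a $G$-grading from $\mathcal C$: the degree of $(X,\varphi)$ is that of the underlying object $X$.
   Formalization: The object formula is corrected to φ ↦ γ(g,h)^{-1}·φ_Y: with γ as printed the claim fails, e.g. for Vec_{Z/3}, ω=1, γ(a,b)=ζ^{ab}, where the self-braiding of δ_1 changes from 1 to ζ². The printed formula describes the inverse functor. *)

theory Defs
  imports "HOL-Computational_Algebra.Polynomial" "HOL-Algebra.Ring"
begin

section \<open>Linear categories\<close>

text \<open>
  Composition, addition and scaling of morphisms are not indexed by objects, and hom-sets are
  not required to be disjoint. Categories with disjoint hom-sets are covered as a special case,
  and the morphisms of a Drinfeld center are literally morphisms of the underlying category.
\<close>

record ('o, 'm, 'k) lin_cat =
  Obj :: "'o set"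
  Hom :: "'o \<Rightarrow> 'o \<Rightarrow> 'm set"
  Ident :: "'o \<Rightarrow> 'm"
  Comp :: "'m \<Rightarrow> 'm \<Rightarrow> 'm"  (infixr \<open>\<bullet>\<index>\<close> 65)
  ZeroM :: "'o \<Rightarrow> 'o \<Rightarrow> 'm"
  AddM :: "'m \<Rightarrow> 'm \<Rightarrow> 'm"
  Scale :: "'k \<Rightarrow> 'm \<Rightarrow> 'm"

text \<open>The additive group of morphisms; only the additive part of the record is meaningful.\<close>

definition hom_group :: "('o, 'm, 'k, 'e) lin_cat_scheme \<Rightarrow> 'o \<Rightarrow> 'o \<Rightarrow> 'm ring" where
  "hom_group C X Y = \<lparr>carrier = Hom C X Y, monoid.mult = undefined, one = undefined,
     zero = ZeroM C X Y, add = AddM C\<rparr>"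

locale linear_category =
  fixes C :: "('o, 'm, 'k::field, 'e) lin_cat_scheme" (structure)
  assumes hom_abelian: "\<lbrakk>X \<in> Obj C; Y \<in> Obj C\<rbrakk> \<Longrightarrow> abelian_group (hom_group C X Y)"
    and scale_closed:
      "\<lbrakk>X \<in> Obj C; Y \<in> Obj C; f \<in> Hom C X Y\<rbrakk> \<Longrightarrow> Scale C a f \<in> Hom C X Y"
    and scale_add_right:
      "\<lbrakk>X \<in> Obj C; Y \<in> Obj C; f \<in> Hom C X Y; g \<in> Hom C X Y\<rbrakk>
        \<Longrightarrow> Scale C a (AddM C f g) = AddM C (Scale C a f) (Scale C a g)"
    and scale_add_left:
      "\<lbrakk>X \<in> Obj C; Y \<in> Obj C; f \<in> Hom C X Y\<rbrakk>
        \<Longrightarrow> Scale C (a + b) f = AddM C (Scale C a f) (Scale C b f)"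
    and scale_scale:
      "\<lbrakk>X \<in> Obj C; Y \<in> Obj C; f \<in> Hom C X Y\<rbrakk>
        \<Longrightarrow> Scale C a (Scale C b f) = Scale C (a * b) f"
    and scale_one:
      "\<lbrakk>X \<in> Obj C; Y \<in> Obj C; f \<in> Hom C X Y\<rbrakk> \<Longrightarrow> Scale C 1 f = f"
    and ident_closed: "X \<in> Obj C \<Longrightarrow> Ident C X \<in> Hom C X X"
    and comp_closed:
      "\<lbrakk>X \<in> Obj C; Y \<in> Obj C; Z \<in> Obj C; f \<in> Hom C X Y; g \<in> Hom C Y Z\<rbrakk>
        \<Longrightarrow> g \<bullet> f \<in> Hom C X Z"
    and comp_ident:
      "\<lbrakk>X \<in> Obj C; Y \<in> Obj C; f \<in> Hom C X Y\<rbrakk> \<Longrightarrow> f \<bullet> Ident C X = f"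
    and ident_comp:
      "\<lbrakk>X \<in> Obj C; Y \<in> Obj C; f \<in> Hom C X Y\<rbrakk> \<Longrightarrow> Ident C Y \<bullet> f = f"
    and comp_assoc:
      "\<lbrakk>W \<in> Obj C; X \<in> Obj C; Y \<in> Obj C; Z \<in> Obj C;
        f \<in> Hom C W X; g \<in> Hom C X Y; h \<in> Hom C Y Z\<rbrakk>
        \<Longrightarrow> (h \<bullet> g) \<bullet> f = h \<bullet> (g \<bullet> f)"
    and comp_add_right:
      "\<lbrakk>X \<in> Obj C; Y \<in> Obj C; Z \<in> Obj C; f \<in> Hom C X Y; f' \<in> Hom C X Y; g \<in> Hom C Y Z\<rbrakk>
        \<Longrightarrow> g \<bullet> AddM C f f' = AddM C (g \<bullet> f) (g \<bullet> f')"
    and comp_add_left: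
      "\<lbrakk>X \<in> Obj C; Y \<in> Obj C; Z \<in> Obj C; f \<in> Hom C X Y; g \<in> Hom C Y Z; g' \<in> Hom C Y Z\<rbrakk>
        \<Longrightarrow> AddM C g g' \<bullet> f = AddM C (g \<bullet> f) (g' \<bullet> f)"
    and comp_scale_right:
      "\<lbrakk>X \<in> Obj C; Y \<in> Obj C; Z \<in> Obj C; f \<in> Hom C X Y; g \<in> Hom C Y Z\<rbrakk>
        \<Longrightarrow> g \<bullet> Scale C a f = Scale C a (g \<bullet> f)"
    and comp_scale_left:
      "\<lbrakk>X \<in> Obj C; Y \<in> Obj C; Z \<in> Obj C; f \<in> Hom C X Y; g \<in> Hom C Y Z\<rbrakk>
        \<Longrightarrow> Scale C a g \<bullet> f = Scale C a (g \<bullet> f)"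

definition inverse_pair ::
  "('o, 'm, 'k, 'e) lin_cat_scheme \<Rightarrow> 'o \<Rightarrow> 'o \<Rightarrow> 'm \<Rightarrow> 'm \<Rightarrow> bool" where
  "inverse_pair C X Y f g \<longleftrightarrow> f \<in> Hom C X Y \<and> g \<in> Hom C Y X \<and>
     g \<bullet>\<^bsub>C\<^esub> f = Ident C X \<and> f \<bullet>\<^bsub>C\<^esub> g = Ident C Y"

definition is_iso :: "('o, 'm, 'k, 'e) lin_cat_scheme \<Rightarrow> 'o \<Rightarrow> 'o \<Rightarrow> 'm \<Rightarrow> bool" where
  "is_iso C X Y f \<longleftrightarrow> (\<exists>g. inverse_pair C X Y f g)"

definition iso_inv :: "('o, 'm, 'k, 'e) lin_cat_scheme \<Rightarrow> 'o \<Rightarrow> 'o \<Rightarrow> 'm \<Rightarrow> 'm" where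
  "iso_inv C X Y f = (THE g. inverse_pair C X Y f g)"

definition is_functor ::
  "('o, 'm, 'k, 'e) lin_cat_scheme \<Rightarrow> ('p, 'n, 'l, 'd) lin_cat_scheme \<Rightarrow>
    ('o \<Rightarrow> 'p) \<Rightarrow> ('m \<Rightarrow> 'n) \<Rightarrow> bool" where
  "is_functor A B Fo Fm \<longleftrightarrow>
     (\<forall>X\<in>Obj A. Fo X \<in> Obj B \<and> Fm (Ident A X) = Ident B (Fo X)) \<and>
     (\<forall>X\<in>Obj A. \<forall>Y\<in>Obj A. \<forall>f\<in>Hom A X Y. Fm f \<in> Hom B (Fo X) (Fo Y)) \<and>
     (\<forall>X\<in>Obj A. \<forall>Y\<in>Obj A. \<forall>Z\<in>Obj A. \<forall>f\<in>Hom A X Y. \<forall>g\<in>Hom A Y Z.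
        Fm (g \<bullet>\<^bsub>A\<^esub> f) = Fm g \<bullet>\<^bsub>B\<^esub> Fm f)"

definition is_linear_functor ::
  "('o, 'm, 'k, 'e) lin_cat_scheme \<Rightarrow> ('p, 'n, 'k, 'd) lin_cat_scheme \<Rightarrow>
    ('o \<Rightarrow> 'p) \<Rightarrow> ('m \<Rightarrow> 'n) \<Rightarrow> bool" where
  "is_linear_functor A B Fo Fm \<longleftrightarrow> is_functor A B Fo Fm \<and>
     (\<forall>X\<in>Obj A. \<forall>Y\<in>Obj A. \<forall>f\<in>Hom A X Y. \<forall>g\<in>Hom A X Y.
        Fm (AddM A f g) = AddM B (Fm f) (Fm g)) \<and>
     (\<forall>X\<in>Obj A. \<forall>Y\<in>Obj A. \<forall>f\<in>Hom A X Y. \<forall>a. Fm (Scale A a f) = Scale B a (Fm f))"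

definition natural_iso ::
  "('o, 'm, 'k, 'e) lin_cat_scheme \<Rightarrow> ('p, 'n, 'l, 'd) lin_cat_scheme \<Rightarrow>
    ('o \<Rightarrow> 'p) \<Rightarrow> ('m \<Rightarrow> 'n) \<Rightarrow> ('o \<Rightarrow> 'p) \<Rightarrow> ('m \<Rightarrow> 'n) \<Rightarrow> ('o \<Rightarrow> 'n) \<Rightarrow> bool" where
  "natural_iso A B Fo Fm Go Gm \<eta> \<longleftrightarrow>
     (\<forall>X\<in>Obj A. is_iso B (Fo X) (Go X) (\<eta> X)) \<and>
     (\<forall>X\<in>Obj A. \<forall>Y\<in>Obj A. \<forall>f\<in>Hom A X Y. Gm f \<bullet>\<^bsub>B\<^esub> \<eta> X = \<eta> Y \<bullet>\<^bsub>B\<^esub> Fm f)"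

definition is_equivalence ::
  "('o, 'm, 'k, 'e) lin_cat_scheme \<Rightarrow> ('p, 'n, 'l, 'd) lin_cat_scheme \<Rightarrow>
    ('o \<Rightarrow> 'p) \<Rightarrow> ('m \<Rightarrow> 'n) \<Rightarrow> bool" where
  "is_equivalence A B Fo Fm \<longleftrightarrow> is_functor A B Fo Fm \<and>
     (\<exists>Go Gm \<eta> \<epsilon>. is_functor B A Go Gm \<and>
        natural_iso A A (\<lambda>X. X) (\<lambda>f. f) (Go \<circ> Fo) (Gm \<circ> Fm) \<eta> \<and>
        natural_iso B B (Fo \<circ> Go) (Fm \<circ> Gm) (\<lambda>X. X) (\<lambda>f. f) \<epsilon>)"


section \<open>Monoidal and braided categories\<close>

text \<open>
  Monoidal categories are given by \<open>(\<otimes>, \<alpha>, 1, \<iota>)\<close> with \<open>\<iota> : 1 \<otimes> 1 \<rightarrow> 1\<close>, as in Etingof, Gelaki,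
  Nikshych and Ostrik, Tensor Categories, Definition 2.1.1; the unitors are derived from these
  data. With this presentation, replacing the associator by \<open>\<omega>\<alpha>\<close> gives a monoidal category also
  when the cocycle \<open>\<omega>\<close> is not normalized: the unitors change along with the associator.
\<close>

record ('o, 'm, 'k) mon_cat = "('o, 'm, 'k) lin_cat" +
  TensO :: "'o \<Rightarrow> 'o \<Rightarrow> 'o"  (infix \<open>\<odot>\<index>\<close> 75)
  TensM :: "'m \<Rightarrow> 'm \<Rightarrow> 'm"  (infix \<open>\<star>\<index>\<close> 75)
  Assoc :: "'o \<Rightarrow> 'o \<Rightarrow> 'o \<Rightarrow> 'm"
  UnitO :: "'o"
  Iota :: "'m"

record ('o, 'm, 'k) braided_cat = "('o, 'm, 'k) mon_cat" +
  Braid :: "'o \<Rightarrow> 'o \<Rightarrow> 'm"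

definition assoc_inv ::
  "('o, 'm, 'k, 'e) mon_cat_scheme \<Rightarrow> 'o \<Rightarrow> 'o \<Rightarrow> 'o \<Rightarrow> 'm" where
  "assoc_inv C X Y Z =
     iso_inv C ((X \<odot>\<^bsub>C\<^esub> Y) \<odot>\<^bsub>C\<^esub> Z) (X \<odot>\<^bsub>C\<^esub> (Y \<odot>\<^bsub>C\<^esub> Z)) (Assoc C X Y Z)"

locale monoidal_category = linear_category C
  for C :: "('o, 'm, 'k::field, 'e) mon_cat_scheme" (structure) +
  assumes tens_obj: "\<lbrakk>X \<in> Obj C; Y \<in> Obj C\<rbrakk> \<Longrightarrow> X \<odot> Y \<in> Obj C"
    and tens_closed:
      "\<lbrakk>X \<in> Obj C; Y \<in> Obj C; X' \<in> Obj C; Y' \<in> Obj C; f \<in> Hom C X Y; g \<in> Hom C X' Y'\<rbrakk>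
        \<Longrightarrow> f \<star> g \<in> Hom C (X \<odot> X') (Y \<odot> Y')"
    and tens_ident:
      "\<lbrakk>X \<in> Obj C; Y \<in> Obj C\<rbrakk> \<Longrightarrow> Ident C X \<star> Ident C Y = Ident C (X \<odot> Y)"
    and tens_comp:
      "\<lbrakk>X \<in> Obj C; Y \<in> Obj C; Z \<in> Obj C; X' \<in> Obj C; Y' \<in> Obj C; Z' \<in> Obj C;
        f \<in> Hom C X Y; g \<in> Hom C Y Z; f' \<in> Hom C X' Y'; g' \<in> Hom C Y' Z'\<rbrakk>
        \<Longrightarrow> (g \<bullet> f) \<star> (g' \<bullet> f') = (g \<star> g') \<bullet> (f \<star> f')"
    and tens_add_left:
      "\<lbrakk>X \<in> Obj C; Y \<in> Obj C; X' \<in> Obj C; Y' \<in> Obj C;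
        f \<in> Hom C X Y; g \<in> Hom C X Y; h \<in> Hom C X' Y'\<rbrakk>
        \<Longrightarrow> AddM C f g \<star> h = AddM C (f \<star> h) (g \<star> h)"
    and tens_add_right:
      "\<lbrakk>X \<in> Obj C; Y \<in> Obj C; X' \<in> Obj C; Y' \<in> Obj C;
        f \<in> Hom C X Y; g \<in> Hom C X' Y'; h \<in> Hom C X' Y'\<rbrakk>
        \<Longrightarrow> f \<star> AddM C g h = AddM C (f \<star> g) (f \<star> h)"
    and tens_scale_left:
      "\<lbrakk>X \<in> Obj C; Y \<in> Obj C; X' \<in> Obj C; Y' \<in> Obj C; f \<in> Hom C X Y; g \<in> Hom C X' Y'\<rbrakk>
        \<Longrightarrow> Scale C a f \<star> g = Scale C a (f \<star> g)"
    and tens_scale_right: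
      "\<lbrakk>X \<in> Obj C; Y \<in> Obj C; X' \<in> Obj C; Y' \<in> Obj C; f \<in> Hom C X Y; g \<in> Hom C X' Y'\<rbrakk>
        \<Longrightarrow> f \<star> Scale C a g = Scale C a (f \<star> g)"
    and assoc_iso:
      "\<lbrakk>X \<in> Obj C; Y \<in> Obj C; Z \<in> Obj C\<rbrakk>
        \<Longrightarrow> is_iso C ((X \<odot> Y) \<odot> Z) (X \<odot> (Y \<odot> Z)) (Assoc C X Y Z)"
    and assoc_natural:
      "\<lbrakk>X \<in> Obj C; Y \<in> Obj C; Z \<in> Obj C; X' \<in> Obj C; Y' \<in> Obj C; Z' \<in> Obj C;
        f \<in> Hom C X X'; g \<in> Hom C Y Y'; h \<in> Hom C Z Z'\<rbrakk>
        \<Longrightarrow> Assoc C X' Y' Z' \<bullet> ((f \<star> g) \<star> h) = (f \<star> (g \<star> h)) \<bullet> Assoc C X Y Z"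
    and pentagon:
      "\<lbrakk>W \<in> Obj C; X \<in> Obj C; Y \<in> Obj C; Z \<in> Obj C\<rbrakk>
        \<Longrightarrow> (Ident C W \<star> Assoc C X Y Z) \<bullet> Assoc C W (X \<odot> Y) Z \<bullet> (Assoc C W X Y \<star> Ident C Z)
          = Assoc C W X (Y \<odot> Z) \<bullet> Assoc C (W \<odot> X) Y Z"
    and unit_obj: "UnitO C \<in> Obj C"
    and iota_iso: "is_iso C (UnitO C \<odot> UnitO C) (UnitO C) (Iota C)"
    and unit_tens_equivalence:
      "is_equivalence C C (\<lambda>X. UnitO C \<odot> X) (\<lambda>f. Ident C (UnitO C) \<star> f)"
    and tens_unit_equivalence:
      "is_equivalence C C (\<lambda>X. X \<odot> UnitO C) (\<lambda>f. f \<star> Ident C (UnitO C))"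

definition left_unitor :: "('o, 'm, 'k, 'e) mon_cat_scheme \<Rightarrow> 'o \<Rightarrow> 'm" where
  "left_unitor C X = (THE l. l \<in> Hom C (UnitO C \<odot>\<^bsub>C\<^esub> X) X \<and>
     Ident C (UnitO C) \<star>\<^bsub>C\<^esub> l =
       (Iota C \<star>\<^bsub>C\<^esub> Ident C X) \<bullet>\<^bsub>C\<^esub> assoc_inv C (UnitO C) (UnitO C) X)"

definition right_unitor :: "('o, 'm, 'k, 'e) mon_cat_scheme \<Rightarrow> 'o \<Rightarrow> 'm" where
  "right_unitor C X = (THE r. r \<in> Hom C (X \<odot>\<^bsub>C\<^esub> UnitO C) X \<and>
     r \<star>\<^bsub>C\<^esub> Ident C (UnitO C) =
       (Ident C X \<star>\<^bsub>C\<^esub> Iota C) \<bullet>\<^bsub>C\<^esub> Assoc C X (UnitO C) (UnitO C))"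

locale braided_monoidal_category = monoidal_category B
  for B :: "('o, 'm, 'k::field, 'e) braided_cat_scheme" (structure) +
  assumes braid_iso:
      "\<lbrakk>X \<in> Obj B; Y \<in> Obj B\<rbrakk> \<Longrightarrow> is_iso B (X \<odot> Y) (Y \<odot> X) (Braid B X Y)"
    and braid_natural:
      "\<lbrakk>X \<in> Obj B; Y \<in> Obj B; X' \<in> Obj B; Y' \<in> Obj B; f \<in> Hom B X X'; g \<in> Hom B Y Y'\<rbrakk>
        \<Longrightarrow> Braid B X' Y' \<bullet> (f \<star> g) = (g \<star> f) \<bullet> Braid B X Y"
    and hexagon1:
      "\<lbrakk>X \<in> Obj B; Y \<in> Obj B; Z \<in> Obj B\<rbrakk>
        \<Longrightarrow> Assoc B Y Z X \<bullet> Braid B X (Y \<odot> Z) \<bullet> Assoc B X Y Z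
          = (Ident B Y \<star> Braid B X Z) \<bullet> Assoc B Y X Z \<bullet> (Braid B X Y \<star> Ident B Z)"
    and hexagon2:
      "\<lbrakk>X \<in> Obj B; Y \<in> Obj B; Z \<in> Obj B\<rbrakk>
        \<Longrightarrow> assoc_inv B Z X Y \<bullet> Braid B (X \<odot> Y) Z \<bullet> assoc_inv B X Y Z
          = (Braid B X Z \<star> Ident B Y) \<bullet> assoc_inv B X Z Y \<bullet> (Ident B X \<star> Braid B Y Z)"

text \<open>
  A monoidal functor carries natural isomorphisms \<open>J : F X \<otimes> F Y \<rightarrow> F (X \<otimes> Y)\<close> compatible with the
  associators, and maps the unit to an object isomorphic to the unit. A unit isomorphism
  compatible with the unitors then exists and is unique (loc. cit., Definition 2.4.1).
\<close>

definition is_monoidal_functor ::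
  "('o, 'm, 'k, 'e) mon_cat_scheme \<Rightarrow> ('p, 'n, 'k, 'd) mon_cat_scheme \<Rightarrow>
    ('o \<Rightarrow> 'p) \<Rightarrow> ('m \<Rightarrow> 'n) \<Rightarrow> ('o \<Rightarrow> 'o \<Rightarrow> 'n) \<Rightarrow> bool" where
  "is_monoidal_functor A B Fo Fm J \<longleftrightarrow> is_linear_functor A B Fo Fm \<and>
     (\<exists>u. is_iso B (UnitO B) (Fo (UnitO A)) u) \<and>
     (\<forall>X\<in>Obj A. \<forall>Y\<in>Obj A. is_iso B (Fo X \<odot>\<^bsub>B\<^esub> Fo Y) (Fo (X \<odot>\<^bsub>A\<^esub> Y)) (J X Y)) \<and>
     (\<forall>X\<in>Obj A. \<forall>Y\<in>Obj A. \<forall>X'\<in>Obj A. \<forall>Y'\<in>Obj A. \<forall>f\<in>Hom A X X'. \<forall>g\<in>Hom A Y Y'.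
        J X' Y' \<bullet>\<^bsub>B\<^esub> (Fm f \<star>\<^bsub>B\<^esub> Fm g) = Fm (f \<star>\<^bsub>A\<^esub> g) \<bullet>\<^bsub>B\<^esub> J X Y) \<and>
     (\<forall>X\<in>Obj A. \<forall>Y\<in>Obj A. \<forall>Z\<in>Obj A.
        Fm (Assoc A X Y Z) \<bullet>\<^bsub>B\<^esub> J (X \<odot>\<^bsub>A\<^esub> Y) Z \<bullet>\<^bsub>B\<^esub> (J X Y \<star>\<^bsub>B\<^esub> Ident B (Fo Z))
        = J X (Y \<odot>\<^bsub>A\<^esub> Z) \<bullet>\<^bsub>B\<^esub> (Ident B (Fo X) \<star>\<^bsub>B\<^esub> J Y Z)
            \<bullet>\<^bsub>B\<^esub> Assoc B (Fo X) (Fo Y) (Fo Z))"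

definition braided_tensor_equivalence ::
  "('o, 'm, 'k::field, 'e) braided_cat_scheme \<Rightarrow> ('p, 'n, 'k, 'd) braided_cat_scheme \<Rightarrow>
    ('o \<Rightarrow> 'p) \<Rightarrow> ('m \<Rightarrow> 'n) \<Rightarrow> ('o \<Rightarrow> 'o \<Rightarrow> 'n) \<Rightarrow> bool" where
  "braided_tensor_equivalence A B Fo Fm J \<longleftrightarrow>
     braided_monoidal_category A \<and> braided_monoidal_category B \<and>
     is_monoidal_functor A B Fo Fm J \<and> is_equivalence A B Fo Fm \<and>
     (\<forall>X\<in>Obj A. \<forall>Y\<in>Obj A.
        Fm (Braid A X Y) \<bullet>\<^bsub>B\<^esub> J X Y = J Y X \<bullet>\<^bsub>B\<^esub> Braid B (Fo X) (Fo Y))"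


section \<open>Gradings, abelian cocycles and twists\<close>

text \<open>
  The abelian group is written additively. A grading is given by the classes \<open>D g\<close> of objects
  of the full subcategories \<open>\<C>\<^sub>g\<close>. The category is their direct sum: there are no nonzero
  morphisms between different degrees, and every object is a finite direct sum of homogeneous
  objects of distinct degrees.
\<close>

locale graded_category = linear_category C
  for C :: "('o, 'm, 'k::field, 'e) lin_cat_scheme" (structure) +
  fixes D :: "'g \<Rightarrow> 'o set"
  assumes homogeneous_obj: "D g \<subseteq> Obj C"
    and hom_distinct_degrees:
      "\<lbrakk>g \<noteq> h; X \<in> D g; Y \<in> D h\<rbrakk> \<Longrightarrow> Hom C X Y = {ZeroM C X Y}"
    and decomposition:
      "X \<in> Obj C \<Longrightarrow> \<exists>S Xs i p. finite S \<and>
         (\<forall>g\<in>S. Xs g \<in> D g \<and> i g \<in> Hom C (Xs g) X \<and> p g \<in> Hom C X (Xs g)) \<and>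
         (\<forall>g\<in>S. \<forall>h\<in>S. p h \<bullet> i g = (if g = h then Ident C (Xs g) else ZeroM C (Xs g) (Xs h))) \<and>
         Ident C X = finsum (hom_group C X X) (\<lambda>g. i g \<bullet> p g) S"

locale graded_monoidal_category = monoidal_category C + graded_category C D
  for C :: "('o, 'm, 'k::field, 'e) mon_cat_scheme" (structure)
    and D :: "'g::ab_group_add \<Rightarrow> 'o set" +
  assumes unit_degree: "UnitO C \<in> D 0"
    and tens_degree: "\<lbrakk>X \<in> D g; Y \<in> D h\<rbrakk> \<Longrightarrow> X \<odot> Y \<in> D (g + h)"

definition abelian_3_cocycle ::
  "('g::ab_group_add \<Rightarrow> 'g \<Rightarrow> 'g \<Rightarrow> 'k::field) \<Rightarrow> ('g \<Rightarrow> 'g \<Rightarrow> 'k) \<Rightarrow> bool" where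
  "abelian_3_cocycle \<omega> \<gamma> \<longleftrightarrow>
     (\<forall>g1 g2 g3. \<omega> g1 g2 g3 \<noteq> 0) \<and> (\<forall>g1 g2. \<gamma> g1 g2 \<noteq> 0) \<and>
     (\<forall>g1 g2 g3 g4. \<omega> g1 g2 g3 * \<omega> g1 (g2 + g3) g4 * \<omega> g2 g3 g4
        = \<omega> (g1 + g2) g3 g4 * \<omega> g1 g2 (g3 + g4)) \<and>
     (\<forall>g1 g2 g3. \<omega> g2 g3 g1 * \<gamma> g1 (g2 + g3) * \<omega> g1 g2 g3
        = \<gamma> g1 g3 * \<omega> g2 g1 g3 * \<gamma> g1 g2) \<and>
     (\<forall>g1 g2 g3. inverse (\<omega> g3 g1 g2) * \<gamma> (g1 + g2) g3 * inverse (\<omega> g1 g2 g3)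
        = \<gamma> g1 g3 * inverse (\<omega> g1 g3 g2) * \<gamma> g2 g3)"

text \<open>
  The projection of \<open>X\<close> onto its component of degree \<open>g\<close>, as an idempotent endomorphism
  of \<open>X\<close>: the endomorphism that fixes morphisms from objects of degree \<open>g\<close> and kills those from
  objects of any other degree.
\<close>

definition degree_proj ::
  "('o, 'm, 'k, 'e) lin_cat_scheme \<Rightarrow> ('g \<Rightarrow> 'o set) \<Rightarrow> 'g \<Rightarrow> 'o \<Rightarrow> 'm" where
  "degree_proj C D g X = (THE e. e \<in> Hom C X X \<and>
     (\<forall>h. \<forall>Y\<in>D h. \<forall>f\<in>Hom C Y X. e \<bullet>\<^bsub>C\<^esub> f = (if h = g then f else ZeroM C Y X)))"

definition degrees :: "('o, 'm, 'k, 'e) lin_cat_scheme \<Rightarrow> ('g \<Rightarrow> 'o set) \<Rightarrow> 'o \<Rightarrow> 'g set" where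
  "degrees C D X = {g. degree_proj C D g X \<noteq> ZeroM C X X}"

text \<open>
  The twisting formulas prescribe the value on homogeneous objects. On arbitrary objects the
  twisted morphism is their direct sum over the homogeneous components; see
  \<open>assoc_twist_homogeneous\<close> and \<open>twist2_homogeneous\<close> below.
\<close>

definition assoc_twist ::
  "('o, 'm, 'k, 'e) mon_cat_scheme \<Rightarrow> ('g \<Rightarrow> 'o set) \<Rightarrow> ('g \<Rightarrow> 'g \<Rightarrow> 'g \<Rightarrow> 'k) \<Rightarrow>
    ('o, 'm, 'k, 'e) mon_cat_scheme" where
  "assoc_twist C D \<omega> = C\<lparr>Assoc := \<lambda>X Y Z.
     finsum (hom_group C ((X \<odot>\<^bsub>C\<^esub> Y) \<odot>\<^bsub>C\<^esub> Z) (X \<odot>\<^bsub>C\<^esub> (Y \<odot>\<^bsub>C\<^esub> Z)))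
       (\<lambda>(g, h, k). Scale C (\<omega> g h k) (Assoc C X Y Z \<bullet>\<^bsub>C\<^esub>
          ((degree_proj C D g X \<star>\<^bsub>C\<^esub> degree_proj C D h Y) \<star>\<^bsub>C\<^esub> degree_proj C D k Z)))
       (degrees C D X \<times> degrees C D Y \<times> degrees C D Z)\<rparr>"

text \<open>For \<open>f : X \<otimes> Y \<rightarrow> Y \<otimes> X\<close>:\<close>

definition twist2 ::
  "('o, 'm, 'k, 'e) mon_cat_scheme \<Rightarrow> ('g \<Rightarrow> 'o set) \<Rightarrow> ('g \<Rightarrow> 'g \<Rightarrow> 'k) \<Rightarrow>
    'o \<Rightarrow> 'o \<Rightarrow> 'm \<Rightarrow> 'm" where
  "twist2 C D \<gamma> X Y f =
     finsum (hom_group C (X \<odot>\<^bsub>C\<^esub> Y) (Y \<odot>\<^bsub>C\<^esub> X))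
       (\<lambda>(g, h). Scale C (\<gamma> g h)
          (f \<bullet>\<^bsub>C\<^esub> (degree_proj C D g X \<star>\<^bsub>C\<^esub> degree_proj C D h Y)))
       (degrees C D X \<times> degrees C D Y)"

definition braided_twist ::
  "('o, 'm, 'k, 'e) braided_cat_scheme \<Rightarrow> ('g \<Rightarrow> 'o set) \<Rightarrow>
    ('g \<Rightarrow> 'g \<Rightarrow> 'g \<Rightarrow> 'k) \<Rightarrow> ('g \<Rightarrow> 'g \<Rightarrow> 'k) \<Rightarrow> ('o, 'm, 'k, 'e) braided_cat_scheme" where
  "braided_twist B D \<omega> \<gamma> =
     (assoc_twist B D \<omega>)\<lparr>Braid := \<lambda>X Y. twist2 B D \<gamma> X Y (Braid B X Y)\<rparr>"


section \<open>The Drinfeld center\<close>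

text \<open>
  A half-braiding is made \<^emph>\<open>extensional\<close>, so that it is determined by its components at
  objects of the category.
\<close>

definition half_braiding :: "('o, 'm, 'k, 'e) mon_cat_scheme \<Rightarrow> 'o \<Rightarrow> ('o \<Rightarrow> 'm) \<Rightarrow> bool" where
  "half_braiding C X \<phi> \<longleftrightarrow> \<phi> \<in> extensional (Obj C) \<and>
     natural_iso C C (\<lambda>Y. X \<odot>\<^bsub>C\<^esub> Y) (\<lambda>f. Ident C X \<star>\<^bsub>C\<^esub> f)
       (\<lambda>Y. Y \<odot>\<^bsub>C\<^esub> X) (\<lambda>f. f \<star>\<^bsub>C\<^esub> Ident C X) \<phi> \<and>
     (\<forall>Y\<in>Obj C. \<forall>Z\<in>Obj C.
        Assoc C Y Z X \<bullet>\<^bsub>C\<^esub> \<phi> (Y \<odot>\<^bsub>C\<^esub> Z) \<bullet>\<^bsub>C\<^esub> Assoc C X Y Z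
        = (Ident C Y \<star>\<^bsub>C\<^esub> \<phi> Z) \<bullet>\<^bsub>C\<^esub> Assoc C Y X Z \<bullet>\<^bsub>C\<^esub> (\<phi> Y \<star>\<^bsub>C\<^esub> Ident C Z))"

definition tens_half_braiding ::
  "('o, 'm, 'k, 'e) mon_cat_scheme \<Rightarrow> 'o \<Rightarrow> ('o \<Rightarrow> 'm) \<Rightarrow> 'o \<Rightarrow> ('o \<Rightarrow> 'm) \<Rightarrow> 'o \<Rightarrow> 'm" where
  "tens_half_braiding C X \<phi> X' \<phi>' = (\<lambda>Y\<in>Obj C.
     Assoc C Y X X' \<bullet>\<^bsub>C\<^esub> (\<phi> Y \<star>\<^bsub>C\<^esub> Ident C X') \<bullet>\<^bsub>C\<^esub> assoc_inv C X Y X' \<bullet>\<^bsub>C\<^esub>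
       (Ident C X \<star>\<^bsub>C\<^esub> \<phi>' Y) \<bullet>\<^bsub>C\<^esub> Assoc C X X' Y)"

definition unit_half_braiding :: "('o, 'm, 'k, 'e) mon_cat_scheme \<Rightarrow> 'o \<Rightarrow> 'm" where
  "unit_half_braiding C = (\<lambda>Y\<in>Obj C.
     iso_inv C (Y \<odot>\<^bsub>C\<^esub> UnitO C) Y (right_unitor C Y) \<bullet>\<^bsub>C\<^esub> left_unitor C Y)"

definition center ::
  "('o, 'm, 'k, 'e) mon_cat_scheme \<Rightarrow> ('o \<times> ('o \<Rightarrow> 'm), 'm, 'k) braided_cat" where
  "center C =
     \<lparr>Obj = {(X, \<phi>). X \<in> Obj C \<and> half_braiding C X \<phi>},
      Hom = (\<lambda>(X, \<phi>) (X', \<phi>'). {f \<in> Hom C X X'.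
        \<forall>Y\<in>Obj C. (Ident C Y \<star>\<^bsub>C\<^esub> f) \<bullet>\<^bsub>C\<^esub> \<phi> Y = \<phi>' Y \<bullet>\<^bsub>C\<^esub> (f \<star>\<^bsub>C\<^esub> Ident C Y)}),
      Ident = (\<lambda>(X, \<phi>). Ident C X),
      Comp = Comp C,
      ZeroM = (\<lambda>(X, \<phi>) (X', \<phi>'). ZeroM C X X'),
      AddM = AddM C,
      Scale = Scale C,
      TensO = (\<lambda>(X, \<phi>) (X', \<phi>'). (X \<odot>\<^bsub>C\<^esub> X', tens_half_braiding C X \<phi> X' \<phi>')),
      TensM = TensM C,
      Assoc = (\<lambda>(X, \<phi>) (X', \<phi>') (X'', \<phi>''). Assoc C X X' X''),
      UnitO = (UnitO C, unit_half_braiding C),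
      Iota = Iota C,
      Braid = (\<lambda>(X, \<phi>) (X', \<phi>'). \<phi> X')\<rparr>"

definition center_grading ::
  "('o, 'm, 'k, 'e) mon_cat_scheme \<Rightarrow> ('g \<Rightarrow> 'o set) \<Rightarrow> 'g \<Rightarrow> ('o \<times> ('o \<Rightarrow> 'm)) set" where
  "center_grading C D g = {(X, \<phi>). (X, \<phi>) \<in> Obj (center C) \<and> X \<in> D g}"

text \<open>
  On homogeneous objects this is \<open>\<phi>\<^sup>\<delta>\<close> with \<open>\<phi>\<^sup>\<delta> Y = \<delta> g h \<phi> Y\<close>. For an abelian cocycle \<open>(\<omega>, \<gamma>)\<close> the
  hexagon for \<open>\<gamma>\<close> shows that \<open>\<phi> \<mapsto> \<phi>\<^sup>\<gamma>\<close> turns half-braidings for the associator \<open>\<alpha>\<close> into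
  half-braidings for \<open>\<omega>\<alpha>\<close>. A functor from the center of the twisted category to the center of the
  original one therefore uses \<open>\<delta> = \<gamma>\<^sup>-\<^sup>1\<close>.
\<close>

definition half_braiding_twist ::
  "('o, 'm, 'k, 'e) mon_cat_scheme \<Rightarrow> ('g \<Rightarrow> 'o set) \<Rightarrow> ('g \<Rightarrow> 'g \<Rightarrow> 'k) \<Rightarrow>
    'o \<Rightarrow> ('o \<Rightarrow> 'm) \<Rightarrow> 'o \<Rightarrow> 'm" where
  "half_braiding_twist C D \<delta> X \<phi> = (\<lambda>Y\<in>Obj C. twist2 C D \<delta> X Y (\<phi> Y))"


section \<open>The twists on homogeneous objects\<close>

context graded_category
begin

lemma homogeneousD: "X \<in> D g \<Longrightarrow> X \<in> Obj C"
  using homogeneous_obj by blast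

lemma zero_closed: "\<lbrakk>X \<in> Obj C; Y \<in> Obj C\<rbrakk> \<Longrightarrow> ZeroM C X Y \<in> Hom C X Y"
  using abelian_monoid.zero_closed[OF abelian_group.axioms(1)[OF hom_abelian]]
  by (simp add: hom_group_def)

lemma add_self_zero:
  assumes "X \<in> Obj C" "Y \<in> Obj C" "f \<in> Hom C X Y" "AddM C f f = f"
  shows "f = ZeroM C X Y"
proof -
  interpret A: abelian_group "hom_group C X Y" using hom_abelian assms by blast
  have "f \<in> carrier (hom_group C X Y)" "f \<oplus>\<^bsub>hom_group C X Y\<^esub> f = f"
    using assms by (simp_all add: hom_group_def)
  then have "f = \<zero>\<^bsub>hom_group C X Y\<^esub>"
    by (metis A.a_assoc A.r_neg A.r_zero A.a_inv_closed)
  then show ?thesis by (simp add: hom_group_def)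
qed

lemma zero_add_zero:
  assumes "X \<in> Obj C" "Y \<in> Obj C"
  shows "AddM C (ZeroM C X Y) (ZeroM C X Y) = ZeroM C X Y"
  using abelian_monoid.l_zero[OF abelian_group.axioms(1)[OF hom_abelian[OF assms]], of "ZeroM C X Y"]
    zero_closed[OF assms] by (simp add: hom_group_def)

lemma zero_comp:
  assumes "X \<in> Obj C" "Y \<in> Obj C" "Z \<in> Obj C" "f \<in> Hom C X Y"
  shows "ZeroM C Y Z \<bullet> f = ZeroM C X Z"
proof -
  let ?z = "ZeroM C Y Z"
  have z: "?z \<in> Hom C Y Z" using zero_closed assms by blast
  have "AddM C ?z ?z = ?z" using zero_add_zero[OF assms(2,3)] .
  then have "AddM C (?z \<bullet> f) (?z \<bullet> f) = ?z \<bullet> f"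
    using comp_add_left[OF assms z z] by simp
  then show ?thesis
    using add_self_zero comp_closed[OF assms z] assms by blast
qed

lemma degree_proj_homogeneous:
  assumes X: "X \<in> D g"
  shows "degree_proj C D h X = (if h = g then Ident C X else ZeroM C X X)"
proof -
  note Xo = homogeneousD[OF X]
  show ?thesis unfolding degree_proj_def
  proof (rule the_equality, intro conjI allI ballI)
    show "(if h = g then Ident C X else ZeroM C X X) \<in> Hom C X X"
      using Xo ident_closed zero_closed by simp
  next
    fix k Y f assume Y: "Y \<in> D k" and f: "f \<in> Hom C Y X"
    have "f = ZeroM C Y X" if "k \<noteq> g" using hom_distinct_degrees[OF that Y X] f by blast
    then show "(if h = g then Ident C X else ZeroM C X X) \<bullet> f = (if k = h then f else ZeroM C Y X)"
      using Xo homogeneousD[OF Y] f ident_comp zero_comp by auto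
  next
    fix e assume e: "e \<in> Hom C X X \<and> (\<forall>k. \<forall>Y\<in>D k. \<forall>f\<in>Hom C Y X.
      e \<bullet> f = (if k = h then f else ZeroM C Y X))"
    then have "e \<bullet> Ident C X = (if g = h then Ident C X else ZeroM C X X)"
      using X ident_closed[OF Xo] by blast
    then show "e = (if h = g then Ident C X else ZeroM C X X)"
      using comp_ident[OF Xo Xo] e by auto
  qed
qed

lemma degrees_homogeneous:
  assumes "X \<in> D g"
  shows "degrees C D X = (if Ident C X = ZeroM C X X then {} else {g})"
  using degree_proj_homogeneous[OF assms] by (auto simp: degrees_def)

end

context graded_monoidal_category
begin

lemma scale_zero:
  assumes "X \<in> Obj C" "Y \<in> Obj C"
  shows "Scale C a (ZeroM C X Y) = ZeroM C X Y"
proof -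
  let ?z = "ZeroM C X Y"
  have z: "?z \<in> Hom C X Y" using zero_closed assms by blast
  have "AddM C ?z ?z = ?z" using zero_add_zero[OF assms] .
  then have "AddM C (Scale C a ?z) (Scale C a ?z) = Scale C a ?z"
    using scale_add_right[OF assms z z, of a] by simp
  then show ?thesis
    using add_self_zero scale_closed[OF assms z] assms by blast
qed

lemma tens_zero_left:
  assumes "X \<in> Obj C" "Y \<in> Obj C" "X' \<in> Obj C" "Y' \<in> Obj C" "f \<in> Hom C X' Y'"
  shows "ZeroM C X Y \<star> f = ZeroM C (X \<odot> X') (Y \<odot> Y')"
proof -
  let ?z = "ZeroM C X Y"
  have z: "?z \<in> Hom C X Y" using zero_closed assms by blast
  have "AddM C ?z ?z = ?z" using zero_add_zero[OF assms(1,2)] .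
  then have "AddM C (?z \<star> f) (?z \<star> f) = ?z \<star> f"
    using tens_add_left[OF assms(1-4) z z assms(5)] by simp
  then show ?thesis
    using add_self_zero tens_closed[OF assms(1-4) z assms(5)] tens_obj assms by blast
qed

lemma tens_zero_right:
  assumes "X \<in> Obj C" "Y \<in> Obj C" "X' \<in> Obj C" "Y' \<in> Obj C" "f \<in> Hom C X Y"
  shows "f \<star> ZeroM C X' Y' = ZeroM C (X \<odot> X') (Y \<odot> Y')"
proof -
  let ?z = "ZeroM C X' Y'"
  have z: "?z \<in> Hom C X' Y'" using zero_closed assms by blast
  have "AddM C ?z ?z = ?z" using zero_add_zero[OF assms(3,4)] .
  then have "AddM C (f \<star> ?z) (f \<star> ?z) = f \<star> ?z"
    using tens_add_right[OF assms(1-5) z z] by simp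
  then show ?thesis
    using add_self_zero tens_closed[OF assms(1-5) z] tens_obj assms by blast
qed

lemma hom_zero_if_ident_zero:
  assumes "X \<in> Obj C" "Y \<in> Obj C" "f \<in> Hom C X Y" "Ident C X = ZeroM C X X"
  shows "f = ZeroM C X Y"
proof -
  let ?z = "ZeroM C X X"
  have z: "?z \<in> Hom C X X" using zero_closed assms by blast
  have "AddM C ?z ?z = ?z" using zero_add_zero[OF assms(1,1)] .
  then have "AddM C (f \<bullet> ?z) (f \<bullet> ?z) = f \<bullet> ?z"
    using comp_add_right[OF assms(1,1,2) z z assms(3)] by simp
  moreover have "f \<bullet> ?z = f" using comp_ident[OF assms(1-3)] assms(4) by simp
  ultimately show ?thesis using add_self_zero assms by simp
qed

lemma finsum_hom_empty: "finsum (hom_group C X Y) f {} = ZeroM C X Y"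
  if "X \<in> Obj C" "Y \<in> Obj C"
  using abelian_monoid.finsum_empty[OF abelian_group.axioms(1)[OF hom_abelian[OF that]]]
  by (simp add: hom_group_def)

lemma finsum_hom_singleton: "finsum (hom_group C X Y) f {a} = f a"
  if "X \<in> Obj C" "Y \<in> Obj C" "f a \<in> Hom C X Y"
proof -
  interpret A: abelian_group "hom_group C X Y" using hom_abelian that by blast
  have c: "carrier (hom_group C X Y) = Hom C X Y" by (simp add: hom_group_def)
  show ?thesis
    using A.finsum_insert[of "{}" a f] A.r_zero[of "f a"] that(3) c by simp
qed

lemma twist2_homogeneous:
  assumes X: "X \<in> D g" and Y: "Y \<in> D h" and f: "f \<in> Hom C (X \<odot> Y) (Y \<odot> X)"
  shows "twist2 C D \<gamma> X Y f = Scale C (\<gamma> g h) f"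
proof -
  note Xo = homogeneousD[OF X] and Yo = homogeneousD[OF Y]
  note XY = tens_obj[OF Xo Yo] and YX = tens_obj[OF Yo Xo]
  have sf: "Scale C (\<gamma> g h) f \<in> Hom C (X \<odot> Y) (Y \<odot> X)" using scale_closed[OF XY YX f] .
  show ?thesis
  proof (cases "Ident C X = ZeroM C X X \<or> Ident C Y = ZeroM C Y Y")
    case True
    then have "Ident C (X \<odot> Y) = ZeroM C (X \<odot> Y) (X \<odot> Y)"
      using tens_ident[OF Xo Yo] tens_zero_left[OF Xo Xo Yo Yo ident_closed[OF Yo]]
        tens_zero_right[OF Xo Xo Yo Yo ident_closed[OF Xo]] by auto
    then have "Scale C (\<gamma> g h) f = ZeroM C (X \<odot> Y) (Y \<odot> X)"
      using hom_zero_if_ident_zero[OF XY YX sf] by simp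
    moreover have "degrees C D X \<times> degrees C D Y = {}"
      using True degrees_homogeneous[OF X] degrees_homogeneous[OF Y] by auto
    ultimately show ?thesis unfolding twist2_def by (simp only: finsum_hom_empty[OF XY YX])
  next
    case False
    then have "degrees C D X \<times> degrees C D Y = {(g, h)}"
      using degrees_homogeneous[OF X] degrees_homogeneous[OF Y] by auto
    then show ?thesis
      using finsum_hom_singleton[OF XY YX, of _ "(g, h)"] sf comp_ident[OF XY YX f]
      by (simp add: twist2_def degree_proj_homogeneous[OF X] degree_proj_homogeneous[OF Y]
          tens_ident[OF Xo Yo])
  qed
qed

lemma assoc_twist_homogeneous:
  assumes X: "X \<in> D g" and Y: "Y \<in> D h" and Z: "Z \<in> D k"
  shows "Assoc (assoc_twist C D \<omega>) X Y Z = Scale C (\<omega> g h k) (Assoc C X Y Z)"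
proof -
  note Xo = homogeneousD[OF X] and Yo = homogeneousD[OF Y] and Zo = homogeneousD[OF Z]
  note XY = tens_obj[OF Xo Yo]
  note P = tens_obj[OF XY Zo] and Q = tens_obj[OF Xo tens_obj[OF Yo Zo]]
  have a: "Assoc C X Y Z \<in> Hom C ((X \<odot> Y) \<odot> Z) (X \<odot> (Y \<odot> Z))"
    using assoc_iso[OF Xo Yo Zo] by (auto simp: is_iso_def inverse_pair_def)
  have sa: "Scale C (\<omega> g h k) (Assoc C X Y Z) \<in> Hom C ((X \<odot> Y) \<odot> Z) (X \<odot> (Y \<odot> Z))"
    using scale_closed[OF P Q a] .
  show ?thesis
  proof (cases "Ident C X = ZeroM C X X \<or> Ident C Y = ZeroM C Y Y \<or> Ident C Z = ZeroM C Z Z")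
    case True
    then have "Ident C (X \<odot> Y) = ZeroM C (X \<odot> Y) (X \<odot> Y) \<or> Ident C Z = ZeroM C Z Z"
      using tens_ident[OF Xo Yo] tens_zero_left[OF Xo Xo Yo Yo ident_closed[OF Yo]]
        tens_zero_right[OF Xo Xo Yo Yo ident_closed[OF Xo]] by auto
    then have "Ident C ((X \<odot> Y) \<odot> Z) = ZeroM C ((X \<odot> Y) \<odot> Z) ((X \<odot> Y) \<odot> Z)"
      using tens_ident[OF XY Zo] tens_zero_left[OF XY XY Zo Zo ident_closed[OF Zo]]
        tens_zero_right[OF XY XY Zo Zo ident_closed[OF XY]] by auto
    then have "Scale C (\<omega> g h k) (Assoc C X Y Z) = ZeroM C ((X \<odot> Y) \<odot> Z) (X \<odot> (Y \<odot> Z))"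
      using hom_zero_if_ident_zero[OF P Q sa] by simp
    moreover have "degrees C D X \<times> degrees C D Y \<times> degrees C D Z = {}"
      using True degrees_homogeneous[OF X] degrees_homogeneous[OF Y] degrees_homogeneous[OF Z]
      by auto
    ultimately show ?thesis by (auto simp: assoc_twist_def finsum_hom_empty[OF P Q])
  next
    case False
    then have "degrees C D X \<times> degrees C D Y \<times> degrees C D Z = {(g, h, k)}"
      using degrees_homogeneous[OF X] degrees_homogeneous[OF Y] degrees_homogeneous[OF Z] by auto
    then show ?thesis
      using finsum_hom_singleton[OF P Q, of _ "(g, h, k)"] sa comp_ident[OF P Q a]
      by (simp add: assoc_twist_def degree_proj_homogeneous[OF X] degree_proj_homogeneous[OF Y]
          degree_proj_homogeneous[OF Z] tens_ident[OF Xo Yo] tens_ident[OF XY Zo])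
  qed
qed

end

end

theory Submission
  imports Defs
begin

text \<open>
  The functor is the identity on morphisms and multiplies half-braidings by \<open>\<delta> = \<gamma>\<^sup>-\<^sup>1\<close>. It is a
  bijection on objects that preserves the whole structure strictly, so that it is enough to compare
  the data (\<open>strict_iso_braided_tensor_equivalence\<close>). The pentagon for \<open>\<omega>\<close> makes \<open>\<omega>\<alpha>\<close> an associator
  (\<open>assoc_twist_graded_monoidal\<close>). The first hexagon for \<open>(\<omega>, \<gamma>)\<close> says that multiplication by \<open>\<gamma>\<close>
  turns half-braidings for \<open>\<alpha>\<close> into half-braidings for \<open>\<omega>\<alpha>\<close> (\<open>ctw_obj\<close>); multiplication by \<open>\<delta>\<close> is the
  inverse map, by the same lemma for \<open>(\<omega>\<^sup>-\<^sup>1, \<delta>)\<close>. The second hexagon says that multiplication by \<open>\<delta>\<close>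
  is compatible with the tensor product of half-braidings (\<open>twh_T_thb\<close>). The braiding \<open>\<phi>\<close> of the
  source is \<open>\<gamma>\<close> times the half-braiding \<open>\<delta>\<phi>\<close> (\<open>center_braid_twist\<close>). The unit is preserved because
  an abelian cocycle satisfies \<open>\<gamma> 0 h = \<omega> h 0 0\<^sup>-\<^sup>1 \<omega> 0 0 h\<^sup>-\<^sup>1\<close>, which is the change of the half-braiding of
  the unit under the twist (\<open>twh_T_uhb\<close>).

  These are identities between scalars on homogeneous objects only. On arbitrary objects both
  sides are natural transformations, and a natural transformation is determined by its values
  on homogeneous objects, because the identity of every object is a finite sum of morphisms that
  factor through such objects (\<open>covers_ext\<close>, \<open>covers_tns\<close>). In the variable that carries a half-braiding
  \<open>\<phi>\<close>, naturality is available for morphisms of the center only. Hence the homogeneous components of an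
  object of the center have to be objects of the center themselves (\<open>center_components\<close>). This holds
  because the group is abelian, which forces \<open>\<phi>\<close> to commute with the degree projections
  (\<open>hb_component_commutes\<close>); it also shows that the center is graded (\<open>center_graded_monoidal\<close>).

  It remains to see that the center of any monoidal category is a braided monoidal category
  (\<open>center_braided\<close>). The tensor product of half-braidings is handled by pentagons (\<open>hb_thb\<close>, \<open>im_as\<close>).
  For the unit the triangle and the compatibility of the unitors with tensor products have to be derived
  first, since the unitors are not part of the data (\<open>triangle\<close>, \<open>lu_tens\<close>, \<open>ru_tens\<close>).
  The target of the functor is monoidal as a twist of the graded category \<open>center C\<close>, and its
  braiding axioms are transported from the source.
\<close>

section \<open>Isomorphisms and zero morphisms in a linear category\<close>

context linear_category
begin

lemma inverse_pair_unique:
  assumes "X \<in> Obj C" "Y \<in> Obj C" "inverse_pair C X Y f g" "inverse_pair C X Y f h"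
  shows "g = h"
proof -
  have "g = (h \<bullet> f) \<bullet> g"
    using assms ident_comp[of Y X g] by (simp add: inverse_pair_def)
  also have "\<dots> = h \<bullet> (f \<bullet> g)"
    using assms comp_assoc[of Y X Y X g f h] by (simp add: inverse_pair_def)
  also have "\<dots> = h" using assms comp_ident[of Y X h] by (simp add: inverse_pair_def)
  finally show ?thesis .
qed

lemma iso_inv_eqI:
  assumes "X \<in> Obj C" "Y \<in> Obj C" "inverse_pair C X Y f g"
  shows "iso_inv C X Y f = g"
  unfolding iso_inv_def using assms inverse_pair_unique by blast

lemma inverse_pair_iso_inv:
  assumes "X \<in> Obj C" "Y \<in> Obj C" "is_iso C X Y f"
  shows "inverse_pair C X Y f (iso_inv C X Y f)"
  using assms iso_inv_eqI unfolding is_iso_def by blast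

lemma ident_inverse_pair: "X \<in> Obj C \<Longrightarrow> inverse_pair C X X (Ident C X) (Ident C X)"
  by (simp add: inverse_pair_def ident_closed comp_ident[of X X])

lemma ident_is_iso: "X \<in> Obj C \<Longrightarrow> is_iso C X X (Ident C X)"
  using ident_inverse_pair by (auto simp: is_iso_def)

lemma zero_in_hom: "\<lbrakk>X \<in> Obj C; Y \<in> Obj C\<rbrakk> \<Longrightarrow> ZeroM C X Y \<in> Hom C X Y"
  using abelian_monoid.zero_closed[OF abelian_group.axioms(1)[OF hom_abelian]]
  by (simp add: hom_group_def)

lemma add_in_hom:
  "\<lbrakk>X \<in> Obj C; Y \<in> Obj C; f \<in> Hom C X Y; g \<in> Hom C X Y\<rbrakk> \<Longrightarrow> AddM C f g \<in> Hom C X Y"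
  using abelian_monoid.a_closed[OF abelian_group.axioms(1)[OF hom_abelian]]
  by (simp add: hom_group_def)

lemma add_idem_zero:
  assumes "X \<in> Obj C" "Y \<in> Obj C" "f \<in> Hom C X Y" "AddM C f f = f"
  shows "f = ZeroM C X Y"
proof -
  interpret A: abelian_group "hom_group C X Y" using hom_abelian assms by blast
  have "f \<in> carrier (hom_group C X Y)" "f \<oplus>\<^bsub>hom_group C X Y\<^esub> f = f"
    using assms by (simp_all add: hom_group_def)
  then have "f = \<zero>\<^bsub>hom_group C X Y\<^esub>"
    by (metis A.a_assoc A.r_neg A.r_zero A.a_inv_closed)
  then show ?thesis by (simp add: hom_group_def)
qed

lemma scale_by_zero:
  assumes "X \<in> Obj C" "Y \<in> Obj C" "f \<in> Hom C X Y"
  shows "Scale C 0 f = ZeroM C X Y"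
  using add_idem_zero[OF assms(1,2) scale_closed[OF assms, of 0]] scale_add_left[OF assms, of 0 0]
  by simp

lemma comp_zero_right:
  assumes "X \<in> Obj C" "Y \<in> Obj C" "Z \<in> Obj C" "g \<in> Hom C Y Z"
  shows "g \<bullet> ZeroM C X Y = ZeroM C X Z"
  using comp_scale_right[OF assms(1-3) zero_in_hom[OF assms(1,2)] assms(4), of 0]
    scale_by_zero assms zero_in_hom comp_closed by metis

lemma comp_zero_left:
  assumes "X \<in> Obj C" "Y \<in> Obj C" "Z \<in> Obj C" "f \<in> Hom C X Y"
  shows "ZeroM C Y Z \<bullet> f = ZeroM C X Z"
  using comp_scale_left[OF assms zero_in_hom[OF assms(2,3)], of 0]
    scale_by_zero assms zero_in_hom comp_closed by metis

lemma equivalence_faithful: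
  assumes eq: "is_equivalence C C Fo Fm"
    and "X \<in> Obj C" "Y \<in> Obj C" "f \<in> Hom C X Y" "f' \<in> Hom C X Y" "Fm f = Fm f'"
  shows "f = f'"
proof -
  obtain Go Gm \<eta> where G: "is_functor C C Go Gm"
    and n: "natural_iso C C (\<lambda>X. X) (\<lambda>f. f) (Go \<circ> Fo) (Gm \<circ> Fm) \<eta>"
    using eq unfolding is_equivalence_def by blast
  have nat: "Gm (Fm h) \<bullet> \<eta> X = \<eta> Y \<bullet> h" if "h \<in> Hom C X Y" for h
    using n that assms(2,3) unfolding natural_iso_def by auto
  have iso: "is_iso C Y (Go (Fo Y)) (\<eta> Y)" using n assms(3) unfolding natural_iso_def by auto
  have GF: "Go (Fo Y) \<in> Obj C" using eq G assms(3) unfolding is_equivalence_def is_functor_def by auto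
  let ?u = "iso_inv C Y (Go (Fo Y)) (\<eta> Y)"
  have u: "inverse_pair C Y (Go (Fo Y)) (\<eta> Y) ?u" using inverse_pair_iso_inv[OF assms(3) GF iso] .
  have "h = ?u \<bullet> (\<eta> Y \<bullet> h)" if "h \<in> Hom C X Y" for h
    using u that comp_assoc[of X Y "Go (Fo Y)" Y h "\<eta> Y" ?u] assms(2,3) GF ident_comp[of X Y h]
    by (simp add: inverse_pair_def)
  then show ?thesis using assms nat by metis
qed

lemma equivalence_full:
  assumes eq: "is_equivalence C C Fo Fm"
    and "X \<in> Obj C" "Y \<in> Obj C" "h \<in> Hom C (Fo X) (Fo Y)"
  shows "\<exists>f\<in>Hom C X Y. Fm f = h"
proof -
  obtain Go Gm \<eta> \<epsilon> where F: "is_functor C C Fo Fm" and G: "is_functor C C Go Gm"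
    and n: "natural_iso C C (\<lambda>X. X) (\<lambda>f. f) (Go \<circ> Fo) (Gm \<circ> Fm) \<eta>"
    and e: "natural_iso C C (Fo \<circ> Go) (Fm \<circ> Gm) (\<lambda>X. X) (\<lambda>f. f) \<epsilon>"
    using eq unfolding is_equivalence_def by blast
  note XY = assms(2,3)
  have Fo: "Fo Z \<in> Obj C" "Go Z \<in> Obj C" if "Z \<in> Obj C" for Z
    using that F G unfolding is_functor_def by auto
  have Fh: "Fm f \<in> Hom C (Fo Z) (Fo W)" "Gm f \<in> Hom C (Go Z) (Go W)"
    if "f \<in> Hom C Z W" "Z \<in> Obj C" "W \<in> Obj C" for f Z W
    using that F G unfolding is_functor_def by auto
  let ?GX = "Go (Fo X)" and ?GY = "Go (Fo Y)"
  let ?u = "iso_inv C Y ?GY (\<eta> Y)"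
  have u: "inverse_pair C Y ?GY (\<eta> Y) ?u" and v: "\<eta> X \<in> Hom C X ?GX"
    using n XY Fo inverse_pair_iso_inv unfolding natural_iso_def
    by (auto simp: is_iso_def inverse_pair_def)
  have hh: "Gm h \<in> Hom C ?GX ?GY" using Fh assms Fo by auto
  define f where "f = ?u \<bullet> (Gm h \<bullet> \<eta> X)"
  have k: "Gm h \<bullet> \<eta> X \<in> Hom C X ?GY" using comp_closed[OF _ _ _ v hh] XY Fo by blast
  have f: "f \<in> Hom C X Y"
    unfolding f_def using comp_closed[OF _ _ _ k] u XY Fo by (auto simp: inverse_pair_def)
  have "Gm (Fm f) \<bullet> \<eta> X = \<eta> Y \<bullet> f" using n f XY unfolding natural_iso_def by auto
  also have "\<dots> = Gm h \<bullet> \<eta> X"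
    unfolding f_def using u k comp_assoc[of X ?GY Y ?GY "Gm h \<bullet> \<eta> X" ?u "\<eta> Y"] XY Fo ident_comp[of X ?GY]
    by (simp add: inverse_pair_def)
  finally have 1: "Gm (Fm f) \<bullet> \<eta> X = Gm h \<bullet> \<eta> X" .
  have "Gm (Fm f) = Gm h"
  proof -
    obtain w where w: "inverse_pair C X ?GX (\<eta> X) w"
      using n XY unfolding natural_iso_def by (auto simp: is_iso_def)
    have "m = (m \<bullet> \<eta> X) \<bullet> w" if "m \<in> Hom C ?GX ?GY" for m
      using w that comp_assoc[of ?GX X ?GX ?GY w "\<eta> X" m] XY Fo comp_ident[of ?GX ?GY]
      by (simp add: inverse_pair_def)
    then show ?thesis using 1 hh Fh f XY Fo by metis
  qed
  moreover have "m = m'" if mm: "m \<in> Hom C Z W" "m' \<in> Hom C Z W" "Gm m = Gm m'" and ZW: "Z \<in> Obj C" "W \<in> Obj C" for m m' Z W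
  proof -
    obtain w where w: "inverse_pair C (Fo (Go Z)) Z (\<epsilon> Z) w"
      using e ZW unfolding natural_iso_def by (auto simp: is_iso_def)
    have nt: "l \<bullet> \<epsilon> Z = \<epsilon> W \<bullet> Fm (Gm l)" if "l \<in> Hom C Z W" for l
      using e that ZW unfolding natural_iso_def by auto
    have "l = (l \<bullet> \<epsilon> Z) \<bullet> w" if "l \<in> Hom C Z W" for l
      using w that comp_assoc[of Z "Fo (Go Z)" Z W w "\<epsilon> Z" l] ZW Fo comp_ident[of Z W]
      by (simp add: inverse_pair_def)
    then show ?thesis using mm nt by metis
  qed
  ultimately show ?thesis using f Fh assms Fo by blast
qed

lemma natural_iso_id_equivalence:
  assumes F: "is_functor C C Fo Fm" and e: "natural_iso C C Fo Fm (\<lambda>X. X) (\<lambda>f. f) e"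
  shows "is_equivalence C C Fo Fm"
proof -
  have Fo: "Fo X \<in> Obj C" if "X \<in> Obj C" for X using F that by (simp add: is_functor_def)
  define n where "n X = iso_inv C (Fo X) X (e X)" for X
  have p: "inverse_pair C (Fo X) X (e X) (n X)" if "X \<in> Obj C" for X
    unfolding n_def using inverse_pair_iso_inv[OF Fo[OF that] that] e that by (simp add: natural_iso_def)
  have iso: "is_iso C X (Fo X) (n X)" if "X \<in> Obj C" for X
    using p[OF that] by (auto simp: is_iso_def inverse_pair_def)
  have nat: "Fm f \<bullet> n X = n Y \<bullet> f" if X: "X \<in> Obj C" and Y: "Y \<in> Obj C" and f: "f \<in> Hom C X Y" for X Y f
  proof -
    note pX = p[OF X, unfolded inverse_pair_def] and pY = p[OF Y, unfolded inverse_pair_def]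
    have Ff: "Fm f \<in> Hom C (Fo X) (Fo Y)" using F X Y f by (auto simp: is_functor_def)
    have ne: "e Y \<bullet> Fm f = f \<bullet> e X" using e X Y f by (simp add: natural_iso_def)
    have m: "Fm f \<bullet> n X \<in> Hom C X (Fo Y)"
      using comp_closed[OF X Fo[OF X] Fo[OF Y] _ Ff] pX by blast
    have "Fm f \<bullet> n X = (n Y \<bullet> e Y) \<bullet> (Fm f \<bullet> n X)"
      using pY ident_comp[OF X Fo[OF Y] m] by simp
    also have "\<dots> = n Y \<bullet> (e Y \<bullet> (Fm f \<bullet> n X))"
      using comp_assoc[OF X Fo[OF Y] Y Fo[OF Y] m] pY by blast
    also have "e Y \<bullet> (Fm f \<bullet> n X) = (f \<bullet> e X) \<bullet> n X"
      using comp_assoc[OF X Fo[OF X] Fo[OF Y] Y _ Ff] pX pY ne by metis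
    also have "\<dots> = f"
      using comp_assoc[OF X Fo[OF X] X Y _ _ f] pX comp_ident[OF X Y f] by metis
    finally show ?thesis .
  qed
  have "is_functor C C (\<lambda>X. X) (\<lambda>f. f)" by (simp add: is_functor_def)
  moreover have "natural_iso C C (\<lambda>X. X) (\<lambda>f. f) ((\<lambda>X. X) \<circ> Fo) ((\<lambda>f. f) \<circ> Fm) n"
    using iso nat by (simp add: natural_iso_def)
  moreover have "natural_iso C C (Fo \<circ> (\<lambda>X. X)) (Fm \<circ> (\<lambda>f. f)) (\<lambda>X. X) (\<lambda>f. f) e"
    using e by (simp add: natural_iso_def)
  ultimately show ?thesis unfolding is_equivalence_def using F by blast
qed

end


section \<open>Typed morphisms of a monoidal category\<close>

text \<open>
  Homs are allowed to overlap, so a morphism does not determine its source and target. Diagrams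
  are therefore chased with triples of source, morphism and target, for which the typing side
  conditions of the category axioms are decided by rewriting.
\<close>

text \<open>The source, the underlying morphism and the target.\<close>

definition dm :: "'o \<times> 'm \<times> 'o \<Rightarrow> 'o" where "dm t = fst t"
definition mo :: "'o \<times> 'm \<times> 'o \<Rightarrow> 'm" where "mo t = fst (snd t)"
definition cd :: "'o \<times> 'm \<times> 'o \<Rightarrow> 'o" where "cd t = snd (snd t)"

lemma triple_sel [simp]: "dm (X, f, Y) = X" "mo (X, f, Y) = f" "cd (X, f, Y) = Y"
  by (simp_all add: dm_def mo_def cd_def)

lemma triple_eqI: "\<lbrakk>dm s = dm t; mo s = mo t; cd s = cd t\<rbrakk> \<Longrightarrow> s = t"
  by (cases s; cases t) auto

lemma triple_collapse: "(dm t, mo t, cd t) = t"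
  by (cases t) auto

context monoidal_category
begin

text \<open>
  Well-typed triples (\<open>arr\<close>), identities, composition \<open>\<cdot>\<close>, tensor product \<open>\<boxtimes>\<close>, scaling, isomorphisms
  with their inverses \<open>iv\<close>, the associator, and the whiskerings \<open>X \<rhd> f = id\<^sub>X \<otimes> f\<close> and
  \<open>f \<lhd> X = f \<otimes> id\<^sub>X\<close>. These operations are total; composition does not check that the ends match.
\<close>

definition arr where "arr t \<longleftrightarrow> dm t \<in> Obj C \<and> cd t \<in> Obj C \<and> mo t \<in> Hom C (dm t) (cd t)"
definition idt where "idt X = (X, Ident C X, X)"
definition cmp (infixr \<open>\<cdot>\<close> 55) where "g \<cdot> f = (dm f, mo g \<bullet> mo f, cd g)"
definition tns (infixr \<open>\<boxtimes>\<close> 75) where "f \<boxtimes> g = (dm f \<odot> dm g, mo f \<star> mo g, cd f \<odot> cd g)"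
definition scl where "scl a f = (dm f, Scale C a (mo f), cd f)"
definition isoarr where "isoarr t \<longleftrightarrow> arr t \<and> is_iso C (dm t) (cd t) (mo t)"
definition iv where "iv t = (cd t, iso_inv C (dm t) (cd t) (mo t), dm t)"
definition as where "as X Y Z = ((X \<odot> Y) \<odot> Z, Assoc C X Y Z, X \<odot> (Y \<odot> Z))"
definition lw (infixr \<open>\<rhd>\<close> 75) where "X \<rhd> f = idt X \<boxtimes> f"
definition rw (infixl \<open>\<lhd>\<close> 75) where "f \<lhd> X = f \<boxtimes> idt X"

lemma ends [simp]:
  "dm (idt X) = X" "cd (idt X) = X" "dm (g \<cdot> f) = dm f" "cd (g \<cdot> f) = cd g"
  "dm (f \<boxtimes> g) = dm f \<odot> dm g" "cd (f \<boxtimes> g) = cd f \<odot> cd g"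
  "dm (scl a f) = dm f" "cd (scl a f) = cd f" "dm (iv f) = cd f" "cd (iv f) = dm f"
  "dm (as X Y Z) = (X \<odot> Y) \<odot> Z" "cd (as X Y Z) = X \<odot> (Y \<odot> Z)"
  "dm (X \<rhd> f) = X \<odot> dm f" "cd (X \<rhd> f) = X \<odot> cd f"
  "dm (f \<lhd> X) = dm f \<odot> X" "cd (f \<lhd> X) = cd f \<odot> X"
  by (simp_all add: idt_def cmp_def tns_def scl_def iv_def as_def lw_def rw_def)

lemma mo_sel:
  "mo (idt X) = Ident C X" "mo (g \<cdot> f) = mo g \<bullet> mo f" "mo (f \<boxtimes> g) = mo f \<star> mo g"
  "mo (scl a f) = Scale C a (mo f)" "mo (iv f) = iso_inv C (dm f) (cd f) (mo f)"
  "mo (as X Y Z) = Assoc C X Y Z"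
  "mo (X \<rhd> f) = Ident C X \<star> mo f" "mo (f \<lhd> X) = mo f \<star> Ident C X"
  by (simp_all add: idt_def cmp_def tns_def scl_def iv_def as_def lw_def rw_def)

lemma arrD: "arr f \<Longrightarrow> dm f \<in> Obj C" "arr f \<Longrightarrow> cd f \<in> Obj C" "arr f \<Longrightarrow> mo f \<in> Hom C (dm f) (cd f)"
  by (simp_all add: arr_def)

lemma arr_triple: "arr (X, f, Y) \<longleftrightarrow> X \<in> Obj C \<and> Y \<in> Obj C \<and> f \<in> Hom C X Y"
  by (simp add: arr_def)

declare tens_obj [simp] unit_obj [simp]

lemma arr_idt [simp]: "X \<in> Obj C \<Longrightarrow> arr (idt X)"
  by (simp add: arr_def mo_sel ident_closed)

lemma arr_cmp [simp]: "\<lbrakk>arr f; arr g; dm g = cd f\<rbrakk> \<Longrightarrow> arr (g \<cdot> f)"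
  using comp_closed[of "dm f" "cd f" "cd g" "mo f" "mo g"] by (simp add: arr_def mo_sel)

lemma arr_tns [simp]: "\<lbrakk>arr f; arr g\<rbrakk> \<Longrightarrow> arr (f \<boxtimes> g)"
  by (simp add: arr_def mo_sel tens_closed)

lemma arr_scl [simp]: "arr f \<Longrightarrow> arr (scl a f)"
  by (simp add: arr_def mo_sel scale_closed)

declare arrD [simp]

lemma arr_lw [simp]: "\<lbrakk>X \<in> Obj C; arr f\<rbrakk> \<Longrightarrow> arr (X \<rhd> f)"
  and arr_rw [simp]: "\<lbrakk>X \<in> Obj C; arr f\<rbrakk> \<Longrightarrow> arr (f \<lhd> X)"
  by (simp_all add: lw_def rw_def)

lemma cmp_assoc [simp]:
  "\<lbrakk>arr f; arr g; arr h; dm g = cd f; dm h = cd g\<rbrakk> \<Longrightarrow> (h \<cdot> g) \<cdot> f = h \<cdot> (g \<cdot> f)"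
  using comp_assoc[of "dm f" "cd f" "cd g" "cd h" "mo f" "mo g" "mo h"]
  by (intro triple_eqI) (simp_all add: mo_sel arr_def del: arrD)

lemma cmp_idt [simp]: "\<lbrakk>arr f; dm f = X\<rbrakk> \<Longrightarrow> f \<cdot> idt X = f" "\<lbrakk>arr f; cd f = X\<rbrakk> \<Longrightarrow> idt X \<cdot> f = f"
  by (rule triple_eqI; auto simp: mo_sel comp_ident[of "dm f" "cd f"] ident_comp[of "dm f" "cd f"])+

lemma scl_cmp [simp]:
  "\<lbrakk>arr f; arr g; dm g = cd f\<rbrakk> \<Longrightarrow> scl a g \<cdot> f = scl a (g \<cdot> f)"
  "\<lbrakk>arr f; arr g; dm g = cd f\<rbrakk> \<Longrightarrow> g \<cdot> scl a f = scl a (g \<cdot> f)"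
  using comp_scale_left[of "dm f" "cd f" "cd g" "mo f" "mo g"]
    comp_scale_right[of "dm f" "cd f" "cd g" "mo f" "mo g"]
  by (simp_all add: arr_def scl_def cmp_def del: arrD)

lemma scl_scl [simp]: "arr f \<Longrightarrow> scl a (scl b f) = scl (a * b) f"
  by (rule triple_eqI) (simp_all add: mo_sel scale_scale[of "dm f" "cd f"])

lemma scl_one [simp]: "arr f \<Longrightarrow> scl 1 f = f"
  by (rule triple_eqI) (simp_all add: mo_sel scale_one[of "dm f" "cd f"])

lemma scl_tns [simp]:
  "\<lbrakk>arr f; arr g\<rbrakk> \<Longrightarrow> scl a f \<boxtimes> g = scl a (f \<boxtimes> g)"
  "\<lbrakk>arr f; arr g\<rbrakk> \<Longrightarrow> f \<boxtimes> scl a g = scl a (f \<boxtimes> g)"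
  by (simp_all add: scl_def tns_def tens_scale_left[of "dm f" "cd f" "dm g" "cd g"]
      tens_scale_right[of "dm f" "cd f" "dm g" "cd g"])

lemma scl_wh [simp]:
  "\<lbrakk>X \<in> Obj C; arr f\<rbrakk> \<Longrightarrow> X \<rhd> scl a f = scl a (X \<rhd> f)"
  "\<lbrakk>X \<in> Obj C; arr f\<rbrakk> \<Longrightarrow> scl a f \<lhd> X = scl a (f \<lhd> X)"
  by (simp_all add: lw_def rw_def)

lemma tns_idt [simp]: "\<lbrakk>X \<in> Obj C; Y \<in> Obj C\<rbrakk> \<Longrightarrow> idt X \<boxtimes> idt Y = idt (X \<odot> Y)"
  by (rule triple_eqI) (simp_all add: mo_sel tens_ident)

lemma wh_idt [simp]:
  "\<lbrakk>X \<in> Obj C; Y \<in> Obj C\<rbrakk> \<Longrightarrow> X \<rhd> idt Y = idt (X \<odot> Y)"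
  "\<lbrakk>X \<in> Obj C; Y \<in> Obj C\<rbrakk> \<Longrightarrow> idt Y \<lhd> X = idt (Y \<odot> X)"
  by (simp_all add: lw_def rw_def)

lemma interchange:
  "\<lbrakk>arr f; arr g; arr f'; arr g'; dm g = cd f; dm g' = cd f'\<rbrakk>
    \<Longrightarrow> (g \<cdot> f) \<boxtimes> (g' \<cdot> f') = (g \<boxtimes> g') \<cdot> (f \<boxtimes> f')"
  using tens_comp[of "dm f" "cd f" "cd g" "dm f'" "cd f'" "cd g'" "mo f" "mo g" "mo f'" "mo g'"]
  by (simp add: arr_def tns_def cmp_def del: arrD)

lemma tns_cmp:
  "\<lbrakk>arr f; arr g; arr f'; arr g'; dm g = cd f; dm g' = cd f'\<rbrakk>
    \<Longrightarrow> (g \<boxtimes> g') \<cdot> (f \<boxtimes> f') = (g \<cdot> f) \<boxtimes> (g' \<cdot> f')"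
  by (simp add: interchange)

lemma tns_cmp_tl:
  "\<lbrakk>arr f; arr g; arr f'; arr g'; dm g = cd f; dm g' = cd f'; arr h; cd h = dm f \<odot> dm f'\<rbrakk>
    \<Longrightarrow> (g \<boxtimes> g') \<cdot> (f \<boxtimes> f') \<cdot> h = ((g \<cdot> f) \<boxtimes> (g' \<cdot> f')) \<cdot> h"
  by (simp add: interchange)

lemma wh_cmp [simp]:
  "\<lbrakk>X \<in> Obj C; arr f; arr g; dm g = cd f\<rbrakk> \<Longrightarrow> X \<rhd> (g \<cdot> f) = (X \<rhd> g) \<cdot> (X \<rhd> f)"
  "\<lbrakk>X \<in> Obj C; arr f; arr g; dm g = cd f\<rbrakk> \<Longrightarrow> (g \<cdot> f) \<lhd> X = (g \<lhd> X) \<cdot> (f \<lhd> X)"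
  using interchange[of "idt X" "idt X" f g] interchange[of f g "idt X" "idt X"]
  by (simp_all add: lw_def rw_def)

lemma tns_wh: "\<lbrakk>arr f; arr g\<rbrakk> \<Longrightarrow> f \<boxtimes> g = (cd f \<rhd> g) \<cdot> (f \<lhd> dm g)"
  using interchange[of f "idt (cd f)" "idt (dm g)" g] by (simp add: lw_def rw_def)

lemma wh_swap:
  assumes "arr f" "arr g" "X = dm f" "Y = cd g"
  shows "(f \<lhd> Y) \<cdot> (X \<rhd> g) = (cd f \<rhd> g) \<cdot> (f \<lhd> dm g)"
  using tns_wh[of f g] interchange[of "idt (dm f)" f g "idt (cd g)"] assms
  by (simp add: lw_def rw_def)

lemma wh_swap':
  assumes "arr f" "arr g" "X = cd f" "Y = dm g"
  shows "(X \<rhd> g) \<cdot> (f \<lhd> Y) = (f \<lhd> cd g) \<cdot> (dm f \<rhd> g)"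
  using assms by (simp add: wh_swap)

lemma tns_wh': "\<lbrakk>arr f; arr g\<rbrakk> \<Longrightarrow> f \<boxtimes> g = (f \<lhd> cd g) \<cdot> (dm f \<rhd> g)"
  by (simp add: wh_swap tns_wh)

lemma isoarrD [simp]: "isoarr f \<Longrightarrow> arr f"
  by (simp add: isoarr_def del: arrD)

lemma iv_rules [simp]:
  assumes "isoarr f"
  shows "arr (iv f)" "iv f \<cdot> f = idt (dm f)" "f \<cdot> iv f = idt (cd f)"
proof -
  have "inverse_pair C (dm f) (cd f) (mo f) (mo (iv f))"
    using inverse_pair_iso_inv assms by (simp add: isoarr_def arr_def mo_sel del: arrD)
  then show "arr (iv f)" "iv f \<cdot> f = idt (dm f)" "f \<cdot> iv f = idt (cd f)"
    using assms by (auto simp: inverse_pair_def arr_def isoarr_def idt_def cmp_def simp del: arrD)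
qed

lemma isoarrI:
  assumes "arr f" "arr g" "dm g = cd f" "cd g = dm f" "g \<cdot> f = idt (dm f)" "f \<cdot> g = idt (cd f)"
  shows "isoarr f" "iv f = g"
proof -
  have p: "inverse_pair C (dm f) (cd f) (mo f) (mo g)"
    using assms by (auto simp: inverse_pair_def arr_def idt_def cmp_def simp del: arrD)
  then show "isoarr f" using assms by (auto simp: isoarr_def is_iso_def simp del: arrD)
  show "iv f = g" using iso_inv_eqI[OF _ _ p] assms by (intro triple_eqI) (simp_all add: mo_sel)
qed

lemma iv_tl [simp]:
  "\<lbrakk>isoarr f; arr h; cd h = dm f\<rbrakk> \<Longrightarrow> iv f \<cdot> f \<cdot> h = h"
  "\<lbrakk>isoarr f; arr h; cd h = cd f\<rbrakk> \<Longrightarrow> f \<cdot> iv f \<cdot> h = h"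
  by (simp_all flip: cmp_assoc)

lemma iso_iv [simp]: assumes "isoarr f" shows "isoarr (iv f)" "iv (iv f) = f"
  using isoarrI[of "iv f" f] assms by simp_all

lemma iso_idt [simp]: assumes "X \<in> Obj C" shows "isoarr (idt X)" "iv (idt X) = idt X"
  using isoarrI[of "idt X" "idt X"] assms by simp_all

lemma iso_cmp [simp]:
  assumes "isoarr f" "isoarr g" "dm g = cd f"
  shows "isoarr (g \<cdot> f)" "iv (g \<cdot> f) = iv f \<cdot> iv g"
  using isoarrI[of "g \<cdot> f" "iv f \<cdot> iv g"] assms by simp_all

lemma iso_wh [simp]:
  assumes "X \<in> Obj C" "isoarr f"
  shows "isoarr (X \<rhd> f)" "iv (X \<rhd> f) = X \<rhd> iv f" "isoarr (f \<lhd> X)" "iv (f \<lhd> X) = iv f \<lhd> X"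
proof -
  have "(X \<rhd> iv f) \<cdot> (X \<rhd> f) = idt (X \<odot> dm f)" "(X \<rhd> f) \<cdot> (X \<rhd> iv f) = idt (X \<odot> cd f)"
    "(iv f \<lhd> X) \<cdot> (f \<lhd> X) = idt (dm f \<odot> X)" "(f \<lhd> X) \<cdot> (iv f \<lhd> X) = idt (cd f \<odot> X)"
    using assms by (simp_all flip: wh_cmp)
  then show "isoarr (X \<rhd> f)" "iv (X \<rhd> f) = X \<rhd> iv f" "isoarr (f \<lhd> X)" "iv (f \<lhd> X) = iv f \<lhd> X"
    using isoarrI[of "X \<rhd> f" "X \<rhd> iv f"] isoarrI[of "f \<lhd> X" "iv f \<lhd> X"] assms by simp_all
qed

lemma iso_scl:
  assumes "isoarr f" "a \<noteq> 0"
  shows "isoarr (scl a f)" "iv (scl a f) = scl (inverse a) (iv f)"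
  using isoarrI[of "scl a f" "scl (inverse a) (iv f)"] assms by simp_all

text \<open>
  Rewriting turns the inverse of a whiskered isomorphism into a whiskered inverse, so cancellation
  has to be stated for these as well.
\<close>

lemma iv_wh_tl [simp]:
  "\<lbrakk>isoarr f; X \<in> Obj C\<rbrakk> \<Longrightarrow> (X \<rhd> iv f) \<cdot> (X \<rhd> f) = idt (X \<odot> dm f)"
  "\<lbrakk>isoarr f; X \<in> Obj C\<rbrakk> \<Longrightarrow> (X \<rhd> f) \<cdot> (X \<rhd> iv f) = idt (X \<odot> cd f)"
  "\<lbrakk>isoarr f; X \<in> Obj C\<rbrakk> \<Longrightarrow> (iv f \<lhd> X) \<cdot> (f \<lhd> X) = idt (dm f \<odot> X)"
  "\<lbrakk>isoarr f; X \<in> Obj C\<rbrakk> \<Longrightarrow> (f \<lhd> X) \<cdot> (iv f \<lhd> X) = idt (cd f \<odot> X)"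
  "\<lbrakk>isoarr f; arr h; X \<in> Obj C; cd h = X \<odot> dm f\<rbrakk> \<Longrightarrow> (X \<rhd> iv f) \<cdot> (X \<rhd> f) \<cdot> h = h"
  "\<lbrakk>isoarr f; arr h; X \<in> Obj C; cd h = X \<odot> cd f\<rbrakk> \<Longrightarrow> (X \<rhd> f) \<cdot> (X \<rhd> iv f) \<cdot> h = h"
  "\<lbrakk>isoarr f; arr h; X \<in> Obj C; cd h = dm f \<odot> X\<rbrakk> \<Longrightarrow> (iv f \<lhd> X) \<cdot> (f \<lhd> X) \<cdot> h = h"
  "\<lbrakk>isoarr f; arr h; X \<in> Obj C; cd h = cd f \<odot> X\<rbrakk> \<Longrightarrow> (f \<lhd> X) \<cdot> (iv f \<lhd> X) \<cdot> h = h"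
  by (simp_all flip: iso_wh(2,4))

lemma iso_cancel_left:
  assumes "isoarr m" "arr f" "arr g" "cd f = dm m" "cd g = dm m" "m \<cdot> f = m \<cdot> g"
  shows "f = g"
  using assms iv_tl(1)[of m] by metis

lemma iso_cancel_right:
  assumes "isoarr m" "arr f" "arr g" "dm f = cd m" "dm g = cd m" "f \<cdot> m = g \<cdot> m"
  shows "f = g"
proof -
  have "f = (f \<cdot> m) \<cdot> iv m" "g = (g \<cdot> m) \<cdot> iv m" using assms(1-5) by simp_all
  then show ?thesis using assms(6) by metis
qed

lemma iso_as [simp]: "\<lbrakk>X \<in> Obj C; Y \<in> Obj C; Z \<in> Obj C\<rbrakk> \<Longrightarrow> isoarr (as X Y Z)"
  using assoc_iso[of X Y Z]
  by (auto simp: isoarr_def arr_def mo_sel is_iso_def inverse_pair_def simp del: arrD)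

lemma iv_as: "iv (as X Y Z) = (X \<odot> (Y \<odot> Z), assoc_inv C X Y Z, (X \<odot> Y) \<odot> Z)"
  by (simp add: iv_def as_def assoc_inv_def)

lemma as_nat:
  "\<lbrakk>arr f; arr g; arr h\<rbrakk>
    \<Longrightarrow> as (cd f) (cd g) (cd h) \<cdot> ((f \<boxtimes> g) \<boxtimes> h) = (f \<boxtimes> (g \<boxtimes> h)) \<cdot> as (dm f) (dm g) (dm h)"
  using assoc_natural[of "dm f" "dm g" "dm h" "cd f" "cd g" "cd h" "mo f" "mo g" "mo h"]
  by (simp add: arr_def as_def tns_def cmp_def del: arrD)

lemma as_pentagon:
  "\<lbrakk>W \<in> Obj C; X \<in> Obj C; Y \<in> Obj C; Z \<in> Obj C\<rbrakk>
    \<Longrightarrow> (W \<rhd> as X Y Z) \<cdot> as W (X \<odot> Y) Z \<cdot> (as W X Y \<lhd> Z) = as W X (Y \<odot> Z) \<cdot> as (W \<odot> X) Y Z"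
  using pentagon[of W X Y Z]
  by (simp add: arr_def as_def tns_def cmp_def lw_def rw_def idt_def del: arrD)

text \<open>
  The naturality squares of the associator and of its inverse in each variable, oriented so that
  rewriting moves the associators to the right.
\<close>

lemma as_wh:
  assumes "arr f" "X \<in> Obj C" "Y \<in> Obj C" "A = cd f"
  shows "as A X Y \<cdot> ((f \<lhd> X) \<lhd> Y) = (f \<lhd> (X \<odot> Y)) \<cdot> as (dm f) X Y"
    and "as X A Y \<cdot> ((X \<rhd> f) \<lhd> Y) = (X \<rhd> (f \<lhd> Y)) \<cdot> as X (dm f) Y"
    and "as X Y A \<cdot> ((X \<odot> Y) \<rhd> f) = (X \<rhd> (Y \<rhd> f)) \<cdot> as X Y (dm f)"
  using assms as_nat[of f "idt X" "idt Y"] as_nat[of "idt X" f "idt Y"] as_nat[of "idt X" "idt Y" f]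
  by (simp_all add: lw_def rw_def)

text \<open>Inverting two opposite sides of a commutative square.\<close>

lemma conj_inverse:
  assumes "isoarr m" "isoarr n" "arr f" "arr g" "dm m = cd g" "dm n = dm g" "cd n = dm f" "cd m = cd f"
    and "m \<cdot> g = f \<cdot> n"
  shows "iv m \<cdot> f = g \<cdot> iv n"
proof -
  have "iv m \<cdot> f = iv m \<cdot> (f \<cdot> n) \<cdot> iv n" using assms(1-8) by simp
  also have "\<dots> = g \<cdot> iv n" using assms(1-8) by (simp flip: assms(9))
  finally show ?thesis .
qed

lemma ivas_wh:
  assumes "arr f" "X \<in> Obj C" "Y \<in> Obj C" "A = cd f"
  shows "iv (as A X Y) \<cdot> (f \<lhd> (X \<odot> Y)) = ((f \<lhd> X) \<lhd> Y) \<cdot> iv (as (dm f) X Y)"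
    and "iv (as X A Y) \<cdot> (X \<rhd> (f \<lhd> Y)) = ((X \<rhd> f) \<lhd> Y) \<cdot> iv (as X (dm f) Y)"
    and "iv (as X Y A) \<cdot> (X \<rhd> (Y \<rhd> f)) = ((X \<odot> Y) \<rhd> f) \<cdot> iv (as X Y (dm f))"
  using assms by (intro conj_inverse; simp add: as_wh)+

text \<open>An equation between composites, applied at the left end of a longer composite.\<close>

lemma tl2:
  "\<lbrakk>x \<cdot> y = z; arr x; arr y; arr h; dm x = cd y; dm y = cd h\<rbrakk> \<Longrightarrow> x \<cdot> y \<cdot> h = z \<cdot> h"
  by (simp flip: cmp_assoc)

lemma tl3:
  "\<lbrakk>x \<cdot> y \<cdot> w = z; arr x; arr y; arr w; arr h; dm x = cd y; dm y = cd w; dm w = cd h\<rbrakk>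
    \<Longrightarrow> x \<cdot> y \<cdot> w \<cdot> h = z \<cdot> h"
  by (simp flip: cmp_assoc)

lemma as_wh_tl:
  assumes "arr f" "X \<in> Obj C" "Y \<in> Obj C" "A = cd f" "arr h"
  shows "cd h = (dm f \<odot> X) \<odot> Y \<Longrightarrow> as A X Y \<cdot> ((f \<lhd> X) \<lhd> Y) \<cdot> h = (f \<lhd> (X \<odot> Y)) \<cdot> as (dm f) X Y \<cdot> h"
    and "cd h = (X \<odot> dm f) \<odot> Y \<Longrightarrow> as X A Y \<cdot> ((X \<rhd> f) \<lhd> Y) \<cdot> h = (X \<rhd> (f \<lhd> Y)) \<cdot> as X (dm f) Y \<cdot> h"
    and "cd h = (X \<odot> Y) \<odot> dm f \<Longrightarrow> as X Y A \<cdot> ((X \<odot> Y) \<rhd> f) \<cdot> h = (X \<rhd> (Y \<rhd> f)) \<cdot> as X Y (dm f) \<cdot> h"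
    and "cd h = dm f \<odot> (X \<odot> Y) \<Longrightarrow> iv (as A X Y) \<cdot> (f \<lhd> (X \<odot> Y)) \<cdot> h = ((f \<lhd> X) \<lhd> Y) \<cdot> iv (as (dm f) X Y) \<cdot> h"
    and "cd h = X \<odot> (dm f \<odot> Y) \<Longrightarrow> iv (as X A Y) \<cdot> (X \<rhd> (f \<lhd> Y)) \<cdot> h = ((X \<rhd> f) \<lhd> Y) \<cdot> iv (as X (dm f) Y) \<cdot> h"
    and "cd h = X \<odot> (Y \<odot> dm f) \<Longrightarrow> iv (as X Y A) \<cdot> (X \<rhd> (Y \<rhd> f)) \<cdot> h = ((X \<odot> Y) \<rhd> f) \<cdot> iv (as X Y (dm f)) \<cdot> h"
  using assms by (simp_all add: tl2[OF as_wh(1)] tl2[OF as_wh(2)] tl2[OF as_wh(3)]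
      tl2[OF ivas_wh(1)] tl2[OF ivas_wh(2)] tl2[OF ivas_wh(3)])

text \<open>The pentagon with some of the associators inverted.\<close>

lemma pentagon_inv:
  assumes "W \<in> Obj C" "X \<in> Obj C" "Y \<in> Obj C" "Z \<in> Obj C"
  shows "(W \<rhd> iv (as X Y Z)) \<cdot> as W X (Y \<odot> Z) = as W (X \<odot> Y) Z \<cdot> (as W X Y \<lhd> Z) \<cdot> iv (as (W \<odot> X) Y Z)"
    and "(W \<rhd> as X Y Z) \<cdot> as W (X \<odot> Y) Z = as W X (Y \<odot> Z) \<cdot> as (W \<odot> X) Y Z \<cdot> (iv (as W X Y) \<lhd> Z)"
    and "iv (as W (X \<odot> Y) Z) \<cdot> (W \<rhd> iv (as X Y Z)) \<cdot> as W X (Y \<odot> Z) = (as W X Y \<lhd> Z) \<cdot> iv (as (W \<odot> X) Y Z)"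
    and "(W \<rhd> iv (as X Y Z)) \<cdot> as W X (Y \<odot> Z) \<cdot> as (W \<odot> X) Y Z = as W (X \<odot> Y) Z \<cdot> (as W X Y \<lhd> Z)"
proof -
  note p = as_pentagon[OF assms]
  have "as W X (Y \<odot> Z) = ((W \<rhd> as X Y Z) \<cdot> as W (X \<odot> Y) Z \<cdot> (as W X Y \<lhd> Z)) \<cdot> iv (as (W \<odot> X) Y Z)"
    unfolding p using assms by simp
  then show 1: "(W \<rhd> iv (as X Y Z)) \<cdot> as W X (Y \<odot> Z) = as W (X \<odot> Y) Z \<cdot> (as W X Y \<lhd> Z) \<cdot> iv (as (W \<odot> X) Y Z)"
    using assms by simp
  show "iv (as W (X \<odot> Y) Z) \<cdot> (W \<rhd> iv (as X Y Z)) \<cdot> as W X (Y \<odot> Z) = (as W X Y \<lhd> Z) \<cdot> iv (as (W \<odot> X) Y Z)"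
    using assms by (simp add: 1)
  show "(W \<rhd> iv (as X Y Z)) \<cdot> as W X (Y \<odot> Z) \<cdot> as (W \<odot> X) Y Z = as W (X \<odot> Y) Z \<cdot> (as W X Y \<lhd> Z)"
    using assms by (simp flip: p)
  have "(W \<rhd> as X Y Z) \<cdot> as W (X \<odot> Y) Z = ((W \<rhd> as X Y Z) \<cdot> as W (X \<odot> Y) Z \<cdot> (as W X Y \<lhd> Z)) \<cdot> (iv (as W X Y) \<lhd> Z)"
    using assms by simp
  then show "(W \<rhd> as X Y Z) \<cdot> as W (X \<odot> Y) Z = as W X (Y \<odot> Z) \<cdot> as (W \<odot> X) Y Z \<cdot> (iv (as W X Y) \<lhd> Z)"
    unfolding p using assms by simp
qed

end


section \<open>The unit constraints\<close>

context monoidal_category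
begin

text \<open>
  The unit object is given with \<open>\<iota> : I \<otimes> I \<rightarrow> I\<close> only. The unitors \<open>lu\<close> and \<open>ru\<close> are determined by
  \<open>I \<rhd> lu X = (\<iota> \<lhd> X) \<alpha>\<^sup>-\<^sup>1\<close> and \<open>ru X \<lhd> I = (X \<rhd> \<iota>) \<alpha>\<close>, because tensoring with \<open>I\<close> is fully faithful.
\<close>

abbreviation I where "I \<equiv> UnitO C"

definition io where "io = (I \<odot> I, Iota C, I)"
definition lu where "lu X = (I \<odot> X, left_unitor C X, X)"
definition ru where "ru X = (X \<odot> I, right_unitor C X, X)"

lemma unit_ends [simp]:
  "dm io = I \<odot> I" "cd io = I" "dm (lu X) = I \<odot> X" "cd (lu X) = X" "dm (ru X) = X \<odot> I" "cd (ru X) = X"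
  by (simp_all add: io_def lu_def ru_def)

lemma iso_io [simp]: "isoarr io"
  using iota_iso by (auto simp: io_def isoarr_def arr_triple is_iso_def inverse_pair_def)

lemma unit_wh_faithful:
  assumes "arr f" "arr g" "dm f = dm g" "cd f = cd g"
  shows "I \<rhd> f = I \<rhd> g \<Longrightarrow> f = g" "f \<lhd> I = g \<lhd> I \<Longrightarrow> f = g"
  using assms equivalence_faithful[OF unit_tens_equivalence, of "dm f" "cd f" "mo f" "mo g"]
    equivalence_faithful[OF tens_unit_equivalence, of "dm f" "cd f" "mo f" "mo g"]
    arrD(3)[OF assms(1)] arrD(3)[OF assms(2)]
  by (auto intro!: triple_eqI dest!: arg_cong[of _ _ mo] simp: mo_sel simp del: arrD(3))

lemma unit_wh_full:
  assumes "arr h" "X \<in> Obj C" "Y \<in> Obj C"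
  shows "\<lbrakk>dm h = I \<odot> X; cd h = I \<odot> Y\<rbrakk> \<Longrightarrow> \<exists>f. arr f \<and> dm f = X \<and> cd f = Y \<and> I \<rhd> f = h"
    and "\<lbrakk>dm h = X \<odot> I; cd h = Y \<odot> I\<rbrakk> \<Longrightarrow> \<exists>f. arr f \<and> dm f = X \<and> cd f = Y \<and> f \<lhd> I = h"
proof -
  assume h: "dm h = I \<odot> X" "cd h = I \<odot> Y"
  then obtain f where "f \<in> Hom C X Y" "Ident C I \<star> f = mo h"
    using equivalence_full[OF unit_tens_equivalence assms(2,3), of "mo h"] arrD(3)[OF assms(1)] by auto
  then show "\<exists>f. arr f \<and> dm f = X \<and> cd f = Y \<and> I \<rhd> f = h"
    using assms h by (intro exI[of _ "(X, f, Y)"]) (auto simp: arr_triple mo_sel intro: triple_eqI)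
next
  assume h: "dm h = X \<odot> I" "cd h = Y \<odot> I"
  then obtain f where "f \<in> Hom C X Y" "f \<star> Ident C I = mo h"
    using equivalence_full[OF tens_unit_equivalence assms(2,3), of "mo h"] arrD(3)[OF assms(1)] by auto
  then show "\<exists>f. arr f \<and> dm f = X \<and> cd f = Y \<and> f \<lhd> I = h"
    using assms h by (intro exI[of _ "(X, f, Y)"]) (auto simp: arr_triple mo_sel intro: triple_eqI)
qed

lemma unit_wh_reflects_iso:
  assumes "arr f" shows "isoarr (I \<rhd> f) \<Longrightarrow> isoarr f" "isoarr (f \<lhd> I) \<Longrightarrow> isoarr f"
proof -
  assume i: "isoarr (I \<rhd> f)"
  obtain g where g: "arr g" "dm g = cd f" "cd g = dm f" "I \<rhd> g = iv (I \<rhd> f)"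
    using unit_wh_full(1)[of "iv (I \<rhd> f)" "cd f" "dm f"] i assms by auto
  have "g \<cdot> f = idt (dm f)"
    by (rule unit_wh_faithful(1)) (use i g assms in simp_all)
  moreover have "f \<cdot> g = idt (cd f)"
    by (rule unit_wh_faithful(1)) (use i g assms in simp_all)
  ultimately show "isoarr f" using isoarrI(1)[of f g] g assms by auto
next
  assume i: "isoarr (f \<lhd> I)"
  obtain g where g: "arr g" "dm g = cd f" "cd g = dm f" "g \<lhd> I = iv (f \<lhd> I)"
    using unit_wh_full(2)[of "iv (f \<lhd> I)" "cd f" "dm f"] i assms by auto
  have "g \<cdot> f = idt (dm f)"
    by (rule unit_wh_faithful(2)) (use i g assms in simp_all)
  moreover have "f \<cdot> g = idt (cd f)"
    by (rule unit_wh_faithful(2)) (use i g assms in simp_all)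
  ultimately show "isoarr f" using isoarrI(1)[of f g] g assms by auto
qed

lemma lu_eqI:
  assumes "X \<in> Obj C" "arr f" "dm f = I \<odot> X" "cd f = X" "I \<rhd> f = (io \<lhd> X) \<cdot> iv (as I I X)"
  shows "lu X = f"
proof -
  have m: "Ident C I \<star> mo f = (Iota C \<star> Ident C X) \<bullet> assoc_inv C I I X"
    using arg_cong[OF assms(5), of mo] by (simp add: mo_sel assoc_inv_def) (simp add: io_def)
  have "left_unitor C X = mo f" unfolding left_unitor_def
  proof (rule the_equality)
    show "mo f \<in> Hom C (I \<odot> X) X \<and> Ident C I \<star> mo f = (Iota C \<star> Ident C X) \<bullet> assoc_inv C I I X"
      using m assms arrD(3)[of f] by simp
  next
    fix l assume l: "l \<in> Hom C (I \<odot> X) X \<and> Ident C I \<star> l = (Iota C \<star> Ident C X) \<bullet> assoc_inv C I I X"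
    then have "I \<rhd> (I \<odot> X, l, X) = I \<rhd> f"
      using assms(1-4) m by (intro triple_eqI) (simp_all add: mo_sel)
    then have "(I \<odot> X, l, X) = f"
      by (rule unit_wh_faithful(1)[rotated -1]) (use l assms in \<open>simp_all add: arr_triple\<close>)
    then show "l = mo f" by auto
  qed
  then show ?thesis using assms by (auto simp: lu_def intro: triple_eqI)
qed

lemma ru_eqI:
  assumes "X \<in> Obj C" "arr f" "dm f = X \<odot> I" "cd f = X" "f \<lhd> I = (X \<rhd> io) \<cdot> as X I I"
  shows "ru X = f"
proof -
  have m: "mo f \<star> Ident C I = (Ident C X \<star> Iota C) \<bullet> Assoc C X I I"
    using arg_cong[OF assms(5), of mo] by (simp add: mo_sel) (simp add: io_def)
  have "right_unitor C X = mo f" unfolding right_unitor_def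
  proof (rule the_equality)
    show "mo f \<in> Hom C (X \<odot> I) X \<and> mo f \<star> Ident C I = (Ident C X \<star> Iota C) \<bullet> Assoc C X I I"
      using m assms arrD(3)[of f] by simp
  next
    fix l assume l: "l \<in> Hom C (X \<odot> I) X \<and> l \<star> Ident C I = (Ident C X \<star> Iota C) \<bullet> Assoc C X I I"
    then have "(X \<odot> I, l, X) \<lhd> I = f \<lhd> I"
      using assms(1-4) m by (intro triple_eqI) (simp_all add: mo_sel)
    then have "(X \<odot> I, l, X) = f"
      by (rule unit_wh_faithful(2)[rotated -1]) (use l assms in \<open>simp_all add: arr_triple\<close>)
    then show "l = mo f" by auto
  qed
  then show ?thesis using assms by (auto simp: ru_def intro: triple_eqI)
qed

lemma lu: assumes "X \<in> Obj C" shows "isoarr (lu X)" "I \<rhd> lu X = (io \<lhd> X) \<cdot> iv (as I I X)"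
proof -
  obtain f where f: "arr f" "dm f = I \<odot> X" "cd f = X" "I \<rhd> f = (io \<lhd> X) \<cdot> iv (as I I X)"
    using unit_wh_full(1)[of "(io \<lhd> X) \<cdot> iv (as I I X)" "I \<odot> X" X] assms by auto
  have "isoarr (I \<rhd> f)" using f assms by simp
  then show "isoarr (lu X)" "I \<rhd> lu X = (io \<lhd> X) \<cdot> iv (as I I X)"
    using lu_eqI[OF assms f] f unit_wh_reflects_iso(1)[OF f(1)] by simp_all
qed

lemma ru: assumes "X \<in> Obj C" shows "isoarr (ru X)" "ru X \<lhd> I = (X \<rhd> io) \<cdot> as X I I"
proof -
  obtain f where f: "arr f" "dm f = X \<odot> I" "cd f = X" "f \<lhd> I = (X \<rhd> io) \<cdot> as X I I"
    using unit_wh_full(2)[of "(X \<rhd> io) \<cdot> as X I I" "X \<odot> I" X] assms by auto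
  have "isoarr (f \<lhd> I)" using f assms by simp
  then show "isoarr (ru X)" "ru X \<lhd> I = (X \<rhd> io) \<cdot> as X I I"
    using ru_eqI[OF assms f] f unit_wh_reflects_iso(2)[OF f(1)] by simp_all
qed

declare lu(1) [simp] ru(1) [simp]

lemma lu_nat: assumes "arr f" shows "lu (cd f) \<cdot> (I \<rhd> f) = f \<cdot> lu (dm f)"
proof (rule unit_wh_faithful(1))
  show "I \<rhd> (lu (cd f) \<cdot> (I \<rhd> f)) = I \<rhd> (f \<cdot> lu (dm f))"
    using assms by (simp add: lu(2) ivas_wh(3) tl2[OF wh_swap[of io f]])
qed (use assms in simp_all)

lemma ru_nat: assumes "arr f" shows "ru (cd f) \<cdot> (f \<lhd> I) = f \<cdot> ru (dm f)"
proof (rule unit_wh_faithful(2))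
  show "(ru (cd f) \<cdot> (f \<lhd> I)) \<lhd> I = (f \<cdot> ru (dm f)) \<lhd> I"
    using assms by (simp add: ru(2) as_wh(1) tl2[OF wh_swap'[of f io]])
qed (use assms in simp_all)

lemma lu_unit_tens: assumes "X \<in> Obj C" shows "lu (I \<odot> X) = I \<rhd> lu X"
  using lu_nat[of "lu X"] assms by - (rule iso_cancel_left[of "lu X"], simp_all)

text \<open>
  The triangle. Since \<open>Z \<cong> I \<otimes> Z\<close>, it suffices to treat objects of the form \<open>I \<otimes> Z\<close>, for which it is
  the pentagon on \<open>Y, I, I, Z\<close> together with the definition of the unitors.
\<close>

lemma triangle:
  assumes Y: "Y \<in> Obj C" and Z: "Z \<in> Obj C"
  shows "(Y \<rhd> lu Z) \<cdot> as Y I Z = ru Y \<lhd> Z"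
proof -
  have a: "(Y \<rhd> lu (I \<odot> Z)) \<cdot> as Y I (I \<odot> Z) = ru Y \<lhd> (I \<odot> Z)"
  proof (rule iso_cancel_right[of "as (Y \<odot> I) I Z"])
    have "((Y \<rhd> lu (I \<odot> Z)) \<cdot> as Y I (I \<odot> Z)) \<cdot> as (Y \<odot> I) I Z
      = (Y \<rhd> (I \<rhd> lu Z)) \<cdot> ((Y \<rhd> as I I Z) \<cdot> as Y (I \<odot> I) Z \<cdot> (as Y I I \<lhd> Z))"
      using Y Z by (simp add: as_pentagon lu_unit_tens)
    also have "\<dots> = (Y \<rhd> (io \<lhd> Z)) \<cdot> as Y (I \<odot> I) Z \<cdot> (as Y I I \<lhd> Z)"
      using Y Z by (simp add: lu(2))
    also have "\<dots> = as Y I Z \<cdot> (((Y \<rhd> io) \<cdot> as Y I I) \<lhd> Z)"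
      using Y Z by (simp add: as_wh_tl)
    also have "\<dots> = (ru Y \<lhd> (I \<odot> Z)) \<cdot> as (Y \<odot> I) I Z"
      using Y Z by (simp add: as_wh flip: ru(2))
    finally show "((Y \<rhd> lu (I \<odot> Z)) \<cdot> as Y I (I \<odot> Z)) \<cdot> as (Y \<odot> I) I Z
      = (ru Y \<lhd> (I \<odot> Z)) \<cdot> as (Y \<odot> I) I Z" .
  qed (use Y Z in simp_all)
  have "(Y \<rhd> lu Z) \<cdot> ((Y \<rhd> lu (I \<odot> Z)) \<cdot> as Y I (I \<odot> Z)) = (Y \<rhd> lu Z) \<cdot> (ru Y \<lhd> (I \<odot> Z))"
    by (simp add: a)
  moreover have "(Y \<rhd> lu Z) \<cdot> (ru Y \<lhd> (I \<odot> Z)) = (ru Y \<lhd> Z) \<cdot> ((Y \<odot> I) \<rhd> lu Z)"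
    using wh_swap[of "ru Y" "lu Z", OF _ _ refl refl] Y Z by simp
  moreover have "(Y \<rhd> lu Z) \<cdot> ((Y \<rhd> lu (I \<odot> Z)) \<cdot> as Y I (I \<odot> Z))
    = ((Y \<rhd> lu Z) \<cdot> as Y I Z) \<cdot> ((Y \<odot> I) \<rhd> lu Z)"
    using Y Z by (simp add: as_wh lu_unit_tens)
  ultimately show ?thesis using Y Z by - (rule iso_cancel_right[of "(Y \<odot> I) \<rhd> lu Z"], simp_all)
qed

text \<open>
  The compatibility of the unitors with tensor products: each half follows from a pentagon with
  two adjacent units, without the triangle.
\<close>

lemma lu_tens:
  assumes "X \<in> Obj C" "Y \<in> Obj C"
  shows "lu (X \<odot> Y) \<cdot> as I X Y = lu X \<lhd> Y"
proof (rule unit_wh_faithful(1))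
  have "(I \<rhd> (lu (X \<odot> Y) \<cdot> as I X Y)) \<cdot> as I (I \<odot> X) Y \<cdot> (as I I X \<lhd> Y)
    = (I \<rhd> lu (X \<odot> Y)) \<cdot> as I I (X \<odot> Y) \<cdot> as (I \<odot> I) X Y"
    using assms by (simp flip: as_pentagon)
  also have "\<dots> = (io \<lhd> (X \<odot> Y)) \<cdot> as (I \<odot> I) X Y" using assms by (simp add: lu(2))
  also have "\<dots> = as I X Y \<cdot> ((io \<lhd> X) \<lhd> Y)" using assms by (simp add: as_wh)
  also have "\<dots> = as I X Y \<cdot> ((I \<rhd> lu X) \<lhd> Y) \<cdot> (as I I X \<lhd> Y)" using assms by (simp add: lu(2))
  also have "\<dots> = (I \<rhd> (lu X \<lhd> Y)) \<cdot> as I (I \<odot> X) Y \<cdot> (as I I X \<lhd> Y)" using assms by (simp add: as_wh_tl)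
  finally show "I \<rhd> (lu (X \<odot> Y) \<cdot> as I X Y) = I \<rhd> (lu X \<lhd> Y)"
    using assms by - (rule iso_cancel_right[of "as I (I \<odot> X) Y \<cdot> (as I I X \<lhd> Y)"], simp_all)
qed (use assms in simp_all)

lemma ru_tens:
  assumes "X \<in> Obj C" "Y \<in> Obj C"
  shows "(X \<rhd> ru Y) \<cdot> as X Y I = ru (X \<odot> Y)"
proof (rule unit_wh_faithful(2))
  have "as X Y I \<cdot> (((X \<rhd> ru Y) \<cdot> as X Y I) \<lhd> I)
    = (X \<rhd> (ru Y \<lhd> I)) \<cdot> as X (Y \<odot> I) I \<cdot> (as X Y I \<lhd> I)"
    using assms by (simp add: as_wh_tl)
  also have "\<dots> = (X \<rhd> (Y \<rhd> io)) \<cdot> (X \<rhd> as Y I I) \<cdot> as X (Y \<odot> I) I \<cdot> (as X Y I \<lhd> I)"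
    using assms by (simp add: ru(2))
  also have "\<dots> = (X \<rhd> (Y \<rhd> io)) \<cdot> as X Y (I \<odot> I) \<cdot> as (X \<odot> Y) I I"
    using assms by (simp add: as_pentagon)
  also have "\<dots> = as X Y I \<cdot> (ru (X \<odot> Y) \<lhd> I)"
    using assms by (simp add: ru(2) as_wh_tl)
  finally show "((X \<rhd> ru Y) \<cdot> as X Y I) \<lhd> I = ru (X \<odot> Y) \<lhd> I"
    using assms by - (rule iso_cancel_left[of "as X Y I"], simp_all)
qed (use assms in simp_all)

lemma ru_unit: "ru I = io"
proof (rule unit_wh_faithful(2))
  show "ru I \<lhd> I = io \<lhd> I" using triangle[of I I] by (simp add: lu(2))
qed simp_all

end


section \<open>Half-braidings\<close>

context monoidal_category
begin

text \<open>
  A half-braiding as a family \<open>P\<close> of typed morphisms \<open>P Y : X \<otimes> Y \<rightarrow> Y \<otimes> X\<close>. The family may be arbitrary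
  outside the objects of the category; \<open>hbt X \<phi>\<close> is the family of the function \<open>\<phi>\<close>.
\<close>

definition hbt where "hbt X \<phi> Y = (X \<odot> Y, \<phi> Y, Y \<odot> X)"

definition hb where
  "hb X P \<longleftrightarrow> X \<in> Obj C \<and> (\<forall>Y\<in>Obj C. isoarr (P Y) \<and> dm (P Y) = X \<odot> Y \<and> cd (P Y) = Y \<odot> X) \<and>
     (\<forall>f. arr f \<longrightarrow> P (cd f) \<cdot> (X \<rhd> f) = (f \<lhd> X) \<cdot> P (dm f)) \<and>
     (\<forall>Y\<in>Obj C. \<forall>Z\<in>Obj C.
        as Y Z X \<cdot> P (Y \<odot> Z) \<cdot> as X Y Z = (Y \<rhd> P Z) \<cdot> as Y X Z \<cdot> (P Y \<lhd> Z))"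

text \<open>The morphism \<open>f\<close> intertwines \<open>P\<close> and \<open>P'\<close>, that is, it is a morphism of the center.\<close>

definition im where "im P P' f \<longleftrightarrow> (\<forall>Y\<in>Obj C. (Y \<rhd> f) \<cdot> P Y = P' Y \<cdot> (f \<lhd> Y))"

text \<open>The half-braidings of a tensor product and of the unit object.\<close>

definition thb where
  "thb A P B Q Y = as Y A B \<cdot> (P Y \<lhd> B) \<cdot> iv (as A Y B) \<cdot> (A \<rhd> Q Y) \<cdot> as A B Y"

definition uhb where "uhb Y = iv (ru Y) \<cdot> lu Y"

lemma hb_cong: "(\<And>Y. Y \<in> Obj C \<Longrightarrow> P Y = P' Y) \<Longrightarrow> hb X P \<longleftrightarrow> hb X P'"
  unfolding hb_def by (simp cong: ball_cong)

lemma im_cong: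
  "\<lbrakk>\<And>Y. Y \<in> Obj C \<Longrightarrow> P Y = P' Y; \<And>Y. Y \<in> Obj C \<Longrightarrow> Q Y = Q' Y\<rbrakk> \<Longrightarrow> im P Q f \<longleftrightarrow> im P' Q' f"
  unfolding im_def by (simp cong: ball_cong)

lemma hbD:
  assumes "hb X P"
  shows "X \<in> Obj C" "Y \<in> Obj C \<Longrightarrow> isoarr (P Y)" "Y \<in> Obj C \<Longrightarrow> dm (P Y) = X \<odot> Y"
    "Y \<in> Obj C \<Longrightarrow> cd (P Y) = Y \<odot> X"
    "\<lbrakk>arr f; Y = cd f\<rbrakk> \<Longrightarrow> P Y \<cdot> (X \<rhd> f) = (f \<lhd> X) \<cdot> P (dm f)"
    "\<lbrakk>Y \<in> Obj C; Z \<in> Obj C\<rbrakk>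
      \<Longrightarrow> as Y Z X \<cdot> P (Y \<odot> Z) \<cdot> as X Y Z = (Y \<rhd> P Z) \<cdot> as Y X Z \<cdot> (P Y \<lhd> Z)"
  using assms by (simp_all add: hb_def del: split_paired_All)

lemma hb_hex:
  assumes "hb X P" "Y \<in> Obj C" "Z \<in> Obj C"
  shows "P (Y \<odot> Z) = iv (as Y Z X) \<cdot> (Y \<rhd> P Z) \<cdot> as Y X Z \<cdot> (P Y \<lhd> Z) \<cdot> iv (as X Y Z)"
proof -
  note [simp] = hbD(1-4)[OF assms(1)]
  have "P (Y \<odot> Z) = iv (as Y Z X) \<cdot> (as Y Z X \<cdot> P (Y \<odot> Z) \<cdot> as X Y Z) \<cdot> iv (as X Y Z)"
    using assms by simp
  then show ?thesis unfolding hbD(6)[OF assms] using assms by simp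
qed

lemma hb_nat_wh:
  assumes "hb X P" "arr f" "Y = cd f" "W \<in> Obj C"
  shows "(W \<rhd> P Y) \<cdot> (W \<rhd> (X \<rhd> f)) = (W \<rhd> (f \<lhd> X)) \<cdot> (W \<rhd> P (dm f))"
    and "(P Y \<lhd> W) \<cdot> ((X \<rhd> f) \<lhd> W) = ((f \<lhd> X) \<lhd> W) \<cdot> (P (dm f) \<lhd> W)"
  using hbD(1-4)[OF assms(1)] hbD(5)[OF assms(1-3)] assms
  by (simp_all flip: wh_cmp)

lemma half_braiding_iff:
  assumes X: "X \<in> Obj C"
  shows "half_braiding C X \<phi> \<longleftrightarrow> \<phi> \<in> extensional (Obj C) \<and> hb X (hbt X \<phi>)"
proof -
  have 1: "is_iso C (X \<odot> Y) (Y \<odot> X) (\<phi> Y)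
      \<longleftrightarrow> isoarr (hbt X \<phi> Y) \<and> dm (hbt X \<phi> Y) = X \<odot> Y \<and> cd (hbt X \<phi> Y) = Y \<odot> X"
    if "Y \<in> Obj C" for Y
    using X that by (auto simp: isoarr_def arr_triple hbt_def is_iso_def inverse_pair_def)
  have 2: "(\<forall>Y\<in>Obj C. \<forall>Z\<in>Obj C. \<forall>f\<in>Hom C Y Z. (f \<star> Ident C X) \<bullet> \<phi> Y = \<phi> Z \<bullet> (Ident C X \<star> f))
      \<longleftrightarrow> (\<forall>f. arr f \<longrightarrow> hbt X \<phi> (cd f) \<cdot> (X \<rhd> f) = (f \<lhd> X) \<cdot> hbt X \<phi> (dm f))"
    by (auto simp: arr_def hbt_def cmp_def lw_def rw_def tns_def idt_def simp del: arrD)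
  have 3: "(Assoc C Y Z X \<bullet> \<phi> (Y \<odot> Z) \<bullet> Assoc C X Y Z
        = (Ident C Y \<star> \<phi> Z) \<bullet> Assoc C Y X Z \<bullet> (\<phi> Y \<star> Ident C Z))
      \<longleftrightarrow> (as Y Z X \<cdot> hbt X \<phi> (Y \<odot> Z) \<cdot> as X Y Z
        = (Y \<rhd> hbt X \<phi> Z) \<cdot> as Y X Z \<cdot> (hbt X \<phi> Y \<lhd> Z))" for Y Z
    by (simp add: hbt_def cmp_def lw_def rw_def tns_def idt_def as_def)
  show ?thesis
    unfolding half_braiding_def natural_iso_def hb_def 2 3
    using X 1 by blast
qed

text \<open>
  The half-braidings \<open>P (Y \<otimes> Z)\<close> and \<open>Q (Y \<otimes> Z)\<close> are expanded by their hexagons, and the six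
  pentagons on the shuffles of \<open>A, B\<close> with \<open>Y, Z\<close> bring the associators into place.
\<close>

lemma hb_thb:
  assumes P: "hb A P" and Q: "hb B Q"
  shows "hb (A \<odot> B) (thb A P B Q)"
proof -
  note [simp] = hbD(1-4)[OF P] hbD(1-4)[OF Q]
  have nat: "thb A P B Q (cd f) \<cdot> ((A \<odot> B) \<rhd> f) = (f \<lhd> (A \<odot> B)) \<cdot> thb A P B Q (dm f)"
    if f: "arr f" for f
    using f by (simp add: thb_def as_wh as_wh_tl hb_nat_wh[OF P] hb_nat_wh[OF Q]
        tl2[OF hb_nat_wh(1)[OF Q]] tl2[OF hb_nat_wh(2)[OF P]])
  have hex: "as Y Z (A \<odot> B) \<cdot> thb A P B Q (Y \<odot> Z) \<cdot> as (A \<odot> B) Y Z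
      = (Y \<rhd> thb A P B Q Z) \<cdot> as Y (A \<odot> B) Z \<cdot> (thb A P B Q Y \<lhd> Z)"
    if [simp]: "Y \<in> Obj C" "Z \<in> Obj C" for Y Z
  proof -
    let ?tail = "((A \<rhd> Q Y) \<lhd> Z) \<cdot> (as A B Y \<lhd> Z)"
    let ?mid = "((P Y \<lhd> B) \<lhd> Z) \<cdot> (iv (as A Y B) \<lhd> Z)"
    \<comment> \<open>\<open>Q\<close> is moved past \<open>Y\<close> and \<open>Z\<close>.\<close>
    have q: "(A \<rhd> Q (Y \<odot> Z)) \<cdot> as A B (Y \<odot> Z) \<cdot> as (A \<odot> B) Y Z
      = (A \<rhd> iv (as Y Z B)) \<cdot> (A \<rhd> (Y \<rhd> Q Z)) \<cdot> (A \<rhd> as Y B Z) \<cdot> as A (Y \<odot> B) Z \<cdot> ?tail"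
      by (simp add: hb_hex[OF Q] pentagon_inv(4) as_wh_tl)
    have m: "(A \<rhd> (Y \<rhd> Q Z)) \<cdot> as A Y (B \<odot> Z) = as A Y (Z \<odot> B) \<cdot> ((A \<odot> Y) \<rhd> Q Z)"
      by (simp add: as_wh)
    \<comment> \<open>\<open>P Y\<close> and \<open>Q Z\<close> act on disjoint factors, hence commute.\<close>
    have p: "((P Y \<lhd> Z) \<lhd> B) \<cdot> iv (as (A \<odot> Y) Z B) \<cdot> ((A \<odot> Y) \<rhd> Q Z) \<cdot> as (A \<odot> Y) B Z
      = iv (as (Y \<odot> A) Z B) \<cdot> ((Y \<odot> A) \<rhd> Q Z) \<cdot> as (Y \<odot> A) B Z \<cdot> ((P Y \<lhd> B) \<lhd> Z)"
      by (simp add: as_wh as_wh_tl tl2[OF wh_swap'[of "P Y" "Q Z"]])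
    have n: "(Y \<rhd> (A \<rhd> Q Z)) \<cdot> as Y A (B \<odot> Z) = as Y A (Z \<odot> B) \<cdot> ((Y \<odot> A) \<rhd> Q Z)"
      "(Y \<rhd> (P Z \<lhd> B)) \<cdot> as Y (A \<odot> Z) B = as Y (Z \<odot> A) B \<cdot> ((Y \<rhd> P Z) \<lhd> B)"
      by (simp_all add: as_wh)
    have "as Y Z (A \<odot> B) \<cdot> thb A P B Q (Y \<odot> Z) \<cdot> as (A \<odot> B) Y Z
      = as Y Z (A \<odot> B) \<cdot> as (Y \<odot> Z) A B \<cdot> (P (Y \<odot> Z) \<lhd> B) \<cdot> iv (as A (Y \<odot> Z) B) \<cdot>
          (A \<rhd> iv (as Y Z B)) \<cdot> (A \<rhd> (Y \<rhd> Q Z)) \<cdot> (A \<rhd> as Y B Z) \<cdot> as A (Y \<odot> B) Z \<cdot> ?tail"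
      by (simp add: thb_def q)
    also have "\<dots> = as Y Z (A \<odot> B) \<cdot> as (Y \<odot> Z) A B \<cdot> (P (Y \<odot> Z) \<lhd> B) \<cdot> (as A Y Z \<lhd> B) \<cdot>
          iv (as (A \<odot> Y) Z B) \<cdot> ((A \<odot> Y) \<rhd> Q Z) \<cdot> as (A \<odot> Y) B Z \<cdot> (iv (as A Y B) \<lhd> Z) \<cdot> ?tail"
      by (simp add: tl2[OF pentagon_inv(2)] tl2[OF m] tl3[OF pentagon_inv(3)])
    also have "\<dots> = as Y Z (A \<odot> B) \<cdot> as (Y \<odot> Z) A B \<cdot> (iv (as Y Z A) \<lhd> B) \<cdot> ((Y \<rhd> P Z) \<lhd> B) \<cdot>
          (as Y A Z \<lhd> B) \<cdot> (((P Y \<lhd> Z) \<lhd> B) \<cdot> iv (as (A \<odot> Y) Z B) \<cdot> ((A \<odot> Y) \<rhd> Q Z) \<cdot> as (A \<odot> Y) B Z)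
          \<cdot> (iv (as A Y B) \<lhd> Z) \<cdot> ?tail"
      by (simp add: hb_hex[OF P])
    also have "\<dots> = (as Y Z (A \<odot> B) \<cdot> as (Y \<odot> Z) A B \<cdot> (iv (as Y Z A) \<lhd> B) \<cdot> ((Y \<rhd> P Z) \<lhd> B) \<cdot>
          (as Y A Z \<lhd> B) \<cdot> iv (as (Y \<odot> A) Z B) \<cdot> ((Y \<odot> A) \<rhd> Q Z) \<cdot> as (Y \<odot> A) B Z) \<cdot> ?mid \<cdot> ?tail"
      unfolding p by simp
    also have "as Y Z (A \<odot> B) \<cdot> as (Y \<odot> Z) A B \<cdot> (iv (as Y Z A) \<lhd> B) \<cdot> ((Y \<rhd> P Z) \<lhd> B) \<cdot>
          (as Y A Z \<lhd> B) \<cdot> iv (as (Y \<odot> A) Z B) \<cdot> ((Y \<odot> A) \<rhd> Q Z) \<cdot> as (Y \<odot> A) B Z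
      = (Y \<rhd> thb A P B Q Z) \<cdot> as Y (A \<odot> B) Z \<cdot> (as Y A B \<lhd> Z)"
      by (simp add: thb_def as_pentagon tl2[OF n(1)] tl2[OF n(2)] tl2[OF pentagon_inv(1)] tl2[OF pentagon_inv(2)])
    also have "((Y \<rhd> thb A P B Q Z) \<cdot> as Y (A \<odot> B) Z \<cdot> (as Y A B \<lhd> Z)) \<cdot> ?mid \<cdot> ?tail
      = (Y \<rhd> thb A P B Q Z) \<cdot> as Y (A \<odot> B) Z \<cdot> (thb A P B Q Y \<lhd> Z)"
      by (simp add: thb_def)
    finally show ?thesis .
  qed
  show ?thesis unfolding hb_def
    using nat hex by (auto simp: thb_def)
qed

lemma hb_uhb: "hb I uhb"
proof -
  have hex: "as Y Z I \<cdot> uhb (Y \<odot> Z) \<cdot> as I Y Z = (Y \<rhd> uhb Z) \<cdot> as Y I Z \<cdot> (uhb Y \<lhd> Z)"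
    if [simp]: "Y \<in> Obj C" "Z \<in> Obj C" for Y Z
  proof -
    have r: "iv (ru (Y \<odot> Z)) = iv (as Y Z I) \<cdot> (Y \<rhd> iv (ru Z))"
      by (simp flip: ru_tens)
    show ?thesis by (simp add: uhb_def lu_tens r tl2[OF triangle])
  qed
  have nat: "uhb (cd f) \<cdot> (I \<rhd> f) = (f \<lhd> I) \<cdot> uhb (dm f)" if f: "arr f" for f
  proof -
    have r: "iv (ru (cd f)) \<cdot> f = (f \<lhd> I) \<cdot> iv (ru (dm f))"
      using f ru_nat[OF f] by (intro conj_inverse) simp_all
    then show ?thesis using f by (simp add: uhb_def lu_nat tl2[OF r])
  qed
  show ?thesis unfolding hb_def using hex nat by (auto simp: uhb_def)
qed

lemma im_idt: "hb X P \<Longrightarrow> im P P (idt X)"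
  by (simp add: im_def hbD)

lemma im_cmp:
  assumes "hb A P" "hb B Q" "hb D R" "arr f" "dm f = A" "cd f = B" "arr g" "dm g = B" "cd g = D"
    and "im P Q f" "im Q R g"
  shows "im P R (g \<cdot> f)"
  using assms(1-9) assms(10,11)[unfolded im_def]
  by (simp add: im_def hbD[OF assms(1)] hbD[OF assms(2)] hbD[OF assms(3)] tl2[of _ "Q _"])

lemma im_iv:
  assumes "hb A P" "hb B Q" "isoarr f" "dm f = A" "cd f = B" "im P Q f"
  shows "im Q P (iv f)"
  unfolding im_def
proof
  fix Y assume [simp]: "Y \<in> Obj C"
  note [simp] = hbD(1-4)[OF assms(1)] hbD(1-4)[OF assms(2)]
  have "iv (Y \<rhd> f) \<cdot> Q Y = P Y \<cdot> iv (f \<lhd> Y)"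
    using assms(3-6) by (intro conj_inverse) (simp_all add: im_def)
  then show "(Y \<rhd> iv f) \<cdot> Q Y = P Y \<cdot> (iv f \<lhd> Y)" using assms by simp
qed

lemma im_wh:
  assumes "im P Q f" "arr f" "hb (dm f) P" "hb (cd f) Q" "Y \<in> Obj C" "W \<in> Obj C"
  shows "(W \<rhd> Q Y) \<cdot> (W \<rhd> (f \<lhd> Y)) = (W \<rhd> (Y \<rhd> f)) \<cdot> (W \<rhd> P Y)"
    and "(Q Y \<lhd> W) \<cdot> ((f \<lhd> Y) \<lhd> W) = ((Y \<rhd> f) \<lhd> W) \<cdot> (P Y \<lhd> W)"
  using assms hbD(1-4)[OF assms(3)] hbD(1-4)[OF assms(4)] by (simp_all add: im_def flip: wh_cmp)

lemma im_tns:
  assumes P: "hb A P" and P': "hb A' P'" and Q: "hb B Q" and Q': "hb B' Q'"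
    and [simp]: "arr f" "dm f = A" "cd f = A'" "arr g" "dm g = B" "cd g = B'"
    and f: "im P P' f" and g: "im Q Q' g"
  shows "im (thb A P B Q) (thb A' P' B' Q') (f \<boxtimes> g)"
  unfolding im_def
proof
  fix Y assume [simp]: "Y \<in> Obj C"
  note [simp] = hbD(1-4)[OF P] hbD(1-4)[OF Q] hbD(1-4)[OF P'] hbD(1-4)[OF Q']
  have 1: "(Y \<rhd> (f \<lhd> B)) \<cdot> thb A P B Q Y = thb A' P' B Q Y \<cdot> ((f \<lhd> B) \<lhd> Y)"
  proof -
    have e: "as Y A' B \<cdot> ((Y \<rhd> f) \<lhd> B) = (Y \<rhd> (f \<lhd> B)) \<cdot> as Y A B" by (simp add: as_wh)
    have "thb A' P' B Q Y \<cdot> ((f \<lhd> B) \<lhd> Y)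
      = as Y A' B \<cdot> (P' Y \<lhd> B) \<cdot> iv (as A' Y B) \<cdot> (A' \<rhd> Q Y) \<cdot> (f \<lhd> (B \<odot> Y)) \<cdot> as A B Y"
      by (simp add: thb_def as_wh)
    also have "\<dots> = as Y A' B \<cdot> (P' Y \<lhd> B) \<cdot> ((f \<lhd> Y) \<lhd> B) \<cdot> iv (as A Y B) \<cdot> (A \<rhd> Q Y) \<cdot> as A B Y"
      by (simp add: as_wh_tl tl2[OF wh_swap'[of f "Q Y"]])
    also have "\<dots> = (Y \<rhd> (f \<lhd> B)) \<cdot> thb A P B Q Y"
      by (simp add: thb_def tl2[OF im_wh(2)[OF f]] P P' tl2[OF e])
    finally show ?thesis by simp
  qed
  have 2: "(Y \<rhd> (A' \<rhd> g)) \<cdot> thb A' P' B Q Y = thb A' P' B' Q' Y \<cdot> ((A' \<rhd> g) \<lhd> Y)"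
  proof -
    have "thb A' P' B' Q' Y \<cdot> ((A' \<rhd> g) \<lhd> Y)
      = as Y A' B' \<cdot> (P' Y \<lhd> B') \<cdot> iv (as A' Y B') \<cdot> (A' \<rhd> (Y \<rhd> g)) \<cdot> (A' \<rhd> Q Y) \<cdot> as A' B Y"
      by (simp add: thb_def as_wh tl2[OF im_wh(1)[OF g]] Q Q')
    also have "\<dots> = as Y A' B' \<cdot> ((Y \<odot> A') \<rhd> g) \<cdot> (P' Y \<lhd> B) \<cdot> iv (as A' Y B) \<cdot> (A' \<rhd> Q Y) \<cdot> as A' B Y"
      by (simp add: as_wh_tl tl2[OF wh_swap[of "P' Y" g]])
    also have "\<dots> = (Y \<rhd> (A' \<rhd> g)) \<cdot> thb A' P' B Q Y"
      by (simp add: thb_def as_wh_tl)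
    finally show ?thesis by simp
  qed
  have t: "dm (thb A P B Q Y) = (A \<odot> B) \<odot> Y" "arr (thb A P B Q Y)" "arr (thb A' P' B Q Y)"
    "arr (thb A' P' B' Q' Y)" "cd (thb A P B Q Y) = Y \<odot> (A \<odot> B)"
    "cd (thb A' P' B Q Y) = Y \<odot> (A' \<odot> B)" "dm (thb A' P' B Q Y) = (A' \<odot> B) \<odot> Y"
    "dm (thb A' P' B' Q' Y) = (A' \<odot> B') \<odot> Y"
    by (simp_all add: thb_def)
  show "(Y \<rhd> (f \<boxtimes> g)) \<cdot> thb A P B Q Y = thb A' P' B' Q' Y \<cdot> ((f \<boxtimes> g) \<lhd> Y)"
    using t by (simp add: tns_wh 1 tl2[OF 2])
qed

lemma im_as:
  assumes P: "hb A P" and Q: "hb B Q" and R: "hb D R"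
  shows "im (thb (A \<odot> B) (thb A P B Q) D R) (thb A P (B \<odot> D) (thb B Q D R)) (as A B D)"
  unfolding im_def
proof
  fix Y assume [simp]: "Y \<in> Obj C"
  note [simp] = hbD(1-4)[OF P] hbD(1-4)[OF Q] hbD(1-4)[OF R]
  have n: "(A \<rhd> (B \<rhd> R Y)) \<cdot> as A B (D \<odot> Y) = as A B (Y \<odot> D) \<cdot> ((A \<odot> B) \<rhd> R Y)"
    "(A \<rhd> (Q Y \<lhd> D)) \<cdot> as A (B \<odot> Y) D = as A (Y \<odot> B) D \<cdot> ((A \<rhd> Q Y) \<lhd> D)"
    "(P Y \<lhd> (B \<odot> D)) \<cdot> as (A \<odot> Y) B D = as (Y \<odot> A) B D \<cdot> ((P Y \<lhd> B) \<lhd> D)"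
    by (simp_all add: as_wh)
  show "(Y \<rhd> as A B D) \<cdot> thb (A \<odot> B) (thb A P B Q) D R Y
    = thb A P (B \<odot> D) (thb B Q D R) Y \<cdot> (as A B D \<lhd> Y)"
    by (simp add: thb_def as_pentagon tl3[OF as_pentagon] tl2[OF n(1)] tl2[OF n(2)] tl2[OF n(3)]
        tl2[OF pentagon_inv(1)] tl2[OF pentagon_inv(2)])
qed

lemma im_lu:
  assumes P: "hb A P" shows "im (thb I uhb A P) P (lu A)"
  unfolding im_def
proof
  fix Y assume [simp]: "Y \<in> Obj C"
  note [simp] = hbD(1-4)[OF P]
  have l: "(lu Y \<lhd> A) \<cdot> iv (as I Y A) = lu (Y \<odot> A)" by (simp flip: lu_tens)
  have n: "lu (Y \<odot> A) \<cdot> (I \<rhd> P Y) = P Y \<cdot> lu (A \<odot> Y)" using lu_nat[of "P Y"] by simp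
  show "(Y \<rhd> lu A) \<cdot> thb I uhb A P Y = P Y \<cdot> (lu A \<lhd> Y)"
    by (simp add: thb_def uhb_def tl2[OF triangle] tl2[OF l] tl2[OF n] lu_tens)
qed

lemma im_ru:
  assumes P: "hb A P" shows "im (thb A P I uhb) P (ru A)"
  unfolding im_def
proof
  fix Y assume [simp]: "Y \<in> Obj C"
  note [simp] = hbD(1-4)[OF P]
  have r: "ru (A \<odot> Y) \<cdot> iv (as A Y I) = A \<rhd> ru Y" by (simp flip: ru_tens)
  have n: "ru (Y \<odot> A) \<cdot> (P Y \<lhd> I) = P Y \<cdot> ru (A \<odot> Y)" using ru_nat[of "P Y"] by simp
  show "(Y \<rhd> ru A) \<cdot> thb A P I uhb Y = P Y \<cdot> (ru A \<lhd> Y)"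
    by (simp add: thb_def uhb_def tl2[OF ru_tens] tl2[OF r] tl2[OF n] triangle)
qed

text \<open>
  A half-braiding is itself an intertwiner \<open>(A, P) \<otimes> (B, Q) \<rightarrow> (B, Q) \<otimes> (A, P)\<close>: up to
  associators, both sides are \<open>P (Y \<otimes> B)\<close> composed with \<open>Q Y\<close>, by the hexagon for \<open>P\<close> and its naturality.
\<close>

lemma im_braid:
  assumes P: "hb A P" and Q: "hb B Q"
  shows "im (thb A P B Q) (thb B Q A P) (P B)"
  unfolding im_def
proof
  fix Y assume [simp]: "Y \<in> Obj C"
  note [simp] = hbD(1-4)[OF P] hbD(1-4)[OF Q]
  have n: "P (Y \<odot> B) \<cdot> (A \<rhd> Q Y) = (Q Y \<lhd> A) \<cdot> P (B \<odot> Y)"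
    using hbD(5)[OF P, of "Q Y"] by simp
  have "(Y \<rhd> P B) \<cdot> thb A P B Q Y
    = as Y B A \<cdot> (P (Y \<odot> B) \<cdot> (A \<rhd> Q Y)) \<cdot> as A B Y"
    by (simp add: thb_def hb_hex[OF P])
  also have "\<dots> = thb B Q A P Y \<cdot> (P B \<lhd> Y)"
    unfolding n by (simp add: thb_def hb_hex[OF P])
  finally show "(Y \<rhd> P B) \<cdot> thb A P B Q Y = thb B Q A P Y \<cdot> (P B \<lhd> Y)" .
qed

end


section \<open>The Drinfeld center is braided\<close>

lemma center_sel [simp]:
  "Ident (center C) x = Ident C (fst x)"
  "Comp (center C) = Comp C"
  "ZeroM (center C) x y = ZeroM C (fst x) (fst y)"
  "AddM (center C) = AddM C"
  "Scale (center C) = Scale C"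
  "TensO (center C) x y
    = (fst x \<odot>\<^bsub>C\<^esub> fst y, tens_half_braiding C (fst x) (snd x) (fst y) (snd y))"
  "TensM (center C) = TensM C"
  "Assoc (center C) x y z = Assoc C (fst x) (fst y) (fst z)"
  "UnitO (center C) = (UnitO C, unit_half_braiding C)"
  "Iota (center C) = Iota C"
  "Braid (center C) x y = snd x (fst y)"
  by (simp_all add: center_def split: prod.splits)

context monoidal_category
begin

lemma center_obj: "x \<in> Obj (center C) \<longleftrightarrow> fst x \<in> Obj C \<and> half_braiding C (fst x) (snd x)"
  by (simp add: center_def case_prod_beta)

text \<open>The half-braiding of an object of the center.\<close>

abbreviation hbp where "hbp x \<equiv> hbt (fst x) (snd x)"

lemma center_obj_hb:
  "x \<in> Obj (center C) \<longleftrightarrow> snd x \<in> extensional (Obj C) \<and> hb (fst x) (hbp x)"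
proof -
  have "hb (fst x) (hbp x) \<Longrightarrow> fst x \<in> Obj C" by (simp add: hb_def)
  then show ?thesis using half_braiding_iff[of "fst x" "snd x"] center_obj[of x] by blast
qed

lemma center_objD [simp]: "x \<in> Obj (center C) \<Longrightarrow> fst x \<in> Obj C" "x \<in> Obj (center C) \<Longrightarrow> hb (fst x) (hbp x)"
  using center_obj center_obj_hb by blast+

lemma center_objD_pair:
  "(A, \<phi>) \<in> Obj (center C) \<Longrightarrow> A \<in> Obj C" "(A, \<phi>) \<in> Obj (center C) \<Longrightarrow> hb A (hbt A \<phi>)"
  using center_objD[of "(A, \<phi>)"] by simp_all

lemma center_hom:
  "f \<in> Hom (center C) x y \<longleftrightarrow> f \<in> Hom C (fst x) (fst y) \<and> im (hbp x) (hbp y) (fst x, f, fst y)"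
  by (simp add: center_def im_def hbt_def cmp_def lw_def rw_def tns_def idt_def case_prod_beta)

lemma center_homD: "f \<in> Hom (center C) x y \<Longrightarrow> f \<in> Hom C (fst x) (fst y)"
  by (simp add: center_hom)

lemma center_arr:
  "\<lbrakk>x \<in> Obj (center C); y \<in> Obj (center C); f \<in> Hom (center C) x y\<rbrakk> \<Longrightarrow> arr (fst x, f, fst y)"
  by (simp add: arr_triple center_hom)

lemma hbt_tens:
  "Y \<in> Obj C \<Longrightarrow> hbt (A \<odot> B) (tens_half_braiding C A \<phi> B \<psi>) Y = thb A (hbt A \<phi>) B (hbt B \<psi>) Y"
  by (simp add: hbt_def thb_def tens_half_braiding_def cmp_def lw_def rw_def tns_def idt_def as_def
      iv_def assoc_inv_def)

lemma hbt_unit: "Y \<in> Obj C \<Longrightarrow> hbt I (unit_half_braiding C) Y = uhb Y"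
  by (simp add: hbt_def uhb_def unit_half_braiding_def cmp_def lu_def ru_def iv_def)

lemma center_tens_obj:
  assumes "x \<in> Obj (center C)" "y \<in> Obj (center C)"
  shows "x \<odot>\<^bsub>center C\<^esub> y \<in> Obj (center C)"
  using hb_thb[of "fst x" "hbp x" "fst y" "hbp y"] assms
    hb_cong[of "hbt (fst x \<odot> fst y) (tens_half_braiding C (fst x) (snd x) (fst y) (snd y))"
      "thb (fst x) (hbp x) (fst y) (hbp y)"]
  by (simp add: center_obj_hb[of "(_, _)"] hbt_tens) (simp add: tens_half_braiding_def)

lemma center_unit_obj: "UnitO (center C) \<in> Obj (center C)"
  using hb_uhb hb_cong[of "hbt I (unit_half_braiding C)" uhb]
  by (simp add: center_obj_hb[of "(_, _)"] hbt_unit) (simp add: unit_half_braiding_def)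

lemma center_homI:
  assumes "arr t" "dm t = fst x" "cd t = fst y" "im (hbp x) (hbp y) t"
  shows "mo t \<in> Hom (center C) x y"
  using assms arrD(3)[OF assms(1)] triple_collapse[of t] by (simp add: center_hom)

lemma center_tens_hom:
  assumes "x \<in> Obj (center C)" "y \<in> Obj (center C)" "x' \<in> Obj (center C)" "y' \<in> Obj (center C)"
    and f: "f \<in> Hom (center C) x y" and g: "g \<in> Hom (center C) x' y'"
  shows "f \<star> g \<in> Hom (center C) (x \<odot>\<^bsub>center C\<^esub> x') (y \<odot>\<^bsub>center C\<^esub> y')"
proof -
  let ?f = "(fst x, f, fst y)" and ?g = "(fst x', g, fst y')"
  have "im (thb (fst x) (hbp x) (fst x') (hbp x')) (thb (fst y) (hbp y) (fst y') (hbp y')) (?f \<boxtimes> ?g)"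
    using assms by (intro im_tns) (auto simp: center_hom arr_triple)
  then have "mo (?f \<boxtimes> ?g) \<in> Hom (center C) (x \<odot>\<^bsub>center C\<^esub> x') (y \<odot>\<^bsub>center C\<^esub> y')"
    using assms by (intro center_homI) (simp_all add: center_arr hbt_tens cong: im_cong)
  then show ?thesis by (simp add: mo_sel)
qed

lemma center_inverse_pair:
  assumes x: "x \<in> Obj (center C)" and y: "y \<in> Obj (center C)" and f: "f \<in> Hom (center C) x y"
    and p: "inverse_pair C (fst x) (fst y) f g"
  shows "inverse_pair (center C) x y f g"
proof -
  let ?t = "(fst x, f, fst y)"
  have t: "isoarr ?t" using x y p by (auto simp: isoarr_def is_iso_def arr_triple inverse_pair_def)
  have g: "g = mo (iv ?t)" using iso_inv_eqI[OF _ _ p] x y by (simp add: mo_sel)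
  have "im (hbp y) (hbp x) (iv ?t)"
    using im_iv[of "fst x" "hbp x" "fst y" "hbp y" ?t] t x y f by (simp add: center_hom)
  then have "g \<in> Hom (center C) y x" unfolding g using t by (intro center_homI) simp_all
  then show ?thesis using p f by (simp add: inverse_pair_def)
qed

lemma center_iso:
  assumes "x \<in> Obj (center C)" "y \<in> Obj (center C)" "isoarr t" "dm t = fst x" "cd t = fst y"
    and "im (hbp x) (hbp y) t"
  shows "is_iso (center C) x y (mo t)"
  using center_inverse_pair[OF assms(1,2) center_homI[of t x y]] assms
  unfolding isoarr_def is_iso_def by auto

lemma center_iso_inv:
  assumes "linear_category (center C)" "x \<in> Obj (center C)" "y \<in> Obj (center C)" "is_iso (center C) x y f"
  shows "iso_inv (center C) x y f = iso_inv C (fst x) (fst y) f"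
proof -
  obtain g where g: "inverse_pair (center C) x y f g" using assms(4) by (auto simp: is_iso_def)
  then have "inverse_pair C (fst x) (fst y) f g" by (auto simp: inverse_pair_def center_hom)
  then show ?thesis
    using iso_inv_eqI[of "fst x" "fst y"] linear_category.iso_inv_eqI[OF assms(1-3) g] assms(2,3) by simp
qed

text \<open>Intertwiners form a linear subspace, so that the center is again linear.\<close>

lemma im_zero:
  assumes "hb A P" "hb B Q" shows "im P Q (A, ZeroM C A B, B)"
proof -
  note AB = hbD(1)[OF assms(1)] hbD(1)[OF assms(2)]
  have z: "(A, ZeroM C A B, B) = scl 0 (A, ZeroM C A B, B)"
    using scale_by_zero[OF AB zero_in_hom[OF AB]] by (simp add: scl_def)
  have a: "arr (A, ZeroM C A B, B)" using AB zero_in_hom by (simp add: arr_triple)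
  have s: "scl 0 s = (dm s, ZeroM C (dm s) (cd s), cd s)" if "arr s" for s
    using that scale_by_zero[of "dm s" "cd s" "mo s"] by (simp add: scl_def)
  have "im P Q (scl 0 t)" if "arr t" "dm t = A" "cd t = B" for t
    unfolding im_def
  proof
    fix Y assume [simp]: "Y \<in> Obj C"
    note [simp] = that hbD(1-4)[OF assms(1)] hbD(1-4)[OF assms(2)]
    have "(Y \<rhd> scl 0 t) \<cdot> P Y = scl 0 ((Y \<rhd> t) \<cdot> P Y)" by simp
    also have "\<dots> = scl 0 (Q Y \<cdot> (t \<lhd> Y))"
      using s[of "(Y \<rhd> t) \<cdot> P Y"] s[of "Q Y \<cdot> (t \<lhd> Y)"] by simp
    also have "\<dots> = Q Y \<cdot> (scl 0 t \<lhd> Y)" by simp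
    finally show "(Y \<rhd> scl 0 t) \<cdot> P Y = Q Y \<cdot> (scl 0 t \<lhd> Y)" .
  qed
  from this[OF a] show ?thesis unfolding z[symmetric] by simp
qed

lemma im_add:
  assumes "hb A P" "hb B Q" "f \<in> Hom C A B" "g \<in> Hom C A B" "im P Q (A, f, B)" "im P Q (A, g, B)"
  shows "im P Q (A, AddM C f g, B)"
  unfolding im_def
proof
  fix Y assume Y: "Y \<in> Obj C"
  note AB = hbD(1)[OF assms(1)] hbD(1)[OF assms(2)]
  note p = hbD(2-4)[OF assms(1) Y] and q = hbD(2-4)[OF assms(2) Y]
  note i = ident_closed[OF Y]
  have wf: "Ident C Y \<star> h \<in> Hom C (Y \<odot> A) (Y \<odot> B)" "h \<star> Ident C Y \<in> Hom C (A \<odot> Y) (B \<odot> Y)"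
    if "h \<in> Hom C A B" for h
    using tens_closed[OF Y Y AB i that] tens_closed[OF AB Y Y that i] by auto
  have pp: "mo (P Y) \<in> Hom C (A \<odot> Y) (Y \<odot> A)" "mo (Q Y) \<in> Hom C (B \<odot> Y) (Y \<odot> B)"
    using p q arrD(3)[of "P Y"] arrD(3)[of "Q Y"] by simp_all
  have e: "(Ident C Y \<star> h) \<bullet> mo (P Y) = mo (Q Y) \<bullet> (h \<star> Ident C Y)" if "im P Q (A, h, B)" for h
    using that Y by (auto simp: im_def cmp_def lw_def rw_def tns_def idt_def)
  have "(Ident C Y \<star> AddM C f g) \<bullet> mo (P Y) = mo (Q Y) \<bullet> (AddM C f g \<star> Ident C Y)"
    using tens_add_right[OF Y Y AB i assms(3,4)] tens_add_left[OF AB Y Y assms(3,4) i]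
      comp_add_left[OF _ _ _ pp(1) wf(1)[OF assms(3)] wf(1)[OF assms(4)]]
      comp_add_right[OF _ _ _ wf(2)[OF assms(3)] wf(2)[OF assms(4)] pp(2)]
      e[OF assms(5)] e[OF assms(6)] Y AB by simp
  then show "(Y \<rhd> (A, AddM C f g, B)) \<cdot> P Y = Q Y \<cdot> ((A, AddM C f g, B) \<lhd> Y)"
    using p q by (intro triple_eqI) (simp_all add: mo_sel)
qed

lemma im_scl:
  assumes "hb A P" "hb B Q" "arr t" "dm t = A" "cd t = B" "im P Q t"
  shows "im P Q (scl a t)"
  using assms(3-6) by (simp add: im_def hbD[OF assms(1)] hbD[OF assms(2)])

lemma center_linear: "linear_category (center C)"
proof (rule linear_category.intro)
  fix x y assume [simp]: "x \<in> Obj (center C)" "y \<in> Obj (center C)"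
  interpret A: abelian_group "hom_group C (fst x) (fst y)" by (rule hom_abelian) simp_all
  have c [simp]: "carrier (hom_group C (fst x) (fst y)) = Hom C (fst x) (fst y)"
    "add (hom_group C (fst x) (fst y)) = AddM C"
    "zero (hom_group C (fst x) (fst y)) = ZeroM C (fst x) (fst y)"
    by (simp_all add: hom_group_def)
  note a = A.a_assoc[unfolded c] and l = A.l_zero[unfolded c] and m = A.a_comm[unfolded c]
  have cZ: "carrier (hom_group (center C) x y) = Hom (center C) x y"
    "add (hom_group (center C) x y) = AddM C"
    "zero (hom_group (center C) x y) = ZeroM C (fst x) (fst y)"
    by (simp_all add: hom_group_def)
  show "abelian_group (hom_group (center C) x y)"
  proof (rule abelian_groupI, unfold cZ)
    show "ZeroM C (fst x) (fst y) \<in> Hom (center C) x y"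
      using im_zero by (simp add: center_hom zero_in_hom)
  next
    fix f assume f: "f \<in> Hom (center C) x y"
    then have fh: "f \<in> Hom C (fst x) (fst y)" by (rule center_homD)
    show "AddM C (ZeroM C (fst x) (fst y)) f = f" using l[OF fh] .
    show "\<exists>g\<in>Hom (center C) x y. AddM C g f = ZeroM C (fst x) (fst y)"
    proof
      have "AddM C (Scale C (-1) f) (Scale C 1 f) = Scale C 0 f"
        using scale_add_left[of "fst x" "fst y" f "-1" 1] fh by simp
      then show "AddM C (Scale C (-1) f) f = ZeroM C (fst x) (fst y)"
        using scale_by_zero[of "fst x" "fst y" f] scale_one[of "fst x" "fst y" f] fh by simp
      show "Scale C (-1) f \<in> Hom (center C) x y"
        using f im_scl[of "fst x" "hbp x" "fst y" "hbp y" "(fst x, f, fst y)" "-1"] scale_closed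
        by (simp add: center_hom arr_triple) (simp add: scl_def)
    qed
    fix g assume g: "g \<in> Hom (center C) x y"
    then have gh: "g \<in> Hom C (fst x) (fst y)" by (rule center_homD)
    show "AddM C f g \<in> Hom (center C) x y" using f g im_add add_in_hom by (simp add: center_hom)
    show "AddM C f g = AddM C g f" using m[OF fh gh] .
    fix h assume "h \<in> Hom (center C) x y"
    then have hh: "h \<in> Hom C (fst x) (fst y)" by (rule center_homD)
    show "AddM C (AddM C f g) h = AddM C f (AddM C g h)" using a[OF fh gh hh] .
  qed
next
  fix x y f a assume "x \<in> Obj (center C)" "y \<in> Obj (center C)" "f \<in> Hom (center C) x y"
  then show "Scale (center C) a f \<in> Hom (center C) x y"
    using im_scl[of "fst x" "hbp x" "fst y" "hbp y" "(fst x, f, fst y)" a] scale_closed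
    by (simp add: center_hom arr_triple) (simp add: scl_def)
next
  fix x assume "x \<in> Obj (center C)"
  then show "Ident (center C) x \<in> Hom (center C) x x"
    using im_idt[of "fst x" "hbp x"] ident_closed by (simp add: center_hom) (simp add: idt_def)
next
  fix x y z f g assume "x \<in> Obj (center C)" "y \<in> Obj (center C)" "z \<in> Obj (center C)"
    "f \<in> Hom (center C) x y" "g \<in> Hom (center C) y z"
  then show "g \<bullet>\<^bsub>center C\<^esub> f \<in> Hom (center C) x z"
    using im_cmp[of "fst x" "hbp x" "fst y" "hbp y" "fst z" "hbp z" "(fst x, f, fst y)" "(fst y, g, fst z)"]
      comp_closed[of "fst x" "fst y" "fst z" f g]
    by (simp add: center_hom arr_triple) (simp add: cmp_def)
qed (auto dest!: center_homD center_objD_pair(1) simp: scale_add_right scale_add_left scale_scale scale_one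
      comp_ident ident_comp comp_assoc comp_add_left comp_add_right comp_scale_left comp_scale_right)

lemma center_monoidal: "monoidal_category (center C)"
proof -
  interpret Z: linear_category "center C" by (rule center_linear)
  note to = center_tens_obj[simplified]
  let ?U = "UnitO (center C)"
  have uo: "?U \<in> Obj (center C)" "(I, unit_half_braiding C) \<in> Obj (center C)"
    using center_unit_obj by simp_all
  \<comment> \<open>The unitors are intertwiners, so tensoring with the unit is isomorphic to the identity.\<close>
  have lu: "is_iso (center C) (?U \<odot>\<^bsub>center C\<^esub> x) x (mo (lu (fst x)))"
    and ru: "is_iso (center C) (x \<odot>\<^bsub>center C\<^esub> ?U) x (mo (ru (fst x)))"
    if x: "x \<in> Obj (center C)" for x
  proof -
    have u: "thb I (hbt I (unit_half_braiding C)) (fst x) (hbp x) Y = thb I uhb (fst x) (hbp x) Y"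
      "thb (fst x) (hbp x) I (hbt I (unit_half_braiding C)) Y = thb (fst x) (hbp x) I uhb Y"
      if "Y \<in> Obj C" for Y
      using that by (simp_all add: thb_def hbt_unit)
    show "is_iso (center C) (?U \<odot>\<^bsub>center C\<^esub> x) x (mo (lu (fst x)))"
      using x center_tens_obj[OF center_unit_obj x] im_lu[of "fst x" "hbp x"]
      by (intro center_iso) (simp_all add: hbt_tens u cong: im_cong)
    show "is_iso (center C) (x \<odot>\<^bsub>center C\<^esub> ?U) x (mo (ru (fst x)))"
      using x center_tens_obj[OF x center_unit_obj] im_ru[of "fst x" "hbp x"]
      by (intro center_iso) (simp_all add: hbt_tens u cong: im_cong)
  qed
  show ?thesis
  proof
    fix x y assume "x \<in> Obj (center C)" "y \<in> Obj (center C)"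
    then show "x \<odot>\<^bsub>center C\<^esub> y \<in> Obj (center C)" by (rule center_tens_obj)
  next
    fix x y x' y' f g
    assume "x \<in> Obj (center C)" "y \<in> Obj (center C)" "x' \<in> Obj (center C)" "y' \<in> Obj (center C)"
      "f \<in> Hom (center C) x y" "g \<in> Hom (center C) x' y'"
    then show "f \<star>\<^bsub>center C\<^esub> g \<in> Hom (center C) (x \<odot>\<^bsub>center C\<^esub> x') (y \<odot>\<^bsub>center C\<^esub> y')"
      using center_tens_hom by simp
  next
    fix x y z assume [simp]: "x \<in> Obj (center C)" "y \<in> Obj (center C)" "z \<in> Obj (center C)"
    have e: "thb (fst x \<odot> fst y) (hbt (fst x \<odot> fst y) (tens_half_braiding C (fst x) (snd x) (fst y) (snd y)))
          (fst z) (hbp z) Y = thb (fst x \<odot> fst y) (thb (fst x) (hbp x) (fst y) (hbp y)) (fst z) (hbp z) Y"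
      "thb (fst x) (hbp x) (fst y \<odot> fst z) (hbt (fst y \<odot> fst z)
          (tens_half_braiding C (fst y) (snd y) (fst z) (snd z))) Y
        = thb (fst x) (hbp x) (fst y \<odot> fst z) (thb (fst y) (hbp y) (fst z) (hbp z)) Y"
      if "Y \<in> Obj C" for Y
      using that by (simp_all add: thb_def hbt_tens)
    have o: "(x \<odot>\<^bsub>center C\<^esub> y) \<odot>\<^bsub>center C\<^esub> z \<in> Obj (center C)" "x \<odot>\<^bsub>center C\<^esub> (y \<odot>\<^bsub>center C\<^esub> z) \<in> Obj (center C)"
      using center_tens_obj by auto
    have "is_iso (center C) ((x \<odot>\<^bsub>center C\<^esub> y) \<odot>\<^bsub>center C\<^esub> z) (x \<odot>\<^bsub>center C\<^esub> (y \<odot>\<^bsub>center C\<^esub> z))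
      (mo (as (fst x) (fst y) (fst z)))"
      using o im_as[of "fst x" "hbp x" "fst y" "hbp y" "fst z" "hbp z"]
      by (intro center_iso) (simp_all add: hbt_tens e cong: im_cong)
    then show "is_iso (center C) ((x \<odot>\<^bsub>center C\<^esub> y) \<odot>\<^bsub>center C\<^esub> z) (x \<odot>\<^bsub>center C\<^esub> (y \<odot>\<^bsub>center C\<^esub> z))
      (Assoc (center C) x y z)"
      by (simp add: mo_sel)
  next
    show "?U \<in> Obj (center C)" by (rule center_unit_obj)
    show "is_iso (center C) (?U \<odot>\<^bsub>center C\<^esub> ?U) ?U (Iota (center C))"
      using ru[OF center_unit_obj] ru_unit by simp (simp add: io_def)
    show "is_equivalence (center C) (center C) (\<lambda>x. ?U \<odot>\<^bsub>center C\<^esub> x) (\<lambda>f. Ident (center C) ?U \<star>\<^bsub>center C\<^esub> f)"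
    proof (rule Z.natural_iso_id_equivalence)
      have "Ident C I \<star> (g \<bullet> f) = (Ident C I \<star> g) \<bullet> (Ident C I \<star> f)"
        if "X \<in> Obj C" "Y \<in> Obj C" "Z \<in> Obj C" "f \<in> Hom C X Y" "g \<in> Hom C Y Z" for X Y Z f g
        using tens_comp[of I I I X Y Z "Ident C I" "Ident C I" f g] that ident_closed comp_ident[of I I]
        by simp
      then have c: "Ident C I \<star> (g \<bullet> f) = (Ident C I \<star> g) \<bullet> (Ident C I \<star> f)"
        if "x \<in> Obj (center C)" "y \<in> Obj (center C)" "z \<in> Obj (center C)"
          "f \<in> Hom (center C) x y" "g \<in> Hom (center C) y z" for x y z f g
        using that center_objD(1) center_homD by blast
      show "is_functor (center C) (center C) (\<lambda>x. ?U \<odot>\<^bsub>center C\<^esub> x) (\<lambda>f. Ident (center C) ?U \<star>\<^bsub>center C\<^esub> f)"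
        unfolding is_functor_def
        using c center_tens_obj[OF center_unit_obj] center_tens_hom[OF center_unit_obj center_unit_obj _ _
            Z.ident_closed[OF center_unit_obj]]
        by (intro conjI ballI) (simp_all add: tens_ident)
      have "mo (lu (fst y)) \<bullet> (Ident C I \<star> f) = f \<bullet> mo (lu (fst x))"
        if "x \<in> Obj (center C)" "y \<in> Obj (center C)" "f \<in> Hom (center C) x y" for x y f
        using lu_nat[OF center_arr[OF that]] by (auto dest!: arg_cong[of _ _ mo] simp: mo_sel)
      then show "natural_iso (center C) (center C) (\<lambda>x. ?U \<odot>\<^bsub>center C\<^esub> x)
          (\<lambda>f. Ident (center C) ?U \<star>\<^bsub>center C\<^esub> f) (\<lambda>x. x) (\<lambda>f. f) (\<lambda>x. mo (lu (fst x)))"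
        using lu unfolding natural_iso_def by simp
    qed
    show "is_equivalence (center C) (center C) (\<lambda>x. x \<odot>\<^bsub>center C\<^esub> ?U) (\<lambda>f. f \<star>\<^bsub>center C\<^esub> Ident (center C) ?U)"
    proof (rule Z.natural_iso_id_equivalence)
      have "(g \<bullet> f) \<star> Ident C I = (g \<star> Ident C I) \<bullet> (f \<star> Ident C I)"
        if "X \<in> Obj C" "Y \<in> Obj C" "Z \<in> Obj C" "f \<in> Hom C X Y" "g \<in> Hom C Y Z" for X Y Z f g
        using tens_comp[of X Y Z I I I f g "Ident C I" "Ident C I"] that ident_closed comp_ident[of I I]
        by simp
      then have c: "(g \<bullet> f) \<star> Ident C I = (g \<star> Ident C I) \<bullet> (f \<star> Ident C I)"
        if "x \<in> Obj (center C)" "y \<in> Obj (center C)" "z \<in> Obj (center C)"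
          "f \<in> Hom (center C) x y" "g \<in> Hom (center C) y z" for x y z f g
        using that center_objD(1) center_homD by blast
      show "is_functor (center C) (center C) (\<lambda>x. x \<odot>\<^bsub>center C\<^esub> ?U) (\<lambda>f. f \<star>\<^bsub>center C\<^esub> Ident (center C) ?U)"
        unfolding is_functor_def
        using c center_tens_obj[OF _ center_unit_obj] center_tens_hom[OF _ _ center_unit_obj center_unit_obj
            _ Z.ident_closed[OF center_unit_obj]]
        by (intro conjI ballI) (simp_all add: tens_ident)
      have "mo (ru (fst y)) \<bullet> (f \<star> Ident C I) = f \<bullet> mo (ru (fst x))"
        if "x \<in> Obj (center C)" "y \<in> Obj (center C)" "f \<in> Hom (center C) x y" for x y f
        using ru_nat[OF center_arr[OF that]] by (auto dest!: arg_cong[of _ _ mo] simp: mo_sel)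
      then show "natural_iso (center C) (center C) (\<lambda>x. x \<odot>\<^bsub>center C\<^esub> ?U)
          (\<lambda>f. f \<star>\<^bsub>center C\<^esub> Ident (center C) ?U) (\<lambda>x. x) (\<lambda>f. f) (\<lambda>x. mo (ru (fst x)))"
        using ru unfolding natural_iso_def by simp
    qed
  qed (auto dest!: center_homD center_objD_pair(1) simp: tens_ident tens_comp tens_add_left tens_add_right tens_scale_left
      tens_scale_right assoc_natural pentagon)
qed

theorem center_braided: "braided_monoidal_category (center C)"
proof -
  interpret Z: monoidal_category "center C" by (rule center_monoidal)
  have ai: "assoc_inv (center C) x y z = assoc_inv C (fst x) (fst y) (fst z)"
    if "x \<in> Obj (center C)" "y \<in> Obj (center C)" "z \<in> Obj (center C)" for x y z
    using center_iso_inv[OF center_linear Z.tens_obj[OF Z.tens_obj[OF that(1,2)] that(3)]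
        Z.tens_obj[OF that(1) Z.tens_obj[OF that(2,3)]] Z.assoc_iso[OF that]]
    by (simp add: assoc_inv_def)
  show ?thesis
  proof
    fix x y assume [simp]: "x \<in> Obj (center C)" "y \<in> Obj (center C)"
    have "is_iso (center C) (x \<odot>\<^bsub>center C\<^esub> y) (y \<odot>\<^bsub>center C\<^esub> x) (mo (hbp x (fst y)))"
      using Z.tens_obj[of x y] Z.tens_obj[of y x] im_braid[of "fst x" "hbp x" "fst y" "hbp y"]
        hbD(2-4)[of "fst x" "hbp x" "fst y"]
      by (intro center_iso) (simp_all add: hbt_tens cong: im_cong)
    then show "is_iso (center C) (x \<odot>\<^bsub>center C\<^esub> y) (y \<odot>\<^bsub>center C\<^esub> x) (Braid (center C) x y)"
      by (simp add: hbt_def)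
  next
    fix x y x' y' f g
    assume xy: "x \<in> Obj (center C)" "y \<in> Obj (center C)" "x' \<in> Obj (center C)" "y' \<in> Obj (center C)"
      and f: "f \<in> Hom (center C) x x'" and g: "g \<in> Hom (center C) y y'"
    let ?f = "(fst x, f, fst x')" and ?g = "(fst y, g, fst y')"
    note [simp] = center_arr[OF xy(1,3) f] center_arr[OF xy(2,4) g]
      hbD(1-4)[OF center_objD(2)[OF xy(1)]] hbD(1-4)[OF center_objD(2)[OF xy(3)]]
    have i: "hbp x' (fst y) \<cdot> (?f \<lhd> fst y) = (fst y \<rhd> ?f) \<cdot> hbp x (fst y)"
      using f xy by (simp add: center_hom im_def)
    have n: "hbp x' (fst y') \<cdot> (fst x' \<rhd> ?g) = (?g \<lhd> fst x') \<cdot> hbp x' (fst y)"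
      using hbD(5)[OF center_objD(2)[OF xy(3)], of ?g] by simp
    have "hbp x' (fst y') \<cdot> (?f \<boxtimes> ?g) = (?g \<boxtimes> ?f) \<cdot> hbp x (fst y)"
      using xy by (simp add: tns_wh[of ?f ?g] tns_wh'[of ?g ?f] tl2[OF n] i)
    then show "Braid (center C) x' y' \<bullet>\<^bsub>center C\<^esub> (f \<star>\<^bsub>center C\<^esub> g)
        = (g \<star>\<^bsub>center C\<^esub> f) \<bullet>\<^bsub>center C\<^esub> Braid (center C) x y"
      by (auto dest!: arg_cong[of _ _ mo] simp: mo_sel hbt_def)
  next
    fix x y z assume xyz: "x \<in> Obj (center C)" "y \<in> Obj (center C)" "z \<in> Obj (center C)"
    show "Assoc (center C) y z x \<bullet>\<^bsub>center C\<^esub> Braid (center C) x (y \<odot>\<^bsub>center C\<^esub> z) \<bullet>\<^bsub>center C\<^esub> Assoc (center C) x y z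
      = (Ident (center C) y \<star>\<^bsub>center C\<^esub> Braid (center C) x z) \<bullet>\<^bsub>center C\<^esub> Assoc (center C) y x z
        \<bullet>\<^bsub>center C\<^esub> (Braid (center C) x y \<star>\<^bsub>center C\<^esub> Ident (center C) z)"
      using xyz center_obj[of x] by (simp add: half_braiding_def)
    note [simp] = hbD(1-4)[OF center_objD(2)[OF xyz(1)]] hbD(1-4)[OF center_objD(2)[OF xyz(2)]]
    have "iv (as (fst z) (fst x) (fst y)) \<cdot> thb (fst x) (hbp x) (fst y) (hbp y) (fst z) \<cdot> iv (as (fst x) (fst y) (fst z))
      = (hbp x (fst z) \<lhd> fst y) \<cdot> iv (as (fst x) (fst z) (fst y)) \<cdot> (fst x \<rhd> hbp y (fst z))"
      using xyz by (simp add: thb_def)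
    then show "assoc_inv (center C) z x y \<bullet>\<^bsub>center C\<^esub> Braid (center C) (x \<odot>\<^bsub>center C\<^esub> y) z \<bullet>\<^bsub>center C\<^esub> assoc_inv (center C) x y z
      = (Braid (center C) x z \<star>\<^bsub>center C\<^esub> Ident (center C) y) \<bullet>\<^bsub>center C\<^esub> assoc_inv (center C) x z y
        \<bullet>\<^bsub>center C\<^esub> (Ident (center C) x \<star>\<^bsub>center C\<^esub> Braid (center C) y z)"
      using xyz by (simp add: ai iv_as flip: hbt_tens)
       (auto dest!: arg_cong[of _ _ mo] simp: mo_sel hbt_def assoc_inv_def)
  qed
qed

end


section \<open>Families of morphisms that span the identity\<close>

context monoidal_category
begin

text \<open>Zero morphisms and sums of typed morphisms.\<close>

definition zr where "zr X Y = (X, ZeroM C X Y, Y)"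
definition pls where "pls f g = (dm f, AddM C (mo f) (mo g), cd f)"

lemma pls_ends [simp]: "dm (zr X Y) = X" "cd (zr X Y) = Y" "dm (pls f g) = dm f" "cd (pls f g) = cd f"
  by (simp_all add: zr_def pls_def)

lemma arr_zr [simp]: "\<lbrakk>X \<in> Obj C; Y \<in> Obj C\<rbrakk> \<Longrightarrow> arr (zr X Y)"
  by (simp add: zr_def arr_triple zero_in_hom)

lemma arr_pls [simp]: "\<lbrakk>arr f; arr g; dm f = dm g; cd f = cd g\<rbrakk> \<Longrightarrow> arr (pls f g)"
  using add_in_hom[of "dm f" "cd f" "mo f" "mo g"] arrD(3)[of f] arrD(3)[of g]
  by (simp add: pls_def arr_triple del: arrD(3))

lemma scl_zero: "arr f \<Longrightarrow> scl 0 f = zr (dm f) (cd f)"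
  by (simp add: scl_def zr_def scale_by_zero)

lemma cmp_zr [simp]:
  "\<lbrakk>arr f; Y = cd f; Z \<in> Obj C\<rbrakk> \<Longrightarrow> zr Y Z \<cdot> f = zr (dm f) Z"
  "\<lbrakk>arr f; Y = dm f; Z \<in> Obj C\<rbrakk> \<Longrightarrow> f \<cdot> zr Z Y = zr Z (cd f)"
  by (simp_all add: zr_def cmp_def comp_zero_left comp_zero_right)

lemma tns_zr [simp]:
  assumes "arr f" "X \<in> Obj C" "Y \<in> Obj C"
  shows "zr X Y \<boxtimes> f = zr (X \<odot> dm f) (Y \<odot> cd f)" "f \<boxtimes> zr X Y = zr (dm f \<odot> X) (cd f \<odot> Y)"
proof -
  have z: "zr X Y = scl 0 (zr X Y)" using assms scl_zero[of "zr X Y"] by simp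
  show "zr X Y \<boxtimes> f = zr (X \<odot> dm f) (Y \<odot> cd f)"
    using assms scl_zero[of "zr X Y \<boxtimes> f"] scl_tns(1)[of "zr X Y" f 0] z by simp
  show "f \<boxtimes> zr X Y = zr (dm f \<odot> X) (cd f \<odot> Y)"
    using assms scl_zero[of "f \<boxtimes> zr X Y"] scl_tns(2)[of f "zr X Y" 0] z by simp
qed

lemma wh_zr [simp]:
  "\<lbrakk>W \<in> Obj C; X \<in> Obj C; Y \<in> Obj C\<rbrakk> \<Longrightarrow> W \<rhd> zr X Y = zr (W \<odot> X) (W \<odot> Y)"
  "\<lbrakk>W \<in> Obj C; X \<in> Obj C; Y \<in> Obj C\<rbrakk> \<Longrightarrow> zr X Y \<lhd> W = zr (X \<odot> W) (Y \<odot> W)"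
  by (simp_all add: lw_def rw_def)

lemma scl_zr [simp]: "\<lbrakk>X \<in> Obj C; Y \<in> Obj C\<rbrakk> \<Longrightarrow> scl a (zr X Y) = zr X Y"
  using scl_scl[of "zr X Y" a 0] scl_zero[of "zr X Y"] by simp

lemma cmp_pls:
  "\<lbrakk>arr f; arr g; arr h; dm f = dm g; cd f = cd g; dm h = cd g\<rbrakk> \<Longrightarrow> h \<cdot> pls f g = pls (h \<cdot> f) (h \<cdot> g)"
  "\<lbrakk>arr f; arr g; arr h; dm f = dm g; cd f = cd g; cd h = dm g\<rbrakk> \<Longrightarrow> pls f g \<cdot> h = pls (f \<cdot> h) (g \<cdot> h)"
  using comp_add_right[of "dm f" "cd f" "cd h" "mo f" "mo g" "mo h"]
    comp_add_left[of "dm h" "cd h" "cd f" "mo h" "mo f" "mo g"]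
    arrD(3)[of f] arrD(3)[of g] arrD(3)[of h]
  by (simp_all add: pls_def cmp_def del: arrD(3))

lemma tns_pls:
  "\<lbrakk>arr f; arr g; arr h; dm f = dm g; cd f = cd g\<rbrakk> \<Longrightarrow> h \<boxtimes> pls f g = pls (h \<boxtimes> f) (h \<boxtimes> g)"
  "\<lbrakk>arr f; arr g; arr h; dm f = dm g; cd f = cd g\<rbrakk> \<Longrightarrow> pls f g \<boxtimes> h = pls (f \<boxtimes> h) (g \<boxtimes> h)"
  using tens_add_right[of "dm h" "cd h" "dm f" "cd f" "mo h" "mo f" "mo g"]
    tens_add_left[of "dm f" "cd f" "dm h" "cd h" "mo f" "mo g" "mo h"]
    arrD(3)[of f] arrD(3)[of g] arrD(3)[of h]
  by (simp_all add: pls_def tns_def del: arrD(3))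

text \<open>
  A set \<open>S\<close> of morphisms into \<open>X\<close> covers \<open>X\<close> if the identity of \<open>X\<close> is a finite sum of morphisms
  that factor through members of \<open>S\<close>; this is expressed by the induction principle for such sums.
  The tensor products of two covers cover the tensor product, and morphisms out of \<open>X\<close> are
  determined by their composites with a cover.
\<close>

definition covers where
  "covers X S \<longleftrightarrow> X \<in> Obj C \<and> (\<forall>s\<in>S. arr s \<and> cd s = X) \<and>
     (\<forall>P. P (zr X X) \<longrightarrow>
       (\<forall>f g. arr f \<and> dm f = X \<and> cd f = X \<and> arr g \<and> dm g = X \<and> cd g = X \<and> P f \<and> P g \<longrightarrow> P (pls f g)) \<longrightarrow>
       (\<forall>s\<in>S. \<forall>p. arr p \<and> dm p = X \<and> cd p = dm s \<longrightarrow> P (s \<cdot> p)) \<longrightarrow> P (idt X))"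

lemma covers_arr: "\<lbrakk>covers X S; s \<in> S\<rbrakk> \<Longrightarrow> arr s" "\<lbrakk>covers X S; s \<in> S\<rbrakk> \<Longrightarrow> cd s = X"
  "covers X S \<Longrightarrow> X \<in> Obj C"
  by (auto simp: covers_def)

lemma covers_induct [consumes 1, case_names zr pls cmp]:
  assumes "covers X S" "P (zr X X)"
    and "\<And>f g. \<lbrakk>arr f; dm f = X; cd f = X; arr g; dm g = X; cd g = X; P f; P g\<rbrakk> \<Longrightarrow> P (pls f g)"
    and "\<And>s p. \<lbrakk>s \<in> S; arr s; cd s = X; arr p; dm p = X; cd p = dm s\<rbrakk> \<Longrightarrow> P (s \<cdot> p)"
  shows "P (idt X)"
proof -
  have "P (zr X X) \<longrightarrow>
       (\<forall>f g. arr f \<and> dm f = X \<and> cd f = X \<and> arr g \<and> dm g = X \<and> cd g = X \<and> P f \<and> P g \<longrightarrow> P (pls f g)) \<longrightarrow>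
       (\<forall>s\<in>S. \<forall>p. arr p \<and> dm p = X \<and> cd p = dm s \<longrightarrow> P (s \<cdot> p)) \<longrightarrow> P (idt X)"
    using assms(1) unfolding covers_def by blast
  moreover have "\<forall>s\<in>S. arr s \<and> cd s = X" using assms(1) unfolding covers_def by blast
  ultimately show ?thesis using assms(2-4) by blast
qed

lemma coversI:
  assumes "X \<in> Obj C" "\<And>s. s \<in> S \<Longrightarrow> arr s \<and> cd s = X"
    and "\<And>P. \<lbrakk>P (zr X X);
        \<And>f g. \<lbrakk>arr f; dm f = X; cd f = X; arr g; dm g = X; cd g = X; P f; P g\<rbrakk> \<Longrightarrow> P (pls f g);
        \<And>s p. \<lbrakk>s \<in> S; arr p; dm p = X; cd p = dm s\<rbrakk> \<Longrightarrow> P (s \<cdot> p)\<rbrakk> \<Longrightarrow> P (idt X)"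
  shows "covers X S"
  unfolding covers_def
proof (intro conjI allI impI ballI)
  fix P
  assume "P (zr X X)"
    and "\<forall>f g. arr f \<and> dm f = X \<and> cd f = X \<and> arr g \<and> dm g = X \<and> cd g = X \<and> P f \<and> P g \<longrightarrow> P (pls f g)"
    and "\<forall>s\<in>S. \<forall>p. arr p \<and> dm p = X \<and> cd p = dm s \<longrightarrow> P (s \<cdot> p)"
  then show "P (idt X)" by (intro assms(3)[of P]) blast+
qed (use assms(1,2) in auto)

lemma covers_mono:
  assumes "covers X S" "S \<subseteq> T" "\<And>t. t \<in> T \<Longrightarrow> arr t \<and> cd t = X"
  shows "covers X T"
proof (rule coversI[OF covers_arr(3)[OF assms(1)] assms(3)])
  fix P
  assume z: "P (zr X X)"
    and a: "\<And>f g. \<lbrakk>arr f; dm f = X; cd f = X; arr g; dm g = X; cd g = X; P f; P g\<rbrakk> \<Longrightarrow> P (pls f g)"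
    and c: "\<And>s p. \<lbrakk>s \<in> T; arr p; dm p = X; cd p = dm s\<rbrakk> \<Longrightarrow> P (s \<cdot> p)"
  show "P (idt X)"
    by (rule covers_induct[OF assms(1), of P, OF z a]) (use c assms(2) in blast)+
qed

lemma covers_ext:
  assumes cov: "covers X S" and f: "arr f" "dm f = X" and g: "arr g" "dm g = X" and "cd f = cd g"
    and eq: "\<And>s. \<lbrakk>s \<in> S; arr s; cd s = X\<rbrakk> \<Longrightarrow> f \<cdot> s = g \<cdot> s"
  shows "f = g"
proof -
  have "f \<cdot> idt X = g \<cdot> idt X"
  proof (induction rule: covers_induct[OF cov, where P = "\<lambda>e. f \<cdot> e = g \<cdot> e"])
    case 1 then show ?case using assms(2-6) covers_arr(3)[OF cov] by simp
  next
    case (2 u v) then show ?case using f g by (simp add: cmp_pls)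
  next
    case (3 s p) then show ?case using f g eq[of s] by (simp flip: cmp_assoc)
  qed
  then show ?thesis using f g by simp
qed

lemma covers_tns:
  assumes S: "covers X S" and T: "covers Y T"
  shows "covers (X \<odot> Y) {s \<boxtimes> t |s t. s \<in> S \<and> t \<in> T}" (is "covers _ ?ST")
proof -
  note [simp] = covers_arr[OF S] covers_arr[OF T]
  have st: "arr s \<and> cd s = X \<odot> Y" if st: "s \<in> ?ST" for s
  proof -
    obtain a b where "s = a \<boxtimes> b" "a \<in> S" "b \<in> T" using st by blast
    then show ?thesis by simp
  qed
  show ?thesis
  proof (rule coversI[OF _ st])
    fix P
    assume z: "P (zr (X \<odot> Y) (X \<odot> Y))"
      and a: "\<And>f g. \<lbrakk>arr f; dm f = X \<odot> Y; cd f = X \<odot> Y; arr g; dm g = X \<odot> Y; cd g = X \<odot> Y; P f; P g\<rbrakk>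
        \<Longrightarrow> P (pls f g)"
      and "\<And>s p. \<lbrakk>s \<in> ?ST; arr p; dm p = X \<odot> Y; cd p = dm s\<rbrakk> \<Longrightarrow> P (s \<cdot> p)"
    then have c: "P ((s \<boxtimes> t) \<cdot> p)"
      if "s \<in> S" "t \<in> T" "arr p" "dm p = X \<odot> Y" "cd p = dm s \<odot> dm t" for s t p
      using that by (metis (mono_tags, lifting) mem_Collect_eq ends(5))
    show "P (idt (X \<odot> Y))"
  proof -
    have "P (idt X \<boxtimes> idt Y)"
    \<comment> \<open>The identity of \<open>X\<close> is decomposed first; inside each summand, that of \<open>Y\<close>.\<close>
    proof (induction rule: covers_induct[OF S, where P = "\<lambda>e. P (e \<boxtimes> idt Y)"])
      case 1 then show ?case using z by simp
    next
      case (2 f g) then show ?case using a[of "f \<boxtimes> idt Y" "g \<boxtimes> idt Y"] by (simp add: tns_pls)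
    next
      case (3 s p)
      have "P ((s \<boxtimes> idt Y) \<cdot> (p \<boxtimes> idt Y))"
      proof (induction rule: covers_induct[OF T, where P = "\<lambda>e. P ((s \<boxtimes> e) \<cdot> (p \<boxtimes> idt Y))"])
        case 1 then show ?case using 3 z by simp
      next
        case (2 f g) then show ?case
          using 3 a[of "(s \<boxtimes> f) \<cdot> (p \<boxtimes> idt Y)" "(s \<boxtimes> g) \<cdot> (p \<boxtimes> idt Y)"]
          by (simp add: tns_pls cmp_pls)
      next
        case (3 t q)
        have "(s \<boxtimes> t) \<cdot> (p \<boxtimes> q) = (s \<boxtimes> (t \<cdot> q)) \<cdot> (p \<boxtimes> idt Y)"
          using 3 \<open>s \<in> S\<close> \<open>arr p\<close> \<open>cd p = dm s\<close> by (simp add: tns_cmp)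
        moreover have "P ((s \<boxtimes> t) \<cdot> (p \<boxtimes> q))"
          using 3 \<open>s \<in> S\<close> \<open>arr p\<close> \<open>cd p = dm s\<close> \<open>dm p = X\<close> by (intro c) simp_all
        ultimately show ?case by simp
      qed
      then show ?case using 3 by (simp add: tns_cmp)
    qed
    then show ?thesis by simp
  qed
  qed (use covers_arr(3)[OF S] covers_arr(3)[OF T] in simp)
qed

end


section \<open>Gradings\<close>

context graded_monoidal_category
begin

text \<open>The morphisms into \<open>X\<close> from homogeneous objects.\<close>

definition homs where "homs X = {i. arr i \<and> cd i = X \<and> (\<exists>g. dm i \<in> D g)}"

declare homogeneousD [simp]

lemma hom_zero_degree:
  assumes "arr t" "dm t \<in> D g" "cd t \<in> D h" "g \<noteq> h"
  shows "t = zr (dm t) (cd t)"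
  using hom_distinct_degrees[OF assms(4,2,3)] arrD(3)[OF assms(1)]
  by (intro triple_eqI) (simp_all add: zr_def)

text \<open>
  The decomposition of an object into homogeneous components: inclusions \<open>i g\<close> and projections
  \<open>p g\<close> for the degrees \<open>g\<close> in a finite set \<open>S\<close>.
\<close>

definition graded_decomp where
  "graded_decomp X S i p \<longleftrightarrow> finite S \<and>
     (\<forall>g\<in>S. arr (i g) \<and> cd (i g) = X \<and> dm (i g) \<in> D g \<and> arr (p g) \<and> dm (p g) = X \<and> cd (p g) = dm (i g)) \<and>
     (\<forall>g\<in>S. \<forall>h\<in>S. p h \<cdot> i g = (if g = h then idt (dm (i g)) else zr (dm (i g)) (dm (i h)))) \<and>
     Ident C X = finsum (hom_group C X X) (\<lambda>g. mo (i g) \<bullet> mo (p g)) S"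

lemma graded_decompD:
  assumes "graded_decomp X S i p"
  shows "finite S" "g \<in> S \<Longrightarrow> arr (i g)" "g \<in> S \<Longrightarrow> cd (i g) = X" "g \<in> S \<Longrightarrow> dm (i g) \<in> D g"
    "g \<in> S \<Longrightarrow> arr (p g)" "g \<in> S \<Longrightarrow> dm (p g) = X" "g \<in> S \<Longrightarrow> cd (p g) = dm (i g)"
    "\<lbrakk>g \<in> S; h \<in> S\<rbrakk> \<Longrightarrow> p h \<cdot> i g = (if g = h then idt (dm (i g)) else zr (dm (i g)) (dm (i h)))"
    "Ident C X = finsum (hom_group C X X) (\<lambda>g. mo (i g) \<bullet> mo (p g)) S"
  using assms unfolding graded_decomp_def by blast+

lemma graded_decomp_exists:
  assumes X: "X \<in> Obj C" shows "\<exists>S i p. graded_decomp X S i p"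
proof -
  obtain S Xs i p where d: "finite S \<and>
         (\<forall>g\<in>S. Xs g \<in> D g \<and> i g \<in> Hom C (Xs g) X \<and> p g \<in> Hom C X (Xs g)) \<and>
         (\<forall>g\<in>S. \<forall>h\<in>S. p h \<bullet> i g = (if g = h then Ident C (Xs g) else ZeroM C (Xs g) (Xs h))) \<and>
         Ident C X = finsum (hom_group C X X) (\<lambda>g. i g \<bullet> p g) S"
    using decomposition[OF X] by (elim exE) (rule that)
  have "graded_decomp X S (\<lambda>g. (Xs g, i g, X)) (\<lambda>g. (X, p g, Xs g))"
    unfolding graded_decomp_def
    using d X by (auto simp: arr_triple idt_def zr_def cmp_def homogeneousD)
  then show ?thesis by blast
qed

lemma graded_decomp_covers:
  assumes X: "X \<in> Obj C" and d: "graded_decomp X S i p"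
  shows "covers X (i ` S)"
proof (rule coversI)
  interpret A: abelian_group "hom_group C X X" using hom_abelian X by blast
  have cG: "carrier (hom_group C X X) = Hom C X X" "add (hom_group C X X) = AddM C"
    "zero (hom_group C X X) = ZeroM C X X"
    by (simp_all add: hom_group_def)
  note [simp] = graded_decompD(2,3,5-7)[OF d]
  let ?F = "\<lambda>g. mo (i g) \<bullet> mo (p g)"
  have ipX: "?F g \<in> Hom C X X" if "g \<in> S" for g
    using arrD(3)[OF arr_cmp[of "p g" "i g"]] that by (simp add: mo_sel)
  fix P assume z: "P (zr X X)"
    and a: "\<And>f g. \<lbrakk>arr f; dm f = X; cd f = X; arr g; dm g = X; cd g = X; P f; P g\<rbrakk> \<Longrightarrow> P (pls f g)"
    and c: "\<And>s q. \<lbrakk>s \<in> i ` S; arr q; dm q = X; cd q = dm s\<rbrakk> \<Longrightarrow> P (s \<cdot> q)"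
  have "P (X, finsum (hom_group C X X) ?F T, X) \<and> finsum (hom_group C X X) ?F T \<in> Hom C X X"
    if "T \<subseteq> S" for T
    using finite_subset[OF that graded_decompD(1)[OF d]] that
  proof (induction T rule: finite_induct)
    case empty
    then show ?case using z X by (simp add: cG zr_def zero_in_hom)
  next
    case (insert g T)
    have 1: "finsum (hom_group C X X) ?F (insert g T) = AddM C (?F g) (finsum (hom_group C X X) ?F T)"
      using insert ipX by (subst A.finsum_insert) (auto simp: cG)
    have 2: "P (X, ?F g, X)"
      using c[of "i g" "p g"] insert by (simp add: cmp_def)
    show ?case
      unfolding 1 using a[of "(X, ?F g, X)" "(X, finsum (hom_group C X X) ?F T, X)"]
        2 insert ipX[of g] X add_in_hom by (auto simp: pls_def arr_triple)
  qed
  from this[OF subset_refl] show "P (idt X)" by (simp add: idt_def graded_decompD(9)[OF d])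
qed (use X graded_decompD[OF d] in auto)

lemma covers_homs: assumes "X \<in> Obj C" shows "covers X (homs X)"
proof -
  obtain S i p where d: "graded_decomp X S i p" using graded_decomp_exists[OF assms] by blast
  have "i ` S \<subseteq> homs X" unfolding homs_def using graded_decompD(2-4)[OF d] by blast
  then show ?thesis
    by (rule covers_mono[OF graded_decomp_covers[OF assms d]]) (simp add: homs_def)
qed

lemma homogeneous_ext2:
  assumes "X \<in> Obj C" "Y \<in> Obj C" "arr f" "dm f = X \<odot> Y" "arr f'" "dm f' = X \<odot> Y" "cd f = cd f'"
    and "\<And>i j g h. \<lbrakk>arr i; cd i = X; dm i \<in> D g; arr j; cd j = Y; dm j \<in> D h\<rbrakk>
      \<Longrightarrow> f \<cdot> (i \<boxtimes> j) = f' \<cdot> (i \<boxtimes> j)"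
  shows "f = f'"
proof (rule covers_ext[OF covers_tns[OF covers_homs[OF assms(1)] covers_homs[OF assms(2)]] assms(3-7)])
  fix s assume "s \<in> {i \<boxtimes> j |i j. i \<in> homs X \<and> j \<in> homs Y}"
  then obtain i j where "s = i \<boxtimes> j" "i \<in> homs X" "j \<in> homs Y" by blast
  then show "f \<cdot> s = f' \<cdot> s" using assms(8) unfolding homs_def by blast
qed

lemma homogeneous_ext3:
  assumes "X \<in> Obj C" "Y \<in> Obj C" "Z \<in> Obj C"
    "arr f" "dm f = (X \<odot> Y) \<odot> Z" "arr f'" "dm f' = (X \<odot> Y) \<odot> Z" "cd f = cd f'"
    and "\<And>i j k g h l. \<lbrakk>arr i; cd i = X; dm i \<in> D g; arr j; cd j = Y; dm j \<in> D h; arr k; cd k = Z; dm k \<in> D l\<rbrakk>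
      \<Longrightarrow> f \<cdot> ((i \<boxtimes> j) \<boxtimes> k) = f' \<cdot> ((i \<boxtimes> j) \<boxtimes> k)"
  shows "f = f'"
proof (rule covers_ext[OF covers_tns[OF covers_tns[OF covers_homs[OF assms(1)] covers_homs[OF assms(2)]]
      covers_homs[OF assms(3)]] assms(4-8)])
  fix s assume "s \<in> {u \<boxtimes> k |u k. u \<in> {i \<boxtimes> j |i j. i \<in> homs X \<and> j \<in> homs Y} \<and> k \<in> homs Z}"
  then obtain i j k where "s = (i \<boxtimes> j) \<boxtimes> k" "i \<in> homs X" "j \<in> homs Y" "k \<in> homs Z" by blast
  then show "f \<cdot> s = f' \<cdot> s" using assms(9) unfolding homs_def by blast
qed

lemma homogeneous_ext4:
  assumes "W \<in> Obj C" "X \<in> Obj C" "Y \<in> Obj C" "Z \<in> Obj C"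
    "arr f" "dm f = ((W \<odot> X) \<odot> Y) \<odot> Z" "arr f'" "dm f' = ((W \<odot> X) \<odot> Y) \<odot> Z" "cd f = cd f'"
    and "\<And>i j k m g h l n. \<lbrakk>arr i; cd i = W; dm i \<in> D g; arr j; cd j = X; dm j \<in> D h;
        arr k; cd k = Y; dm k \<in> D l; arr m; cd m = Z; dm m \<in> D n\<rbrakk>
      \<Longrightarrow> f \<cdot> (((i \<boxtimes> j) \<boxtimes> k) \<boxtimes> m) = f' \<cdot> (((i \<boxtimes> j) \<boxtimes> k) \<boxtimes> m)"
  shows "f = f'"
proof (rule covers_ext[OF covers_tns[OF covers_tns[OF covers_tns[OF covers_homs[OF assms(1)]
      covers_homs[OF assms(2)]] covers_homs[OF assms(3)]] covers_homs[OF assms(4)]] assms(5-9)])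
  fix s assume "s \<in> {v \<boxtimes> m |v m. v \<in> {u \<boxtimes> k |u k. u \<in> {i \<boxtimes> j |i j. i \<in> homs W \<and> j \<in> homs X}
    \<and> k \<in> homs Y} \<and> m \<in> homs Z}"
  then obtain i j k m where "s = ((i \<boxtimes> j) \<boxtimes> k) \<boxtimes> m" "i \<in> homs W" "j \<in> homs X" "k \<in> homs Y" "m \<in> homs Z"
    by blast
  then show "f \<cdot> s = f' \<cdot> s" using assms(10) unfolding homs_def by blast
qed

text \<open>
  The degree projections as typed morphisms. Since they are definite descriptions, and the twists
  sum over the degrees with nonzero projection, it has to be shown that the projections exist and
  that only finitely many of them are nonzero.
\<close>

definition dpr where "dpr g X = (X, degree_proj C D g X, X)"

lemma dpr_ends [simp]: "dm (dpr g X) = X" "cd (dpr g X) = X"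
  by (simp_all add: dpr_def)

lemma dpr_eqI:
  assumes X: "X \<in> Obj C" and e: "arr e" "dm e = X" "cd e = X"
    and ei: "\<And>i h. \<lbrakk>arr i; cd i = X; dm i \<in> D h\<rbrakk> \<Longrightarrow> e \<cdot> i = (if h = g then i else zr (dm i) X)"
  shows "dpr g X = e"
proof -
  have "degree_proj C D g X = mo e" unfolding degree_proj_def
  proof (rule the_equality, intro conjI allI ballI)
    show "mo e \<in> Hom C X X" using arrD(3)[OF e(1)] e by simp
  next
    fix h Y f assume "Y \<in> D h" "f \<in> Hom C Y X"
    then show "mo e \<bullet> f = (if h = g then f else ZeroM C Y X)"
      using ei[of "(Y, f, X)" h] X e by (auto simp: arr_triple cmp_def zr_def split: if_splits)
  next
    fix e' assume e': "e' \<in> Hom C X X \<and> (\<forall>h. \<forall>Y\<in>D h. \<forall>f\<in>Hom C Y X. e' \<bullet> f = (if h = g then f else ZeroM C Y X))"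
    have "(X, e', X) = e"
    proof (rule covers_ext[OF covers_homs[OF X]])
      fix s assume "s \<in> homs X"
      then obtain h where s: "arr s" "cd s = X" "dm s \<in> D h" by (auto simp: homs_def)
      have "e' \<bullet> mo s = (if h = g then mo s else ZeroM C (dm s) X)"
        using e' s arrD(3)[OF s(1)] by auto
      then show "(X, e', X) \<cdot> s = e \<cdot> s"
        using s ei[OF s] by (intro triple_eqI) (auto simp: mo_sel zr_def)
    qed (use X e e' in \<open>auto simp: arr_triple\<close>)
    then show "e' = mo e" by auto
  qed
  then show ?thesis using e by (auto simp: dpr_def intro: triple_eqI)
qed

lemma dpr_exists:
  assumes X: "X \<in> Obj C"
  shows "arr (dpr g X)"
    and "\<lbrakk>arr i; cd i = X; dm i \<in> D h\<rbrakk> \<Longrightarrow> dpr g X \<cdot> i = (if h = g then i else zr (dm i) X)"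
    and "finite (degrees C D X)"
proof -
  obtain S i p where d: "graded_decomp X S i p" using graded_decomp_exists[OF X] by blast
  note fin = graded_decompD(1)[OF d] and i = graded_decompD(2-4)[OF d] and p = graded_decompD(5-7)[OF d]
    and pi = graded_decompD(8)[OF d] and cov = graded_decomp_covers[OF X d]
  define e where "e g = (if g \<in> S then i g \<cdot> p g else zr X X)" for g
  have ar [simp]: "arr (e g)" "dm (e g) = X" "cd (e g) = X" for g
    using i p X by (auto simp: e_def)
  have ee: "e g \<cdot> i k = (if k = g then i k else zr (dm (i k)) X)" if "k \<in> S" for g k
    using that i[OF that] i[of g] p[of g] pi[OF that, of g] X by (auto simp: e_def)
  have char: "e g \<cdot> f = (if h = g then f else zr (dm f) X)" if f: "arr f" "cd f = X" "dm f \<in> D h" for g f h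
  proof -
    have "e g \<cdot> (idt X \<cdot> f) = (if h = g then idt X \<cdot> f else zr (dm f) X)"
    proof (induction rule: covers_induct[OF cov, where P = "\<lambda>u. e g \<cdot> (u \<cdot> f) = (if h = g then u \<cdot> f else zr (dm f) X)"])
      case 1 then show ?case using f X by simp
    next
      case (2 u v)
      have "pls (zr (dm f) X) (zr (dm f) X) = zr (dm f) X"
        using f X cmp_pls(2)[of "idt (dm f)" "idt (dm f)" "zr (dm f) X"] cmp_pls(1)[of "idt (dm f)" "idt (dm f)" "zr (dm f) X"]
          arr_pls[of "idt (dm f)" "idt (dm f)"] by simp
      then show ?case using 2 f X by (auto simp: cmp_pls)
    next
      case (3 s q)
      then obtain k where k: "k \<in> S" "s = i k" by auto
      have ik: "arr (i k)" "cd (i k) = X" "dm (i k) \<in> D k" using i[OF k(1)] by auto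
      show ?case
      proof (cases "k = h")
        case True
        then show ?thesis
          using 3 f X k ik ee[OF k(1), of g] tl2[OF ee[OF k(1), of g]] by (auto simp: homogeneousD)
      next
        case False
        have "q \<cdot> f = zr (dm f) (dm (i k))"
          using hom_zero_degree[of "q \<cdot> f" h k] False 3 f k ik by auto
        then show ?thesis using 3 f X k ik by simp
      qed
    qed
    then show ?thesis using f by simp
  qed
  have d: "dpr g X = e g" for g using dpr_eqI[OF X] char by simp
  show "arr (dpr g X)" by (simp add: d)
  show "\<lbrakk>arr i; cd i = X; dm i \<in> D h\<rbrakk> \<Longrightarrow> dpr g X \<cdot> i = (if h = g then i else zr (dm i) X)" for i
    unfolding d by (rule char)
  have "degrees C D X \<subseteq> S"
  proof
    fix g assume "g \<in> degrees C D X"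
    then have "e g \<noteq> zr X X" unfolding d[symmetric] by (auto simp: degrees_def dpr_def zr_def)
    then show "g \<in> S" by (auto simp: e_def split: if_splits)
  qed
  then show "finite (degrees C D X)" using fin by (rule finite_subset)
qed

declare dpr_exists(1) [simp]

lemma dpr_zero: "g \<notin> degrees C D X \<Longrightarrow> dpr g X = zr X X"
  by (simp add: degrees_def dpr_def zr_def)

text \<open>A finite sum of morphisms, composed with a \<open>t\<close> that kills all summands but the one at \<open>b\<close>.\<close>

lemma finsum_comp:
  assumes "finite A" "X \<in> Obj C" "Y \<in> Obj C" "\<And>a. F a \<in> Hom C X Y" and t: "arr t" "cd t = X"
    and z: "\<And>a. a \<noteq> b \<Longrightarrow> (X, F a, Y) \<cdot> t = zr (dm t) Y"
    and b: "b \<notin> A \<Longrightarrow> (X, F b, Y) \<cdot> t = zr (dm t) Y"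
  shows "arr (X, finsum (hom_group C X Y) F A, Y)"
    and "(X, finsum (hom_group C X Y) F A, Y) \<cdot> t = (X, F b, Y) \<cdot> t"
proof -
  interpret A: abelian_group "hom_group C X Y" using hom_abelian assms by blast
  have cG: "carrier (hom_group C X Y) = Hom C X Y" "add (hom_group C X Y) = AddM C"
    "zero (hom_group C X Y) = ZeroM C X Y"
    by (simp_all add: hom_group_def)
  have arF: "arr (X, F a, Y)" for a using assms by (simp add: arr_triple)
  have zz: "pls u (zr (dm t) Y) = u" "pls (zr (dm t) Y) u = u" if "arr u" "dm u = dm t" "cd u = Y" for u
  proof -
    interpret B: abelian_group "hom_group C (dm t) Y" using hom_abelian assms by simp
    have "mo u \<in> carrier (hom_group C (dm t) Y)"
      using arrD(3)[OF that(1)] that by (simp add: hom_group_def)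
    from B.r_zero[OF this] B.l_zero[OF this] show "pls u (zr (dm t) Y) = u" "pls (zr (dm t) Y) u = u"
      using that by (auto simp: pls_def zr_def hom_group_def intro: triple_eqI)
  qed
  have "arr (X, finsum (hom_group C X Y) F B, Y) \<and>
    (X, finsum (hom_group C X Y) F B, Y) \<cdot> t = (if b \<in> B then (X, F b, Y) \<cdot> t else zr (dm t) Y)" if "finite B" for B
    using that
  proof (induction B rule: finite_induct)
    case empty
    then show ?case using t assms(2,3) cmp_zr(1)[of t X Y] by (simp add: cG arr_triple zero_in_hom zr_def)
  next
    case (insert a B)
    let ?S = "(X, finsum (hom_group C X Y) F B, Y)"
    have p: "(X, finsum (hom_group C X Y) F (insert a B), Y) = pls (X, F a, Y) ?S"
      using insert assms(4) by (subst A.finsum_insert) (auto simp: cG pls_def)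
    have S: "arr ?S" using insert by simp
    have e: "pls (X, F a, Y) ?S \<cdot> t = pls ((X, F a, Y) \<cdot> t) (?S \<cdot> t)"
      using S arF[of a] t by (intro cmp_pls(2)) simp_all
    have u: "arr ((X, F c, Y) \<cdot> t)" "dm ((X, F c, Y) \<cdot> t) = dm t" "cd ((X, F c, Y) \<cdot> t) = Y" for c
      using t arF[of c] by simp_all
    have "pls ((X, F a, Y) \<cdot> t) (?S \<cdot> t) = (if b \<in> insert a B then (X, F b, Y) \<cdot> t else zr (dm t) Y)"
    proof (cases "a = b")
      case True
      then have "?S \<cdot> t = zr (dm t) Y" using insert by simp
      then show ?thesis using zz(1)[OF u] True by simp
    next
      case False
      have "arr (?S \<cdot> t)" "dm (?S \<cdot> t) = dm t" "cd (?S \<cdot> t) = Y" using t S by simp_all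
      from zz(2)[OF this] z[OF False] insert False show ?thesis by auto
    qed
    then show ?case
      unfolding p e using arr_pls[OF arF[of a] S] by simp
  qed
  from this[OF assms(1)] b show "arr (X, finsum (hom_group C X Y) F A, Y)"
    "(X, finsum (hom_group C X Y) F A, Y) \<cdot> t = (X, F b, Y) \<cdot> t" by auto
qed

text \<open>
  The twists of \<open>f : X \<otimes> Y \<rightarrow> Y \<otimes> X\<close> and of the associator, which on morphisms from homogeneous objects
  are multiplication by a scalar.
\<close>

definition tw2 where "tw2 c X Y f = (X \<odot> Y, twist2 C D c X Y (mo f), Y \<odot> X)"

lemma tw2_ends [simp]: "dm (tw2 c X Y f) = X \<odot> Y" "cd (tw2 c X Y f) = Y \<odot> X"
  by (simp_all add: tw2_def)

lemma tw2:
  assumes XY [simp]: "X \<in> Obj C" "Y \<in> Obj C" and f: "arr f" "dm f = X \<odot> Y" "cd f = Y \<odot> X"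
  shows "arr (tw2 c X Y f)"
    and "\<lbrakk>arr i; cd i = X; dm i \<in> D g; arr j; cd j = Y; dm j \<in> D h\<rbrakk>
      \<Longrightarrow> tw2 c X Y f \<cdot> (i \<boxtimes> j) = scl (c g h) (f \<cdot> (i \<boxtimes> j))"
proof -
  define F where "F = (\<lambda>(g, h). Scale C (c g h) (mo f \<bullet> (degree_proj C D g X \<star> degree_proj C D h Y)))"
  have F: "(X \<odot> Y, F (g, h), Y \<odot> X) = scl (c g h) (f \<cdot> (dpr g X \<boxtimes> dpr h Y))" for g h
    using f by (intro triple_eqI, simp_all add: F_def mo_sel, simp add: dpr_def)
  have FH: "F a \<in> Hom C (X \<odot> Y) (Y \<odot> X)" for a
  proof -
    obtain g h where a: "a = (g, h)" by (cases a)
    have "arr (scl (c g h) (f \<cdot> (dpr g X \<boxtimes> dpr h Y)))" using f by simp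
    then show ?thesis unfolding a F[symmetric] by (simp add: arr_triple)
  qed
  have fin: "finite (degrees C D X \<times> degrees C D Y)" using dpr_exists(3) XY by simp
  have t: "tw2 c X Y f = (X \<odot> Y, finsum (hom_group C (X \<odot> Y) (Y \<odot> X)) F (degrees C D X \<times> degrees C D Y), Y \<odot> X)"
    by (simp add: tw2_def twist2_def F_def)
  have Ft: "(X \<odot> Y, F (g', h'), Y \<odot> X) \<cdot> (i \<boxtimes> j)
      = (if g' = g \<and> h' = h then scl (c g h) (f \<cdot> (i \<boxtimes> j)) else zr (dm i \<odot> dm j) (Y \<odot> X))"
    if "arr i" "cd i = X" "dm i \<in> D g" "arr j" "cd j = Y" "dm j \<in> D h" for i j g h g' h'
    using that f by (auto simp: F tns_cmp dpr_exists(2))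
  have Ft0: "(X \<odot> Y, F (g, h), Y \<odot> X) \<cdot> (i \<boxtimes> j) = zr (dm i \<odot> dm j) (Y \<odot> X)"
    if "arr i" "cd i = X" "dm i \<in> D g" "arr j" "cd j = Y" "dm j \<in> D h"
      and "(g, h) \<notin> degrees C D X \<times> degrees C D Y" for i j g h
    using that f by (auto simp: F tns_cmp dpr_zero)
  show "\<lbrakk>arr i; cd i = X; dm i \<in> D g; arr j; cd j = Y; dm j \<in> D h\<rbrakk>
      \<Longrightarrow> tw2 c X Y f \<cdot> (i \<boxtimes> j) = scl (c g h) (f \<cdot> (i \<boxtimes> j))" for i j
    unfolding t using Ft[of i g j h g h] Ft0[of i g j h] Ft[of i g j h]
    by (subst finsum_comp(2)[OF fin _ _ FH, of _ "(g, h)"]) (auto split: if_splits)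
  show "arr (tw2 c X Y f)"
    unfolding t using finsum_comp(1)[OF fin _ _ FH, of "zr (X \<odot> Y) (X \<odot> Y)"] by (simp add: arr_triple FH)
qed

definition tw3 where "tw3 c X Y Z = ((X \<odot> Y) \<odot> Z, Assoc (assoc_twist C D c) X Y Z, X \<odot> (Y \<odot> Z))"

lemma tw3_ends [simp]: "dm (tw3 c X Y Z) = (X \<odot> Y) \<odot> Z" "cd (tw3 c X Y Z) = X \<odot> (Y \<odot> Z)"
  by (simp_all add: tw3_def)

lemma tw3:
  assumes XYZ [simp]: "X \<in> Obj C" "Y \<in> Obj C" "Z \<in> Obj C"
  shows "arr (tw3 c X Y Z)"
    and "\<lbrakk>arr i; cd i = X; dm i \<in> D g; arr j; cd j = Y; dm j \<in> D h; arr k; cd k = Z; dm k \<in> D l\<rbrakk>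
      \<Longrightarrow> tw3 c X Y Z \<cdot> ((i \<boxtimes> j) \<boxtimes> k) = scl (c g h l) (as X Y Z \<cdot> ((i \<boxtimes> j) \<boxtimes> k))"
proof -
  let ?d = "degrees C D X \<times> degrees C D Y \<times> degrees C D Z"
  let ?P = "(X \<odot> Y) \<odot> Z" and ?Q = "X \<odot> (Y \<odot> Z)"
  define F where "F = (\<lambda>(g, h, k). Scale C (c g h k) (Assoc C X Y Z \<bullet>
    ((degree_proj C D g X \<star> degree_proj C D h Y) \<star> degree_proj C D k Z)))"
  have F: "(?P, F (g, h, l), ?Q) = scl (c g h l) (as X Y Z \<cdot> ((dpr g X \<boxtimes> dpr h Y) \<boxtimes> dpr l Z))" for g h l
    by (intro triple_eqI, simp_all add: F_def mo_sel, simp add: dpr_def)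
  have FH: "F a \<in> Hom C ?P ?Q" for a
  proof -
    obtain g h l where a: "a = (g, h, l)" by (cases a)
    have "arr (scl (c g h l) (as X Y Z \<cdot> ((dpr g X \<boxtimes> dpr h Y) \<boxtimes> dpr l Z)))" by simp
    then show ?thesis unfolding a F[symmetric] by (simp add: arr_triple)
  qed
  have fin: "finite ?d" using dpr_exists(3) XYZ by simp
  have t: "tw3 c X Y Z = (?P, finsum (hom_group C ?P ?Q) F ?d, ?Q)"
    by (simp add: tw3_def assoc_twist_def F_def)
  have Ft: "(?P, F (g', h', l'), ?Q) \<cdot> ((i \<boxtimes> j) \<boxtimes> k)
      = (if g' = g \<and> h' = h \<and> l' = l then scl (c g h l) (as X Y Z \<cdot> ((i \<boxtimes> j) \<boxtimes> k))
         else zr ((dm i \<odot> dm j) \<odot> dm k) ?Q)"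
    if "arr i" "cd i = X" "dm i \<in> D g" "arr j" "cd j = Y" "dm j \<in> D h" "arr k" "cd k = Z" "dm k \<in> D l"
    for i j k g h l g' h' l'
    using that by (auto simp: F tns_cmp dpr_exists(2))
  have Ft0: "(?P, F (g, h, l), ?Q) \<cdot> ((i \<boxtimes> j) \<boxtimes> k) = zr ((dm i \<odot> dm j) \<odot> dm k) ?Q"
    if "arr i" "cd i = X" "dm i \<in> D g" "arr j" "cd j = Y" "dm j \<in> D h" "arr k" "cd k = Z" "dm k \<in> D l"
      and "(g, h, l) \<notin> ?d" for i j k g h l
    using that by (auto simp: F tns_cmp dpr_zero)
  show "\<lbrakk>arr i; cd i = X; dm i \<in> D g; arr j; cd j = Y; dm j \<in> D h; arr k; cd k = Z; dm k \<in> D l\<rbrakk>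
      \<Longrightarrow> tw3 c X Y Z \<cdot> ((i \<boxtimes> j) \<boxtimes> k) = scl (c g h l) (as X Y Z \<cdot> ((i \<boxtimes> j) \<boxtimes> k))" for i j k
    unfolding t using Ft[of i g j h k l g h l] Ft0[of i g j h k l] Ft[of i g j h k l]
    by (subst finsum_comp(2)[OF fin _ _ FH, of _ "(g, h, l)"]) (auto split: if_splits)
  show "arr (tw3 c X Y Z)"
    unfolding t using finsum_comp(1)[OF fin _ _ FH, of "zr ?P ?P"] by (simp add: arr_triple FH)
qed

end


section \<open>Changing the associator\<close>

context monoidal_category
begin

lemma as_natE:
  "\<lbrakk>arr f; arr g; arr h; X = cd f; Y = cd g; Z = cd h\<rbrakk>
    \<Longrightarrow> as X Y Z \<cdot> ((f \<boxtimes> g) \<boxtimes> h) = (f \<boxtimes> (g \<boxtimes> h)) \<cdot> as (dm f) (dm g) (dm h)"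
  using as_nat by simp

text \<open>The axioms that involve the associator are checked on typed morphisms of \<open>C\<close>.\<close>

lemma monoidal_assoc_update:
  fixes A
  defines "aw \<equiv> (\<lambda>X Y Z. ((X \<odot> Y) \<odot> Z, A X Y Z, X \<odot> (Y \<odot> Z)))"
  assumes iso: "\<And>X Y Z. \<lbrakk>X \<in> Obj C; Y \<in> Obj C; Z \<in> Obj C\<rbrakk> \<Longrightarrow> isoarr (aw X Y Z)"
    and nat: "\<And>f g h. \<lbrakk>arr f; arr g; arr h\<rbrakk>
      \<Longrightarrow> aw (cd f) (cd g) (cd h) \<cdot> ((f \<boxtimes> g) \<boxtimes> h) = (f \<boxtimes> (g \<boxtimes> h)) \<cdot> aw (dm f) (dm g) (dm h)"
    and pent: "\<And>W X Y Z. \<lbrakk>W \<in> Obj C; X \<in> Obj C; Y \<in> Obj C; Z \<in> Obj C\<rbrakk>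
      \<Longrightarrow> (W \<rhd> aw X Y Z) \<cdot> aw W (X \<odot> Y) Z \<cdot> (aw W X Y \<lhd> Z) = aw W X (Y \<odot> Z) \<cdot> aw (W \<odot> X) Y Z"
  shows "monoidal_category (C\<lparr>Assoc := A\<rparr>)"
proof (rule monoidal_category.intro)
  show "linear_category (C\<lparr>Assoc := A\<rparr>)"
    using linear_category_axioms by (simp add: linear_category_def hom_group_def)
  have i: "is_iso (C\<lparr>Assoc := A\<rparr>) = is_iso C"
    by (intro ext) (simp add: is_iso_def inverse_pair_def)
  have e: "is_equivalence (C\<lparr>Assoc := A\<rparr>) (C\<lparr>Assoc := A\<rparr>) = is_equivalence C C"
    by (intro ext) (simp add: is_equivalence_def is_functor_def natural_iso_def i)
  show "monoidal_category_axioms (C\<lparr>Assoc := A\<rparr>)"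
  proof (rule monoidal_category_axioms.intro; (unfold i e)?; simp?)
    fix X Y Z assume "X \<in> Obj C" "Y \<in> Obj C" "Z \<in> Obj C"
    then show "is_iso C ((X \<odot> Y) \<odot> Z) (X \<odot> (Y \<odot> Z)) (A X Y Z)"
      using iso[of X Y Z] by (simp add: isoarr_def aw_def)
  next
    fix X Y Z X' Y' Z' f g h
    assume "X \<in> Obj C" "Y \<in> Obj C" "Z \<in> Obj C" "X' \<in> Obj C" "Y' \<in> Obj C" "Z' \<in> Obj C"
      "f \<in> Hom C X X'" "g \<in> Hom C Y Y'" "h \<in> Hom C Z Z'"
    then show "A X' Y' Z' \<bullet> ((f \<star> g) \<star> h) = (f \<star> (g \<star> h)) \<bullet> A X Y Z"
      using nat[of "(X, f, X')" "(Y, g, Y')" "(Z, h, Z')"] by (simp add: arr_triple aw_def cmp_def tns_def)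
  next
    fix W X Y Z assume "W \<in> Obj C" "X \<in> Obj C" "Y \<in> Obj C" "Z \<in> Obj C"
    then show "(Ident C W \<star> A X Y Z) \<bullet> A W (X \<odot> Y) Z \<bullet> (A W X Y \<star> Ident C Z)
        = A W X (Y \<odot> Z) \<bullet> A (W \<odot> X) Y Z"
      using pent[of W X Y Z] by (simp add: aw_def cmp_def tns_def lw_def rw_def idt_def)
  qed (use tens_closed tens_ident tens_comp tens_add_left tens_add_right tens_scale_left tens_scale_right
      iota_iso unit_tens_equivalence tens_unit_equivalence in auto)
qed

end

context graded_monoidal_category
begin

lemma tw3_homogeneous:
  "\<lbrakk>X \<in> D g; Y \<in> D h; Z \<in> D k\<rbrakk> \<Longrightarrow> tw3 c X Y Z = scl (c g h k) (as X Y Z)"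
  by (simp add: tw3_def assoc_twist_homogeneous scl_def as_def)

declare tw3(1) [simp]

lemma tw3_nat:
  assumes "arr f" "arr g" "arr h" "X = cd f" "Y = cd g" "Z = cd h"
  shows "tw3 c X Y Z \<cdot> ((f \<boxtimes> g) \<boxtimes> h) = (f \<boxtimes> (g \<boxtimes> h)) \<cdot> tw3 c (dm f) (dm g) (dm h)"
proof (rule homogeneous_ext3[of "dm f" "dm g" "dm h"])
  fix i j k a b d
  assume ijk: "arr i" "cd i = dm f" "dm i \<in> D a" "arr j" "cd j = dm g" "dm j \<in> D b"
    "arr k" "cd k = dm h" "dm k \<in> D d"
  note [simp] = assms ijk
  have "tw3 c X Y Z \<cdot> (((f \<cdot> i) \<boxtimes> (g \<cdot> j)) \<boxtimes> (h \<cdot> k))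
      = scl (c a b d) (as X Y Z \<cdot> (((f \<cdot> i) \<boxtimes> (g \<cdot> j)) \<boxtimes> (h \<cdot> k)))"
    by (rule tw3(2)) simp_all
  moreover have "tw3 c (dm f) (dm g) (dm h) \<cdot> ((i \<boxtimes> j) \<boxtimes> k)
      = scl (c a b d) (as (dm f) (dm g) (dm h) \<cdot> ((i \<boxtimes> j) \<boxtimes> k))"
    by (rule tw3(2)) simp_all
  ultimately show "(tw3 c X Y Z \<cdot> ((f \<boxtimes> g) \<boxtimes> h)) \<cdot> ((i \<boxtimes> j) \<boxtimes> k)
      = ((f \<boxtimes> (g \<boxtimes> h)) \<cdot> tw3 c (dm f) (dm g) (dm h)) \<cdot> ((i \<boxtimes> j) \<boxtimes> k)"
    by (simp add: tns_cmp as_natE tns_cmp_tl)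
qed (use assms in simp_all)

lemma tw3_iso:
  assumes nz: "\<And>g h k. c g h k \<noteq> 0" and [simp]: "X \<in> Obj C" "Y \<in> Obj C" "Z \<in> Obj C"
  shows "isoarr (tw3 c X Y Z)"
proof -
  \<comment> \<open>The twist is the associator composed with an automorphism of the source.\<close>
  define s where "s c = iv (as X Y Z) \<cdot> tw3 c X Y Z" for c
  have s [simp]: "arr (s c)" "dm (s c) = (X \<odot> Y) \<odot> Z" "cd (s c) = (X \<odot> Y) \<odot> Z" for c
    by (simp_all add: s_def)
  have st: "s c \<cdot> ((i \<boxtimes> j) \<boxtimes> k) = scl (c g h l) ((i \<boxtimes> j) \<boxtimes> k)"
    if "arr i" "cd i = X" "dm i \<in> D g" "arr j" "cd j = Y" "dm j \<in> D h" "arr k" "cd k = Z" "dm k \<in> D l"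
    for i j k g h l c
    using that tw3(2)[OF assms(2-4) that] by (simp add: s_def)
  have ss: "s c \<cdot> s c' = idt ((X \<odot> Y) \<odot> Z)" if cc: "\<And>g h k. c' g h k * c g h k = 1" for c c'
    by (rule homogeneous_ext3[OF assms(2-4)]) (simp_all add: st cc homogeneousD)
  let ?c = "\<lambda>g h k. inverse (c g h k)"
  have "isoarr (s c)"
    using ss[of c ?c] ss[of ?c c] nz by (intro isoarrI(1)[of "s c" "s ?c"]) simp_all
  moreover have "tw3 c X Y Z = as X Y Z \<cdot> s c" by (simp add: s_def)
  ultimately show ?thesis by simp
qed

lemma tw3_pentagon:
  assumes coc: "\<And>g1 g2 g3 g4. c g1 g2 g3 * c g1 (g2 + g3) g4 * c g2 g3 g4
        = c (g1 + g2) g3 g4 * c g1 g2 (g3 + g4)"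
    and [simp]: "W \<in> Obj C" "X \<in> Obj C" "Y \<in> Obj C" "Z \<in> Obj C"
  shows "(W \<rhd> tw3 c X Y Z) \<cdot> tw3 c W (X \<odot> Y) Z \<cdot> (tw3 c W X Y \<lhd> Z)
    = tw3 c W X (Y \<odot> Z) \<cdot> tw3 c (W \<odot> X) Y Z"
proof (rule homogeneous_ext4[OF assms(2-5)])
  fix i j k m g h l n
  assume ijk [simp]: "arr i" "cd i = W" "arr j" "cd j = X" "arr k" "cd k = Y" "arr m" "cd m = Z"
    and deg: "dm i \<in> D g" "dm j \<in> D h" "dm k \<in> D l" "dm m \<in> D n"
  let ?t = "((i \<boxtimes> j) \<boxtimes> k) \<boxtimes> m" and ?W = "dm i" and ?X = "dm j" and ?Y = "dm k" and ?Z = "dm m"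
  have e: "(tw3 c W X Y \<lhd> Z) \<cdot> ?t = ((i \<boxtimes> (j \<boxtimes> k)) \<boxtimes> m) \<cdot> (tw3 c ?W ?X ?Y \<lhd> ?Z)"
    "tw3 c W (X \<odot> Y) Z \<cdot> ((i \<boxtimes> (j \<boxtimes> k)) \<boxtimes> m) = (i \<boxtimes> ((j \<boxtimes> k) \<boxtimes> m)) \<cdot> tw3 c ?W (?X \<odot> ?Y) ?Z"
    "(W \<rhd> tw3 c X Y Z) \<cdot> (i \<boxtimes> ((j \<boxtimes> k) \<boxtimes> m)) = (i \<boxtimes> (j \<boxtimes> (k \<boxtimes> m))) \<cdot> (?W \<rhd> tw3 c ?X ?Y ?Z)"
    "tw3 c (W \<odot> X) Y Z \<cdot> ?t = ((i \<boxtimes> j) \<boxtimes> (k \<boxtimes> m)) \<cdot> tw3 c (?W \<odot> ?X) ?Y ?Z"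
    "tw3 c W X (Y \<odot> Z) \<cdot> ((i \<boxtimes> j) \<boxtimes> (k \<boxtimes> m)) = (i \<boxtimes> (j \<boxtimes> (k \<boxtimes> m))) \<cdot> tw3 c ?W ?X (?Y \<odot> ?Z)"
    by (simp_all add: lw_def rw_def tns_cmp tw3_nat)
  note d = tens_degree
  have p: "(?W \<rhd> tw3 c ?X ?Y ?Z) \<cdot> tw3 c ?W (?X \<odot> ?Y) ?Z \<cdot> (tw3 c ?W ?X ?Y \<lhd> ?Z)
      = tw3 c ?W ?X (?Y \<odot> ?Z) \<cdot> tw3 c (?W \<odot> ?X) ?Y ?Z"
    using coc[of g h l n]
    by (simp add: tw3_homogeneous[OF deg(2,3,4)] tw3_homogeneous[OF deg(1) tens_degree[OF deg(2,3)] deg(4)]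
        tw3_homogeneous[OF deg(1-3)] tw3_homogeneous[OF deg(1,2) tens_degree[OF deg(3,4)]]
        tw3_homogeneous[OF tens_degree[OF deg(1,2)] deg(3,4)] as_pentagon ac_simps)
  show "((W \<rhd> tw3 c X Y Z) \<cdot> tw3 c W (X \<odot> Y) Z \<cdot> (tw3 c W X Y \<lhd> Z)) \<cdot> ?t
    = (tw3 c W X (Y \<odot> Z) \<cdot> tw3 c (W \<odot> X) Y Z) \<cdot> ?t"
    by (simp add: e tl2[OF e(2)] tl2[OF e(3)] tl2[OF e(5)] p)
qed simp_all

theorem assoc_twist_graded_monoidal:
  assumes nz: "\<And>g h k. c g h k \<noteq> 0"
    and coc: "\<And>g1 g2 g3 g4. c g1 g2 g3 * c g1 (g2 + g3) g4 * c g2 g3 g4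
        = c (g1 + g2) g3 g4 * c g1 g2 (g3 + g4)"
  shows "graded_monoidal_category (assoc_twist C D c) D"
proof -
  let ?A = "Assoc (assoc_twist C D c)"
  have eq: "assoc_twist C D c = C\<lparr>Assoc := ?A\<rparr>" by (simp add: assoc_twist_def)
  have "monoidal_category (C\<lparr>Assoc := ?A\<rparr>)"
    using tw3_iso[of c, OF nz] tw3_nat[of _ _ _ _ _ _ c] tw3_pentagon[of c, OF coc]
    by (intro monoidal_assoc_update) (simp_all flip: tw3_def)
  moreover have "graded_category_axioms (C\<lparr>Assoc := ?A\<rparr>) D"
  proof -
    have "graded_category_axioms (C\<lparr>Assoc := ?A\<rparr>) D = graded_category_axioms C D"
      by (simp add: graded_category_axioms_def hom_group_def)
    then show ?thesis using graded_category.axioms(2)[OF graded_category_axioms] by simp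
  qed
  moreover have "graded_monoidal_category_axioms (C\<lparr>Assoc := ?A\<rparr>) D"
    using unit_degree tens_degree by (simp add: graded_monoidal_category_axioms_def)
  ultimately show ?thesis
    unfolding graded_monoidal_category_def graded_category_def using eq
    by (metis monoidal_category.axioms(1))
qed

end


section \<open>Homogeneous components of half-braidings\<close>

context monoidal_category
begin

text \<open>
  A half-braiding on \<open>X\<close> restricts to a retract \<open>X'\<close> of \<open>X\<close> whose idempotent commutes with it.
\<close>

lemma hb_retract:
  assumes P: "hb X P" and ip: "arr i" "dm i = X'" "cd i = X" "arr p" "dm p = X" "cd p = X'"
    and pi: "p \<cdot> i = idt X'"
    and comm: "\<And>Y. Y \<in> Obj C \<Longrightarrow> (Y \<rhd> i) \<cdot> (Y \<rhd> p) \<cdot> P Y = P Y \<cdot> (i \<lhd> Y) \<cdot> (p \<lhd> Y)"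
  defines "R \<equiv> (\<lambda>Y. (Y \<rhd> p) \<cdot> P Y \<cdot> (i \<lhd> Y))"
  shows "hb X' R" "im R P i" "im P R p"
proof -
  note [simp] = ip hbD(1-4)[OF P]
  have X' [simp]: "X' \<in> Obj C" using arrD(1)[OF ip(1)] by simp
  have w: "(Y \<rhd> p) \<cdot> (Y \<rhd> i) = idt (Y \<odot> X')" "(p \<lhd> Y) \<cdot> (i \<lhd> Y) = idt (X' \<odot> Y)"
    if "Y \<in> Obj C" for Y
    using that pi by (simp_all flip: wh_cmp)
  have ci: "(Y \<rhd> i) \<cdot> (Y \<rhd> p) \<cdot> P Y \<cdot> (i \<lhd> Y) = P Y \<cdot> (i \<lhd> Y)" if "Y \<in> Obj C" for Y
    using that by (simp add: tl3[OF comm] w)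
  have cp: "(Y \<rhd> p) \<cdot> P Y \<cdot> (i \<lhd> Y) \<cdot> (p \<lhd> Y) = (Y \<rhd> p) \<cdot> P Y" if "Y \<in> Obj C" for Y
    using that by (simp add: comm[symmetric] tl2[OF w(1)])
  have ends: "dm (R Y) = X' \<odot> Y" "cd (R Y) = Y \<odot> X'" "arr (R Y)" if "Y \<in> Obj C" for Y
    using that by (simp_all add: R_def)
  have iso: "isoarr (R Y)" if [simp]: "Y \<in> Obj C" for Y
  proof (rule isoarrI(1)[of _ "(p \<lhd> Y) \<cdot> iv (P Y) \<cdot> (Y \<rhd> i)"])
    have c: "iv (P Y) \<cdot> (Y \<rhd> i) \<cdot> (Y \<rhd> p) = (i \<lhd> Y) \<cdot> (p \<lhd> Y) \<cdot> iv (P Y)"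
    proof (rule iso_cancel_right[of "P Y"])
      show "(iv (P Y) \<cdot> (Y \<rhd> i) \<cdot> (Y \<rhd> p)) \<cdot> P Y = ((i \<lhd> Y) \<cdot> (p \<lhd> Y) \<cdot> iv (P Y)) \<cdot> P Y"
        by (simp add: comm)
    qed simp_all
    show "((p \<lhd> Y) \<cdot> iv (P Y) \<cdot> (Y \<rhd> i)) \<cdot> R Y = idt (dm (R Y))"
      by (simp add: R_def ci w)
    have "P Y \<cdot> (i \<lhd> Y) \<cdot> (p \<lhd> Y) \<cdot> iv (P Y) \<cdot> (Y \<rhd> i) = (Y \<rhd> i) \<cdot> (Y \<rhd> p) \<cdot> (Y \<rhd> i)"
      using c[symmetric] tl3[OF c[symmetric], of "Y \<rhd> i"] by simp
    then show "R Y \<cdot> (p \<lhd> Y) \<cdot> iv (P Y) \<cdot> (Y \<rhd> i) = idt (cd (R Y))"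
      by (simp add: R_def w tl2[OF w(1)])
  qed (simp_all add: R_def)
  have nat: "R (cd f) \<cdot> (X' \<rhd> f) = (f \<lhd> X') \<cdot> R (dm f)" if f: "arr f" for f
  proof -
    have n: "P (cd f) \<cdot> (X \<rhd> f) = (f \<lhd> X) \<cdot> P (dm f)" using hbD(5)[OF P f] by simp
    show ?thesis
      using f by (simp add: R_def wh_swap[of i f] tl2[OF n] tl2[OF wh_swap'[of f p]])
  qed
  have hex: "as Y Z X' \<cdot> R (Y \<odot> Z) \<cdot> as X' Y Z = (Y \<rhd> R Z) \<cdot> as Y X' Z \<cdot> (R Y \<lhd> Z)"
    if [simp]: "Y \<in> Obj C" "Z \<in> Obj C" for Y Z
  proof -
    have n: "(i \<lhd> (Y \<odot> Z)) \<cdot> as X' Y Z = as X Y Z \<cdot> ((i \<lhd> Y) \<lhd> Z)"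
      "(Y \<rhd> (i \<lhd> Z)) \<cdot> as Y X' Z = as Y X Z \<cdot> ((Y \<rhd> i) \<lhd> Z)"
      by (simp_all add: as_wh)
    have cZ: "((Y \<rhd> i) \<lhd> Z) \<cdot> ((Y \<rhd> p) \<lhd> Z) \<cdot> (P Y \<lhd> Z) \<cdot> ((i \<lhd> Y) \<lhd> Z) = (P Y \<lhd> Z) \<cdot> ((i \<lhd> Y) \<lhd> Z)"
      using arg_cong[OF ci[of Y], of "\<lambda>t. t \<lhd> Z"] by simp
    have "as Y Z X' \<cdot> R (Y \<odot> Z) \<cdot> as X' Y Z
      = (Y \<rhd> (Z \<rhd> p)) \<cdot> (as Y Z X \<cdot> P (Y \<odot> Z) \<cdot> as X Y Z) \<cdot> ((i \<lhd> Y) \<lhd> Z)"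
      by (simp add: R_def n as_wh_tl)
    also have "\<dots> = (Y \<rhd> (Z \<rhd> p)) \<cdot> (Y \<rhd> P Z) \<cdot> as Y X Z \<cdot> (P Y \<lhd> Z) \<cdot> ((i \<lhd> Y) \<lhd> Z)"
      by (simp add: hbD(6)[OF P])
    also have "\<dots> = (Y \<rhd> R Z) \<cdot> as Y X' Z \<cdot> (R Y \<lhd> Z)"
      by (simp add: R_def tl2[OF n(2)] cZ)
    finally show ?thesis .
  qed
  show "hb X' R" unfolding hb_def using X' iso ends nat hex by blast
  show "im R P i" by (simp add: im_def R_def ci)
  show "im P R p" by (simp add: im_def R_def cp)
qed

end

context graded_monoidal_category
begin

text \<open>
  The projection onto a homogeneous component commutes with a half-braiding. This is where the
  group is required to be abelian: a morphism \<open>X\<^sub>g \<otimes> Y\<^sub>h \<rightarrow> Y\<^sub>h \<otimes> X\<^sub>k\<close> vanishes unless \<open>g + h = h + k\<close>.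
\<close>

lemma hb_component_commutes:
  assumes P: "hb X P" and d: "graded_decomp X S i p" and k: "k \<in> S" and Y: "Y \<in> Obj C"
  shows "(Y \<rhd> i k) \<cdot> (Y \<rhd> p k) \<cdot> P Y = P Y \<cdot> (i k \<lhd> Y) \<cdot> (p k \<lhd> Y)"
proof (rule covers_ext[OF covers_tns[OF graded_decomp_covers[OF hbD(1)[OF P] d] covers_homs[OF Y]]])
  note [simp] = hbD(1-4)[OF P] graded_decompD(2,3,5-7)[OF d] k Y
  fix s assume "s \<in> {s \<boxtimes> t |s t. s \<in> i ` S \<and> t \<in> homs Y}"
  then obtain m j where s: "s = i m \<boxtimes> j" and m [simp]: "m \<in> S" and j: "j \<in> homs Y" by blast
  from j obtain h where j [simp]: "arr j" "cd j = Y" and h: "dm j \<in> D h" unfolding homs_def by blast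
  let ?Y = "dm j"
  define q where "q = P ?Y \<cdot> (i m \<lhd> ?Y)"
  have q [simp]: "arr q" "dm q = dm (i m) \<odot> ?Y" "cd q = ?Y \<odot> X" by (simp_all add: q_def)
  \<comment> \<open>By degree reasons \<open>q\<close> has no component in \<open>dm j \<otimes> X\<^sub>n\<close> for \<open>n \<noteq> m\<close>.\<close>
  have z: "(?Y \<rhd> r) \<cdot> q = zr (dm (i m) \<odot> ?Y) (?Y \<odot> cd r)"
    if "arr r" "dm r = X" "cd r \<in> D n" "n \<noteq> m" for r n
    using hom_zero_degree[of "(?Y \<rhd> r) \<cdot> q" "m + h" "h + n"] that h
      tens_degree[OF graded_decompD(4)[OF d m] h] tens_degree[OF h, of "cd r" n]
    by (simp add: add.commute)
  have e: "(?Y \<rhd> i k) \<cdot> (?Y \<rhd> p k) \<cdot> q = (if k = m then q else zr (dm q) (cd q))"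
  proof (cases "k = m")
    case False
    then show ?thesis using z[of "p k" k] graded_decompD(4)[OF d k] by simp
  next
    case True
    have "(?Y \<rhd> i k) \<cdot> (?Y \<rhd> p k) \<cdot> (?Y \<rhd> idt X) \<cdot> q = (?Y \<rhd> idt X) \<cdot> q"
    proof (induction rule: covers_induct[OF graded_decomp_covers[OF hbD(1)[OF P] d],
          where P = "\<lambda>u. (?Y \<rhd> i k) \<cdot> (?Y \<rhd> p k) \<cdot> (?Y \<rhd> u) \<cdot> q = (?Y \<rhd> u) \<cdot> q"])
      case 1 show ?case by simp
    next
      case (2 f g)
      then show ?case by (simp add: lw_def tns_pls cmp_pls)
    next
      case (3 s r)
      then obtain n where n [simp]: "n \<in> S" and s: "s = i n" by blast
      show ?case
      proof (cases "n = k")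
        case True
        have "(?Y \<rhd> p k) \<cdot> (?Y \<rhd> i k) = idt (?Y \<odot> dm (i k))"
          using graded_decompD(8)[OF d k k] by (simp flip: wh_cmp)
        from tl2[OF this] show ?thesis using 3 True s by simp
      next
        case False
        have "(?Y \<rhd> r) \<cdot> q = zr (dm (i m) \<odot> ?Y) (?Y \<odot> dm (i n))"
          using z[of r n] False \<open>k = m\<close> 3 s graded_decompD(4)[OF d n] by simp
        then show ?thesis using 3 s by simp
      qed
    qed
    then show ?thesis using True by simp
  qed
  have n: "P Y \<cdot> (X \<rhd> j) = (j \<lhd> X) \<cdot> P ?Y" using hbD(5)[OF P, of j] by simp
  have Ps: "P Y \<cdot> s = (j \<lhd> X) \<cdot> q" by (simp add: s tns_wh tl2[OF n] q_def)
  have "((Y \<rhd> i k) \<cdot> (Y \<rhd> p k) \<cdot> P Y) \<cdot> s = (Y \<rhd> i k) \<cdot> (Y \<rhd> p k) \<cdot> (j \<lhd> X) \<cdot> q"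
    using Ps by (simp add: s)
  also have "\<dots> = (j \<lhd> X) \<cdot> (?Y \<rhd> i k) \<cdot> (?Y \<rhd> p k) \<cdot> q"
    by (simp add: tl2[OF wh_swap'[of j "p k"]] tl2[OF wh_swap'[of j "i k"]])
  also have "\<dots> = (if k = m then P Y \<cdot> s else zr (dm s) (Y \<odot> X))" by (simp add: e Ps) (simp add: s)
  also have "\<dots> = P Y \<cdot> (((i k \<cdot> p k) \<boxtimes> idt Y) \<cdot> s)"
    using graded_decompD(8)[OF d m k] by (simp add: s tns_cmp)
  also have "\<dots> = (P Y \<cdot> (i k \<lhd> Y) \<cdot> (p k \<lhd> Y)) \<cdot> s"
    by (simp add: s flip: rw_def)
  finally show "((Y \<rhd> i k) \<cdot> (Y \<rhd> p k) \<cdot> P Y) \<cdot> s = (P Y \<cdot> (i k \<lhd> Y) \<cdot> (p k \<lhd> Y)) \<cdot> s" .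
qed (use assms hbD[OF P] graded_decompD[OF d] in simp_all)

text \<open>
  The homogeneous components of the object underlying \<open>x\<close> carry half-braidings for which the
  inclusions and projections are morphisms of the center.
\<close>

lemma center_components:
  assumes x: "x \<in> Obj (center C)" and d: "graded_decomp (fst x) S i p"
  shows "\<exists>y. \<forall>k\<in>S. y k \<in> Obj (center C) \<and> fst (y k) = dm (i k) \<and>
    im (hbp (y k)) (hbp x) (i k) \<and> im (hbp x) (hbp (y k)) (p k)"
proof -
  define R where "R k Y = (Y \<rhd> p k) \<cdot> hbp x Y \<cdot> (i k \<lhd> Y)" for k Y
  define y where "y k = (dm (i k), \<lambda>Y\<in>Obj C. mo (R k Y))" for k
  note P = center_objD(2)[OF x]
  have ends: "dm (R k Y) = dm (i k) \<odot> Y" "cd (R k Y) = Y \<odot> dm (i k)" if "k \<in> S" "Y \<in> Obj C" for k Y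
    using that graded_decompD[OF d] by (simp_all add: R_def)
  have r: "hbp (y k) Y = R k Y" if "k \<in> S" "Y \<in> Obj C" for k Y
    using ends[OF that] that by (auto simp: y_def hbt_def intro: triple_eqI)
  have h: "hb (dm (i k)) (R k)" "im (R k) (hbp x) (i k)" "im (hbp x) (R k) (p k)" if k: "k \<in> S" for k
    using hb_retract[OF P graded_decompD(2)[OF d k] refl graded_decompD(3,5-7)[OF d k] _
        hb_component_commutes[OF P d k]] graded_decompD(8)[OF d k k] by (simp_all add: R_def[abs_def])
  show ?thesis
  proof (intro exI[of _ y] ballI conjI)
    fix k assume k: "k \<in> S"
    show "fst (y k) = dm (i k)" by (simp add: y_def)
    show "y k \<in> Obj (center C)"
      using hb_cong[of "hbp (y k)" "R k" "dm (i k)"] r[OF k] h(1)[OF k]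
      by (simp add: center_obj_hb) (simp add: y_def)
    show "im (hbp (y k)) (hbp x) (i k)" "im (hbp x) (hbp (y k)) (p k)"
      using h(2,3)[OF k] im_cong[of "hbp (y k)" "R k"] im_cong[of "hbp x" "hbp x" "hbp (y k)" "R k"] r[OF k]
      by auto
  qed
qed

text \<open>Every object of the center is covered by intertwiners from homogeneous objects of the center.\<close>

definition chom where
  "chom x = {i. arr i \<and> cd i = fst x \<and>
     (\<exists>y g. y \<in> Obj (center C) \<and> fst y \<in> D g \<and> dm i = fst y \<and> im (hbp y) (hbp x) i)}"

lemma covers_chom:
  assumes x: "x \<in> Obj (center C)"
  shows "covers (fst x) (chom x)"
proof -
  obtain S i p where d: "graded_decomp (fst x) S i p"
      using graded_decomp_exists[OF center_objD(1)[OF x]] by blast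
  obtain y where y: "\<forall>k\<in>S. y k \<in> Obj (center C) \<and> fst (y k) = dm (i k) \<and>
      im (hbp (y k)) (hbp x) (i k) \<and> im (hbp x) (hbp (y k)) (p k)"
    using center_components[OF x d] by (rule exE)
  have "i ` S \<subseteq> chom x"
  proof
    fix s assume "s \<in> i ` S"
    then obtain k where k: "k \<in> S" "s = i k" by blast
    have "y k \<in> Obj (center C)" "fst (y k) = dm (i k)" "im (hbp (y k)) (hbp x) (i k)"
      using bspec[OF y k(1)] by blast+
    then have "fst (y k) \<in> D k" "y k \<in> Obj (center C)" "dm s = fst (y k)" "im (hbp (y k)) (hbp x) s"
      using graded_decompD(4)[OF d k(1)] k(2) by simp_all
    then show "s \<in> chom x"
      unfolding chom_def using graded_decompD(2,3)[OF d k(1)] k(2) by blast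
  qed
  then show ?thesis
    by (rule covers_mono[OF graded_decomp_covers[OF center_objD(1)[OF x] d]]) (simp add: chom_def)
qed

lemma center_finsum:
  assumes x: "x \<in> Obj (center C)" and y: "y \<in> Obj (center C)"
    and "finite S" and F: "\<And>k. k \<in> S \<Longrightarrow> F k \<in> Hom (center C) x y"
  shows "finsum (hom_group (center C) x y) F S = finsum (hom_group C (fst x) (fst y)) F S"
proof -
  interpret Z: linear_category "center C" by (rule center_linear)
  interpret A: abelian_group "hom_group (center C) x y" using Z.hom_abelian x y by blast
  interpret B: abelian_group "hom_group C (fst x) (fst y)" using hom_abelian x y by simp
  have FC: "F k \<in> Hom C (fst x) (fst y)" if "k \<in> S" for k using F[OF that] by (rule center_homD)
  have cG: "carrier (hom_group (center C) x y) = Hom (center C) x y"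
    "add (hom_group (center C) x y) = AddM C" "zero (hom_group (center C) x y) = ZeroM C (fst x) (fst y)"
    "carrier (hom_group C (fst x) (fst y)) = Hom C (fst x) (fst y)"
    "add (hom_group C (fst x) (fst y)) = AddM C" "zero (hom_group C (fst x) (fst y)) = ZeroM C (fst x) (fst y)"
    by (simp_all add: hom_group_def)
  show ?thesis
    using assms(3) F FC
  proof (induction S rule: finite_induct)
    case empty
    then show ?case by (simp add: cG)
  next
    case (insert k T)
    then show ?case
      by (subst A.finsum_insert, simp_all add: cG Pi_iff)
  qed
qed

theorem center_graded_monoidal: "graded_monoidal_category (center C) (center_grading C D)"
proof -
  interpret Z: monoidal_category "center C" by (rule center_monoidal)
  have cgD: "x \<in> center_grading C D g \<longleftrightarrow> x \<in> Obj (center C) \<and> fst x \<in> D g" for x g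
    by (simp add: center_grading_def case_prod_beta)
  show ?thesis
  proof (intro graded_monoidal_category.intro graded_category.intro graded_category_axioms.intro
      graded_monoidal_category_axioms.intro)
    show "monoidal_category (center C)" "linear_category (center C)" by unfold_locales
    show "center_grading C D g \<subseteq> Obj (center C)" for g by (auto simp: cgD)
    show "UnitO (center C) \<in> center_grading C D 0" using center_unit_obj unit_degree by (simp add: cgD)
    show "x \<odot>\<^bsub>center C\<^esub> y \<in> center_grading C D (g + h)"
      if "x \<in> center_grading C D g" "y \<in> center_grading C D h" for x y g h
      using that center_tens_obj tens_degree by (simp add: cgD)
  next
    fix g h x y assume gh: "g \<noteq> h" and x: "x \<in> center_grading C D g" and y: "y \<in> center_grading C D h"
    have 1: "Hom C (fst x) (fst y) = {ZeroM (center C) x y}"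
      unfolding center_sel using x y by (intro hom_distinct_degrees[OF gh]) (simp_all add: cgD)
    have 2: "ZeroM (center C) x y \<in> Hom (center C) x y"
      using x y by (intro Z.zero_in_hom) (simp_all add: cgD)
    have "Hom (center C) x y \<subseteq> Hom C (fst x) (fst y)" using center_homD by (rule subsetI)
    then show "Hom (center C) x y = {ZeroM (center C) x y}" using 2 unfolding 1 by blast
  next
    fix x assume x: "x \<in> Obj (center C)"
    obtain S i p where d: "graded_decomp (fst x) S i p"
      using graded_decomp_exists[OF center_objD(1)[OF x]] by blast
    obtain y where "\<forall>k\<in>S. y k \<in> Obj (center C) \<and> fst (y k) = dm (i k) \<and>
        im (hbp (y k)) (hbp x) (i k) \<and> im (hbp x) (hbp (y k)) (p k)"
      using center_components[OF x d] by (rule exE)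
    then have y: "k \<in> S \<Longrightarrow> y k \<in> Obj (center C)" "k \<in> S \<Longrightarrow> fst (y k) = dm (i k)"
      "k \<in> S \<Longrightarrow> im (hbp (y k)) (hbp x) (i k)" "k \<in> S \<Longrightarrow> im (hbp x) (hbp (y k)) (p k)" for k
      by blast+
    note dd = graded_decompD[OF d]
    have ih: "mo (i k) \<in> Hom (center C) (y k) x" "mo (p k) \<in> Hom (center C) x (y k)" if "k \<in> S" for k
      using that y dd by (simp_all add: center_homI)
    have pi: "mo (p h) \<bullet> mo (i g) = (if g = h then Ident C (dm (i g)) else ZeroM C (dm (i g)) (dm (i h)))"
      if "g \<in> S" "h \<in> S" for g h
      using arg_cong[OF dd(8)[OF that], of mo] by (simp add: mo_sel zr_def split: if_splits)
    have s: "finsum (hom_group (center C) x x) (\<lambda>g. mo (i g) \<bullet> mo (p g)) S = Ident C (fst x)"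
      using center_finsum[OF x x dd(1), of "\<lambda>g. mo (i g) \<bullet> mo (p g)"] dd(9)
        Z.comp_closed[OF x _ x ih(2) ih(1)] y(1) by simp
    show "\<exists>S Xs i p. finite S \<and>
         (\<forall>g\<in>S. Xs g \<in> center_grading C D g \<and> i g \<in> Hom (center C) (Xs g) x \<and> p g \<in> Hom (center C) x (Xs g)) \<and>
         (\<forall>g\<in>S. \<forall>h\<in>S. p h \<bullet>\<^bsub>center C\<^esub> i g
           = (if g = h then Ident (center C) (Xs g) else ZeroM (center C) (Xs g) (Xs h))) \<and>
         Ident (center C) x = finsum (hom_group (center C) x x) (\<lambda>g. i g \<bullet>\<^bsub>center C\<^esub> p g) S"
      using dd(1) dd(4) y(1,2) ih pi s
      by (intro exI[of _ S] exI[of _ y] exI[of _ "\<lambda>k. mo (i k)"] exI[of _ "\<lambda>k. mo (p k)"])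
        (simp add: cgD)
  qed
qed

end


section \<open>Twisting half-braidings\<close>

context graded_monoidal_category
begin

text \<open>
  The properties of a half-braiding that do not involve the associator, so that they make sense
  for \<open>C\<close> and for any category that differs from it in the associator only.
\<close>

definition nf where
  "nf X P \<longleftrightarrow> X \<in> Obj C \<and> (\<forall>Y\<in>Obj C. isoarr (P Y) \<and> dm (P Y) = X \<odot> Y \<and> cd (P Y) = Y \<odot> X) \<and>
     (\<forall>f. arr f \<longrightarrow> P (cd f) \<cdot> (X \<rhd> f) = (f \<lhd> X) \<cdot> P (dm f))"

lemma nfD:
  assumes "nf X P"
  shows "X \<in> Obj C" "Y \<in> Obj C \<Longrightarrow> isoarr (P Y)" "Y \<in> Obj C \<Longrightarrow> dm (P Y) = X \<odot> Y"
    "Y \<in> Obj C \<Longrightarrow> cd (P Y) = Y \<odot> X" "Y \<in> Obj C \<Longrightarrow> arr (P Y)"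
    "\<lbrakk>arr f; Y = cd f\<rbrakk> \<Longrightarrow> P Y \<cdot> (X \<rhd> f) = (f \<lhd> X) \<cdot> P (dm f)"
  using assms by (simp_all add: nf_def del: split_paired_All)

lemma hb_nf: "hb X P \<Longrightarrow> nf X P"
  unfolding hb_def nf_def by blast

lemma hb_iff_nf:
  "hb X P \<longleftrightarrow> nf X P \<and> (\<forall>Y\<in>Obj C. \<forall>Z\<in>Obj C.
     as Y Z X \<cdot> P (Y \<odot> Z) \<cdot> as X Y Z = (Y \<rhd> P Z) \<cdot> as Y X Z \<cdot> (P Y \<lhd> Z))"
  unfolding hb_def nf_def by blast

text \<open>A half-braiding is natural in both variables, if intertwiners are used in the first one.\<close>

lemma im_natural:
  assumes P: "nf X P" and Q: "nf X' Q" and f: "arr f" "dm f = X'" "cd f = X" and im: "im Q P f"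
    and g: "arr g" "cd g = Y"
  shows "P Y \<cdot> (f \<boxtimes> g) = (g \<boxtimes> f) \<cdot> Q (dm g)"
proof -
  note [simp] = nfD(1-5)[OF P] nfD(1-5)[OF Q] f g
  have n: "P Y \<cdot> (X \<rhd> g) = (g \<lhd> X) \<cdot> P (dm g)" using nfD(6)[OF P g(1)] by simp
  have m: "P (dm g) \<cdot> (f \<lhd> dm g) = (dm g \<rhd> f) \<cdot> Q (dm g)" using im by (simp add: im_def)
  have "Y \<in> Obj C" using arrD(2)[OF g(1)] by simp
  then show ?thesis by (simp add: tns_wh[of f g] tns_wh'[of g f] tl2[OF n] m)
qed

text \<open>The family \<open>P\<close> twisted by \<open>c\<close>.\<close>

definition twh where "twh c X P Y = tw2 c X Y (P Y)"

lemma twh_ends [simp]: "dm (twh c X P Y) = X \<odot> Y" "cd (twh c X P Y) = Y \<odot> X"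
  by (simp_all add: twh_def)

lemma twh_arr: "\<lbrakk>nf X P; Y \<in> Obj C\<rbrakk> \<Longrightarrow> arr (twh c X P Y)"
  unfolding twh_def using tw2(1)[of X Y "P Y"] nfD[of X P] by simp

lemma twh_test:
  assumes "nf X P" "arr i" "cd i = X" "dm i \<in> D g" "arr j" "cd j = Y" "dm j \<in> D h"
  shows "twh c X P Y \<cdot> (i \<boxtimes> j) = scl (c g h) (P Y \<cdot> (i \<boxtimes> j))"
proof -
  have "Y \<in> Obj C" using arrD(2)[OF assms(5)] assms(6) by simp
  then show ?thesis unfolding twh_def using nfD[OF assms(1)] by (intro tw2(2)[OF _ _ _ _ _ assms(2-7)]) simp_all
qed

lemma twh_homogeneous:
  assumes P: "nf X P" and X: "X \<in> D g" and Y: "Y \<in> D h"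
  shows "twh c X P Y = scl (c g h) (P Y)"
  using twh_test[OF P, of "idt X" g "idt Y" Y h c] X Y twh_arr[OF P, of Y c] nfD(3,5)[OF P, of Y] by simp

lemma twh_natural:
  assumes P: "nf X P" and f: "arr f"
  shows "twh c X P (cd f) \<cdot> (X \<rhd> f) = (f \<lhd> X) \<cdot> twh c X P (dm f)"
proof (rule homogeneous_ext2[of X "dm f"])
  note [simp] = nfD(1-5)[OF P] f twh_arr[OF P]
  fix i j g h assume ij [simp]: "arr i" "cd i = X" "dm i \<in> D g" "arr j" "cd j = dm f" "dm j \<in> D h"
  have "(twh c X P (cd f) \<cdot> (X \<rhd> f)) \<cdot> (i \<boxtimes> j) = twh c X P (cd f) \<cdot> (i \<boxtimes> (f \<cdot> j))"
    by (simp add: lw_def tns_cmp)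
  also have "\<dots> = scl (c g h) (P (cd f) \<cdot> (i \<boxtimes> (f \<cdot> j)))" by (rule twh_test[OF P]) simp_all
  also have "\<dots> = scl (c g h) ((P (cd f) \<cdot> (X \<rhd> f)) \<cdot> (i \<boxtimes> j))" by (simp add: lw_def tns_cmp)
  also have "\<dots> = (f \<lhd> X) \<cdot> scl (c g h) (P (dm f) \<cdot> (i \<boxtimes> j))" by (simp add: nfD(6)[OF P])
  also have "\<dots> = (f \<lhd> X) \<cdot> (twh c X P (dm f) \<cdot> (i \<boxtimes> j))"
    using twh_test[OF P, of i g j "dm f" h c] by simp
  finally show "(twh c X P (cd f) \<cdot> (X \<rhd> f)) \<cdot> (i \<boxtimes> j) = ((f \<lhd> X) \<cdot> twh c X P (dm f)) \<cdot> (i \<boxtimes> j)"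
    by simp
qed (use nfD[OF P] f twh_arr[OF P] in simp_all)

lemma nf_twh:
  assumes P: "nf X P" and nz: "\<And>g h. c g h \<noteq> 0"
  shows "nf X (twh c X P)"
proof -
  note [simp] = nfD(1-5)[OF P] twh_arr[OF P]
  have "isoarr (twh c X P Y)" if [simp]: "Y \<in> Obj C" for Y
  proof -
    define s where "s c = iv (P Y) \<cdot> twh c X P Y" for c
    have s [simp]: "arr (s c)" "dm (s c) = X \<odot> Y" "cd (s c) = X \<odot> Y" for c by (simp_all add: s_def)
    have st: "s c \<cdot> (i \<boxtimes> j) = scl (c g h) (i \<boxtimes> j)"
      if "arr i" "cd i = X" "dm i \<in> D g" "arr j" "cd j = Y" "dm j \<in> D h" for i j g h c
      using that twh_test[OF P that] by (simp add: s_def)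
    have ss: "s c \<cdot> s c' = idt (X \<odot> Y)" if cc: "\<And>g h. c' g h * c g h = 1" for c c'
      by (rule homogeneous_ext2[of X Y]) (simp_all add: st cc homogeneousD)
    have "isoarr (s c)"
      using ss[of c "\<lambda>g h. inverse (c g h)"] ss[of "\<lambda>g h. inverse (c g h)" c] nz
      by (intro isoarrI(1)[of "s c" "s (\<lambda>g h. inverse (c g h))"]) simp_all
    moreover have "twh c X P Y = P Y \<cdot> s c" by (simp add: s_def)
    ultimately show ?thesis by simp
  qed
  then show ?thesis unfolding nf_def using twh_natural[OF P, of _ c] nfD(1)[OF P] twh_ends by blast
qed

lemma im_twh:
  assumes P: "nf X P" and Q: "nf X' Q" and f [simp]: "arr f" "dm f = X" "cd f = X'" and im: "im P Q f"
  shows "im (twh c X P) (twh c X' Q) f"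
  unfolding im_def
proof
  fix Y assume [simp]: "Y \<in> Obj C"
  note [simp] = nfD(1-5)[OF P] nfD(1-5)[OF Q] twh_arr[OF P] twh_arr[OF Q]
  show "(Y \<rhd> f) \<cdot> twh c X P Y = twh c X' Q Y \<cdot> (f \<lhd> Y)"
  proof (rule homogeneous_ext2[of X Y])
    fix i j g h assume ij [simp]: "arr i" "cd i = X" "dm i \<in> D g" "arr j" "cd j = Y" "dm j \<in> D h"
    have "(twh c X' Q Y \<cdot> (f \<lhd> Y)) \<cdot> (i \<boxtimes> j) = twh c X' Q Y \<cdot> ((f \<cdot> i) \<boxtimes> j)"
      by (simp add: rw_def tns_cmp)
    also have "\<dots> = scl (c g h) (Q Y \<cdot> ((f \<cdot> i) \<boxtimes> j))" by (rule twh_test[OF Q]) simp_all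
    also have "\<dots> = scl (c g h) ((Q Y \<cdot> (f \<lhd> Y)) \<cdot> (i \<boxtimes> j))" by (simp add: rw_def tns_cmp)
    also have "Q Y \<cdot> (f \<lhd> Y) = (Y \<rhd> f) \<cdot> P Y" using im by (simp add: im_def)
    also have "scl (c g h) (((Y \<rhd> f) \<cdot> P Y) \<cdot> (i \<boxtimes> j)) = (Y \<rhd> f) \<cdot> scl (c g h) (P Y \<cdot> (i \<boxtimes> j))" by simp
    also have "\<dots> = ((Y \<rhd> f) \<cdot> twh c X P Y) \<cdot> (i \<boxtimes> j)"
      using twh_test[OF P, of i g j Y h c] by simp
    finally show "((Y \<rhd> f) \<cdot> twh c X P Y) \<cdot> (i \<boxtimes> j) = (twh c X' Q Y \<cdot> (f \<lhd> Y)) \<cdot> (i \<boxtimes> j)" by simp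
  qed simp_all
qed

lemma twh_twh:
  assumes P: "nf X P" and nz: "\<And>g h. c' g h \<noteq> 0" and cc: "\<And>g h. c g h * c' g h = 1" and [simp]: "Y \<in> Obj C"
  shows "twh c X (twh c' X P) Y = P Y"
proof (rule homogeneous_ext2[of X Y])
  note Q = nf_twh[OF P, of c', OF nz]
  note [simp] = nfD(1-5)[OF P] twh_arr[OF P] twh_arr[OF Q]
  fix i j g h assume ij: "arr i" "cd i = X" "dm i \<in> D g" "arr j" "cd j = Y" "dm j \<in> D h"
  show "twh c X (twh c' X P) Y \<cdot> (i \<boxtimes> j) = P Y \<cdot> (i \<boxtimes> j)"
    using twh_test[OF Q ij, of c] twh_test[OF P ij, of c'] ij cc[of g h] by simp
qed (use nfD[OF P] twh_arr[OF nf_twh[OF P, of c', OF nz]] in simp_all)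

text \<open>The map on objects of the center that twists the half-braiding by \<open>c\<close>.\<close>

definition ctw where "ctw c x = (fst x, half_braiding_twist C D c (fst x) (snd x))"

lemma fst_ctw [simp]: "fst (ctw c x) = fst x"
  by (simp add: ctw_def)

lemma hbp_ctw: "\<lbrakk>X = fst x; Y \<in> Obj C\<rbrakk> \<Longrightarrow> hbt X (snd (ctw c x)) Y = twh c X (hbp x) Y"
  by (simp add: ctw_def hbt_def half_braiding_twist_def twh_def tw2_def)

lemma twh_cong: "P Y = Q Y \<Longrightarrow> twh c X P Y = twh c X Q Y"
  by (simp add: twh_def)

lemma ctw_ctw:
  assumes "nf (fst x) (hbp x)" "snd x \<in> extensional (Obj C)"
    and "\<And>g h. c' g h \<noteq> 0" "\<And>g h. c g h * c' g h = 1"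
  shows "ctw c (ctw c' x) = x"
proof -
  have "snd (ctw c (ctw c' x)) Y = snd x Y" for Y
  proof (cases "Y \<in> Obj C")
    case True
    have "hbp (ctw c (ctw c' x)) Y = hbp x Y"
      using twh_twh[of "fst x" "hbp x" c' c Y] assms True
        twh_cong[of "hbp (ctw c' x)" Y "twh c' (fst x) (hbp x)" c "fst x"] by (simp add: hbp_ctw)
    then show ?thesis by (simp add: hbt_def)
  next
    case False
    then show ?thesis using assms(2) by (simp add: ctw_def half_braiding_twist_def extensional_def)
  qed
  then show ?thesis by (intro prod_eqI ext) simp_all
qed

end


section \<open>Categories that differ by a scalar on the associator\<close>

text \<open>
  Two graded monoidal categories \<open>C\<close> and \<open>C\<lparr>Assoc := A\<rparr>\<close> whose associators differ by the scalar \<open>\<omega>\<close>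
  on homogeneous objects. The situation is symmetric: \<open>C\<close> arises from \<open>C\<lparr>Assoc := A\<rparr>\<close> in the same way,
  with \<open>\<omega>\<^sup>-\<^sup>1\<close>. Constants of the second category carry the prefix \<open>T\<close>.
\<close>

locale associator_twist = graded_monoidal_category C D + T: graded_monoidal_category "C\<lparr>Assoc := A\<rparr>" D
  for C :: "('o, 'm, 'k::field, 'e) mon_cat_scheme" (structure)
    and D :: "'g::ab_group_add \<Rightarrow> 'o set" and A +
  fixes \<omega> :: "'g \<Rightarrow> 'g \<Rightarrow> 'g \<Rightarrow> 'k"
  assumes A_homogeneous: "\<lbrakk>X \<in> D g; Y \<in> D h; Z \<in> D k\<rbrakk> \<Longrightarrow> A X Y Z = Scale C (\<omega> g h k) (Assoc C X Y Z)"
    and \<omega>_nonzero: "\<omega> g h k \<noteq> 0"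
begin

text \<open>The associator \<open>A\<close>, as a family of typed morphisms of \<open>C\<close>.\<close>

definition aw where "aw X Y Z = ((X \<odot> Y) \<odot> Z, A X Y Z, X \<odot> (Y \<odot> Z))"

lemma aw_ends [simp]: "dm (aw X Y Z) = (X \<odot> Y) \<odot> Z" "cd (aw X Y Z) = X \<odot> (Y \<odot> Z)"
  by (simp_all add: aw_def)

lemma T_simps [simp]:
  "T.arr = arr" "T.idt = idt" "T.cmp = cmp" "T.tns = tns" "T.scl = scl" "T.isoarr = isoarr" "T.iv = iv"
  "T.lw = lw" "T.rw = rw" "T.as = aw" "T.io = io" "T.hbt = hbt" "T.im = im" "T.nf = nf"
proof -
  have i: "is_iso (C\<lparr>Assoc := A\<rparr>) = is_iso C" "iso_inv (C\<lparr>Assoc := A\<rparr>) = iso_inv C"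
    by (intro ext, simp add: is_iso_def iso_inv_def inverse_pair_def)+
  show 1 [simp]: "T.arr = arr" "T.idt = idt" "T.cmp = cmp" "T.tns = tns"
    by (simp_all add: fun_eq_iff T.arr_def arr_def T.idt_def idt_def T.cmp_def cmp_def T.tns_def tns_def del: arrD)
  show 2 [simp]: "T.scl = scl" "T.isoarr = isoarr" "T.iv = iv" "T.as = aw" "T.io = io" "T.hbt = hbt"
    by (simp_all add: fun_eq_iff T.scl_def scl_def T.isoarr_def isoarr_def i T.iv_def iv_def T.as_def aw_def
        T.io_def io_def T.hbt_def hbt_def)
  show 3 [simp]: "T.lw = lw" "T.rw = rw"
    by (simp_all add: fun_eq_iff T.lw_def lw_def T.rw_def rw_def)
  show "T.im = im" "T.nf = nf"
    by (simp_all add: fun_eq_iff T.im_def im_def T.nf_def nf_def del: split_paired_All)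
qed

lemma iso_aw [simp]: "\<lbrakk>X \<in> Obj C; Y \<in> Obj C; Z \<in> Obj C\<rbrakk> \<Longrightarrow> isoarr (aw X Y Z)"
  using T.iso_as[of X Y Z] by simp

lemma aw_nat:
  "\<lbrakk>arr f; arr g; arr h; X = cd f; Y = cd g; Z = cd h\<rbrakk>
    \<Longrightarrow> aw X Y Z \<cdot> ((f \<boxtimes> g) \<boxtimes> h) = (f \<boxtimes> (g \<boxtimes> h)) \<cdot> aw (dm f) (dm g) (dm h)"
  using T.as_natE[of f g h X Y Z] by simp

lemma aw_homogeneous: "\<lbrakk>X \<in> D g; Y \<in> D h; Z \<in> D k\<rbrakk> \<Longrightarrow> aw X Y Z = scl (\<omega> g h k) (as X Y Z)"
  by (simp add: aw_def scl_def as_def A_homogeneous)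

lemma T_twist2: "twist2 (C\<lparr>Assoc := A\<rparr>) D c X Y f = twist2 C D c X Y f"
  by (simp add: twist2_def degrees_def degree_proj_def hom_group_def)

lemma T_ctw [simp]: "T.ctw = ctw" "T.twh = twh"
  by (simp_all add: fun_eq_iff T.ctw_def ctw_def half_braiding_twist_def T.twh_def twh_def T.tw2_def tw2_def T_twist2)

lemma T_covers: "T.covers = covers"
  by (simp add: fun_eq_iff T.covers_def covers_def T.zr_def zr_def T.pls_def pls_def del: split_paired_All)

abbreviation center_T where "center_T \<equiv> center (C\<lparr>Assoc := A\<rparr>)"

lemma reverse: "associator_twist (C\<lparr>Assoc := A\<rparr>) D (Assoc C) (\<lambda>g h k. inverse (\<omega> g h k))"
proof -
  have C: "C\<lparr>Assoc := A, Assoc := Assoc C\<rparr> = C" by simp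
  have s: "Assoc C X Y Z = Scale C (inverse (\<omega> g h k)) (A X Y Z)"
    if "X \<in> D g" "Y \<in> D h" "Z \<in> D k" for X Y Z g h k
    using that \<omega>_nonzero arrD(3)[of "as X Y Z"]
    by (simp add: A_homogeneous mo_sel scale_scale[of "(X \<odot> Y) \<odot> Z" "X \<odot> (Y \<odot> Z)"]
        scale_one[of "(X \<odot> Y) \<odot> Z" "X \<odot> (Y \<odot> Z)"])
  show ?thesis
    unfolding associator_twist_def associator_twist_axioms_def C
    using graded_monoidal_category_axioms T.graded_monoidal_category_axioms s \<omega>_nonzero by simp
qed

text \<open>
  Twisting by \<open>\<gamma>\<close> turns half-braidings for the associator of \<open>C\<close> into half-braidings for the twisted
  one. Both sides of the hexagon are natural, in \<open>X\<close> with respect to intertwiners, so it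
  suffices to compare scalars on homogeneous objects.
\<close>

lemma ctw_obj:
  assumes x: "x \<in> Obj (center C)"
    and nz: "\<And>g h. \<gamma> g h \<noteq> 0"
    and hex: "\<And>g h k. \<omega> h k g * \<gamma> g (h + k) * \<omega> g h k = \<gamma> g k * \<omega> h g k * \<gamma> g h"
  shows "ctw \<gamma> x \<in> Obj center_T"
proof -
  let ?X = "fst x"
  let ?p = "twh \<gamma> ?X (hbp x)"
  note P = hb_nf[OF center_objD(2)[OF x]]
  note N = nf_twh[OF P, of \<gamma>, OF nz]
  note [simp] = nfD(1-5)[OF N]
  have h: "aw Y Z ?X \<cdot> ?p (Y \<odot> Z) \<cdot> aw ?X Y Z = (Y \<rhd> ?p Z) \<cdot> aw Y ?X Z \<cdot> (?p Y \<lhd> Z)"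
    if YZ [simp]: "Y \<in> Obj C" "Z \<in> Obj C" for Y Z
  proof (rule covers_ext[OF covers_tns[OF covers_tns[OF covers_chom[OF x] covers_homs[OF YZ(1)]] covers_homs[OF YZ(2)]]])
    fix s assume "s \<in> {u \<boxtimes> k |u k. u \<in> {i \<boxtimes> j |i j. i \<in> chom x \<and> j \<in> homs Y} \<and> k \<in> homs Z}"
    then obtain i j k where s: "s = (i \<boxtimes> j) \<boxtimes> k" and i: "i \<in> chom x" and j: "j \<in> homs Y" and k: "k \<in> homs Z"
      by blast
    from i obtain y g where i [simp]: "arr i" "cd i = ?X" "dm i = fst y" and y: "y \<in> Obj (center C)"
      and g: "fst y \<in> D g" and im: "im (hbp y) (hbp x) i" unfolding chom_def by blast
    from j obtain h where j [simp]: "arr j" "cd j = Y" and h: "dm j \<in> D h" unfolding homs_def by blast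
    from k obtain l where k [simp]: "arr k" "cd k = Z" and l: "dm k \<in> D l" unfolding homs_def by blast
    let ?X' = "fst y" and ?Y' = "dm j" and ?Z' = "dm k" and ?q = "twh \<gamma> (fst y) (hbp y)"
    note Q = hb_nf[OF center_objD(2)[OF y]]
    note M = nf_twh[OF Q, of \<gamma>, OF nz]
    note [simp] = nfD(1-5)[OF M] nfD(1-5)[OF Q]
    have nat: "?p (cd f) \<cdot> (i \<boxtimes> f) = (f \<boxtimes> i) \<cdot> ?q (dm f)" if "arr f" for f
      using that im_twh[OF Q P i(1) i(3) i(2) im, of \<gamma>] by (intro im_natural[OF N M]) simp_all
    have e: "aw ?X Y Z \<cdot> s = (i \<boxtimes> (j \<boxtimes> k)) \<cdot> aw ?X' ?Y' ?Z'"
      "?p (Y \<odot> Z) \<cdot> (i \<boxtimes> (j \<boxtimes> k)) = ((j \<boxtimes> k) \<boxtimes> i) \<cdot> ?q (?Y' \<odot> ?Z')"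
      "aw Y Z ?X \<cdot> ((j \<boxtimes> k) \<boxtimes> i) = (j \<boxtimes> (k \<boxtimes> i)) \<cdot> aw ?Y' ?Z' ?X'"
      "(?p Y \<lhd> Z) \<cdot> s = ((j \<boxtimes> i) \<boxtimes> k) \<cdot> (?q ?Y' \<lhd> ?Z')"
      "aw Y ?X Z \<cdot> ((j \<boxtimes> i) \<boxtimes> k) = (j \<boxtimes> (i \<boxtimes> k)) \<cdot> aw ?Y' ?X' ?Z'"
      "(Y \<rhd> ?p Z) \<cdot> (j \<boxtimes> (i \<boxtimes> k)) = (j \<boxtimes> (k \<boxtimes> i)) \<cdot> (?Y' \<rhd> ?q ?Z')"
      using nat[of j] nat[of k] nat[of "j \<boxtimes> k"] by (simp_all add: s aw_nat lw_def rw_def tns_cmp)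
    note w = aw_homogeneous and t = twh_homogeneous[OF Q g, of _ _ \<gamma>]
    have "aw ?Y' ?Z' ?X' \<cdot> ?q (?Y' \<odot> ?Z') \<cdot> aw ?X' ?Y' ?Z' = (?Y' \<rhd> ?q ?Z') \<cdot> aw ?Y' ?X' ?Z' \<cdot> (?q ?Y' \<lhd> ?Z')"
      using hex[of h l g] hbD(6)[OF center_objD(2)[OF y], of ?Y' ?Z']
      by (simp add: w[OF h l g] w[OF g h l] w[OF h g l] t[OF h] t[OF l] t[OF tens_degree[OF h l]] ac_simps)
    then show "(aw Y Z ?X \<cdot> ?p (Y \<odot> Z) \<cdot> aw ?X Y Z) \<cdot> s = ((Y \<rhd> ?p Z) \<cdot> aw Y ?X Z \<cdot> (?p Y \<lhd> Z)) \<cdot> s"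
      using e(1,4) by (simp add: s tl2[OF e(2)] tl2[OF e(3)] tl2[OF e(5)] tl2[OF e(6)])
  qed simp_all
  have "T.hb ?X ?p" unfolding T.hb_iff_nf using N h by simp
  then have "T.hb ?X (hbp (ctw \<gamma> x))"
    using T.hb_cong[of "hbp (ctw \<gamma> x)" ?p ?X] by (simp add: hbp_ctw)
  then show ?thesis
    by (simp add: T.center_obj_hb) (simp add: ctw_def half_braiding_twist_def)
qed

lemma ctw_hom:
  assumes x: "x \<in> Obj (center C)" and y: "y \<in> Obj (center C)"
    and f: "f \<in> Hom (center C) x y"
  shows "f \<in> Hom center_T (ctw \<gamma> x) (ctw \<gamma> y)"
proof -
  have "im (twh \<gamma> (fst x) (hbp x)) (twh \<gamma> (fst y) (hbp y)) (fst x, f, fst y)"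
    using f x y center_arr[OF x y f]
    by (intro im_twh hb_nf) (simp_all add: center_hom)
  then show ?thesis
    using f x y im_cong[of "hbp (ctw \<gamma> x)" "twh \<gamma> (fst x) (hbp x)" "hbp (ctw \<gamma> y)" "twh \<gamma> (fst y) (hbp y)"]
    by (simp add: center_hom T.center_hom hbp_ctw)
qed

end


section \<open>Strict isomorphisms of braided categories\<close>

text \<open>
  If \<open>F\<close> is a bijection on objects, and the two categories have the same morphisms, operations,
  associators and braidings under \<open>F\<close>, then \<open>F\<close> with the identity on morphisms is a braided
  equivalence. The braided axioms are assumed for \<open>A\<close> only and transported to \<open>B\<close>.
\<close>

lemma strict_iso_braided_tensor_equivalence:
  fixes A :: "('o, 'm, 'k::field, 'e) braided_cat_scheme" and B :: "('p, 'm, 'k, 'd) braided_cat_scheme"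
  assumes A: "braided_monoidal_category A" and B: "monoidal_category B"
    and F: "\<And>x. x \<in> Obj A \<Longrightarrow> F x \<in> Obj B"
    and G: "\<And>y. y \<in> Obj B \<Longrightarrow> G y \<in> Obj A"
    and FG: "\<And>y. y \<in> Obj B \<Longrightarrow> F (G y) = y"
    and GF: "\<And>x. x \<in> Obj A \<Longrightarrow> G (F x) = x"
    and hom: "\<And>x y. \<lbrakk>x \<in> Obj A; y \<in> Obj A\<rbrakk> \<Longrightarrow> Hom B (F x) (F y) = Hom A x y"
    and ident: "\<And>x. x \<in> Obj A \<Longrightarrow> Ident B (F x) = Ident A x"
    and ops: "Comp B = Comp A" "AddM B = AddM A" "Scale B = Scale A" "TensM B = TensM A"
    and tens: "\<And>x y. \<lbrakk>x \<in> Obj A; y \<in> Obj A\<rbrakk> \<Longrightarrow> F x \<odot>\<^bsub>B\<^esub> F y = F (x \<odot>\<^bsub>A\<^esub> y)"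
    and assoc: "\<And>x y z. \<lbrakk>x \<in> Obj A; y \<in> Obj A; z \<in> Obj A\<rbrakk> \<Longrightarrow> Assoc B (F x) (F y) (F z) = Assoc A x y z"
    and unit: "UnitO B = F (UnitO A)"
    and braid: "\<And>x y. \<lbrakk>x \<in> Obj A; y \<in> Obj A\<rbrakk> \<Longrightarrow> Braid B (F x) (F y) = Braid A x y"
  shows "braided_tensor_equivalence A B F (\<lambda>f. f) (\<lambda>x y. Ident A (x \<odot>\<^bsub>A\<^esub> y))"
proof -
  interpret A: braided_monoidal_category A by (rule A)
  interpret B: monoidal_category B by (rule B)
  note [simp] = F G FG GF hom ident ops tens assoc braid
  have surj: "\<exists>x\<in>Obj A. y = F x" if "y \<in> Obj B" for y using that by (intro bexI[of _ "G y"]) simp_all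
  have ip: "inverse_pair B (F x) (F y) f g \<longleftrightarrow> inverse_pair A x y f g"
    if "x \<in> Obj A" "y \<in> Obj A" for x y f g
    using that by (simp add: inverse_pair_def)
  have iso: "is_iso B (F x) (F y) f \<longleftrightarrow> is_iso A x y f" if "x \<in> Obj A" "y \<in> Obj A" for x y f
    using that by (simp add: is_iso_def ip)
  have ai: "assoc_inv B (F x) (F y) (F z) = assoc_inv A x y z"
    if "x \<in> Obj A" "y \<in> Obj A" "z \<in> Obj A" for x y z
    using that by (simp add: assoc_inv_def iso_inv_def ip)
  have "braided_monoidal_category B"
  proof
    fix u v assume "u \<in> Obj B" "v \<in> Obj B"
    then obtain x y where [simp]: "x \<in> Obj A" "y \<in> Obj A" "u = F x" "v = F y" using surj by meson
    show "is_iso B (u \<odot>\<^bsub>B\<^esub> v) (v \<odot>\<^bsub>B\<^esub> u) (Braid B u v)" by (simp add: iso A.braid_iso)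
  next
    fix u v u' v' f g assume "u \<in> Obj B" "v \<in> Obj B" "u' \<in> Obj B" "v' \<in> Obj B" and fg: "f \<in> Hom B u u'" "g \<in> Hom B v v'"
    then obtain x y x' y' where [simp]: "x \<in> Obj A" "y \<in> Obj A" "x' \<in> Obj A" "y' \<in> Obj A"
      "u = F x" "v = F y" "u' = F x'" "v' = F y'" using surj by meson
    show "Braid B u' v' \<bullet>\<^bsub>B\<^esub> (f \<star>\<^bsub>B\<^esub> g) = (g \<star>\<^bsub>B\<^esub> f) \<bullet>\<^bsub>B\<^esub> Braid B u v"
      using fg A.braid_natural[of x y x' y' f g] by simp
  next
    fix u v w assume "u \<in> Obj B" "v \<in> Obj B" "w \<in> Obj B"
    then obtain x y z where [simp]: "x \<in> Obj A" "y \<in> Obj A" "z \<in> Obj A" "u = F x" "v = F y" "w = F z"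
      using surj by meson
    show "Assoc B v w u \<bullet>\<^bsub>B\<^esub> Braid B u (v \<odot>\<^bsub>B\<^esub> w) \<bullet>\<^bsub>B\<^esub> Assoc B u v w
      = (Ident B v \<star>\<^bsub>B\<^esub> Braid B u w) \<bullet>\<^bsub>B\<^esub> Assoc B v u w \<bullet>\<^bsub>B\<^esub> (Braid B u v \<star>\<^bsub>B\<^esub> Ident B w)"
      using A.hexagon1[of x y z] by simp
    show "assoc_inv B w u v \<bullet>\<^bsub>B\<^esub> Braid B (u \<odot>\<^bsub>B\<^esub> v) w \<bullet>\<^bsub>B\<^esub> assoc_inv B u v w
      = (Braid B u w \<star>\<^bsub>B\<^esub> Ident B v) \<bullet>\<^bsub>B\<^esub> assoc_inv B u w v \<bullet>\<^bsub>B\<^esub> (Ident B u \<star>\<^bsub>B\<^esub> Braid B v w)"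
      using A.hexagon2[of x y z] by (simp add: ai)
  qed
  moreover have fF: "is_functor A B F (\<lambda>f. f)" and fG: "is_functor B A G (\<lambda>f. f)"
  proof -
    show "is_functor A B F (\<lambda>f. f)" by (simp add: is_functor_def)
    have "Hom B u v = Hom A (G u) (G v)" "Ident B u = Ident A (G u)" if "u \<in> Obj B" "v \<in> Obj B" for u v
      using that hom[of "G u" "G v"] ident[of "G u"] by simp_all
    then show "is_functor B A G (\<lambda>f. f)" by (simp add: is_functor_def)
  qed
  moreover have "is_equivalence A B F (\<lambda>f. f)"
  proof -
    have "natural_iso A A (\<lambda>x. x) (\<lambda>f. f) (G \<circ> F) ((\<lambda>f. f) \<circ> (\<lambda>f. f)) (Ident A)"
      using A.ident_is_iso A.comp_ident A.ident_comp by (simp add: natural_iso_def)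
    moreover have "natural_iso B B (F \<circ> G) ((\<lambda>f. f) \<circ> (\<lambda>f. f)) (\<lambda>x. x) (\<lambda>f. f) (Ident B)"
      using B.ident_is_iso B.comp_ident B.ident_comp unfolding natural_iso_def by (simp del: ops)
    ultimately show ?thesis using fF fG unfolding is_equivalence_def by blast
  qed
  moreover have "is_monoidal_functor A B F (\<lambda>f. f) (\<lambda>x y. Ident A (x \<odot>\<^bsub>A\<^esub> y))"
  proof -
    have "is_iso B (UnitO B) (F (UnitO A)) (Ident B (UnitO B))"
      using B.ident_is_iso[OF B.unit_obj] unit by simp
    moreover have "Ident A (x' \<odot>\<^bsub>A\<^esub> y') \<bullet>\<^bsub>A\<^esub> (f \<star>\<^bsub>A\<^esub> g) = (f \<star>\<^bsub>A\<^esub> g) \<bullet>\<^bsub>A\<^esub> Ident A (x \<odot>\<^bsub>A\<^esub> y)"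
      if "x \<in> Obj A" "y \<in> Obj A" "x' \<in> Obj A" "y' \<in> Obj A" "f \<in> Hom A x x'" "g \<in> Hom A y y'" for x y x' y' f g
      using that A.tens_closed[of x x' y y' f g] A.tens_obj A.comp_ident A.ident_comp by metis
    moreover have "Assoc A x y z \<bullet>\<^bsub>A\<^esub> Ident A ((x \<odot>\<^bsub>A\<^esub> y) \<odot>\<^bsub>A\<^esub> z) \<bullet>\<^bsub>A\<^esub> (Ident A (x \<odot>\<^bsub>A\<^esub> y) \<star>\<^bsub>A\<^esub> Ident A z)
        = Ident A (x \<odot>\<^bsub>A\<^esub> (y \<odot>\<^bsub>A\<^esub> z)) \<bullet>\<^bsub>A\<^esub> (Ident A x \<star>\<^bsub>A\<^esub> Ident A (y \<odot>\<^bsub>A\<^esub> z)) \<bullet>\<^bsub>A\<^esub> Assoc A x y z"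
      if "x \<in> Obj A" "y \<in> Obj A" "z \<in> Obj A" for x y z
    proof -
      let ?P = "(x \<odot>\<^bsub>A\<^esub> y) \<odot>\<^bsub>A\<^esub> z" and ?Q = "x \<odot>\<^bsub>A\<^esub> (y \<odot>\<^bsub>A\<^esub> z)"
      have a: "Assoc A x y z \<in> Hom A ?P ?Q" and PQ: "?P \<in> Obj A" "?Q \<in> Obj A"
        using that A.assoc_iso[OF that] A.tens_obj by (auto simp: is_iso_def inverse_pair_def)
      show ?thesis
        using that A.tens_obj A.comp_ident[OF PQ a] A.ident_comp[OF PQ a]
          A.comp_ident[OF PQ(1) PQ(1) A.ident_closed[OF PQ(1)]]
        by (simp add: A.tens_ident)
    qed
    ultimately show ?thesis
      using fF A.tens_obj A.ident_is_iso iso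
      by (simp add: is_monoidal_functor_def is_linear_functor_def) blast
  qed
  moreover have "Braid A x y \<bullet>\<^bsub>A\<^esub> Ident A (x \<odot>\<^bsub>A\<^esub> y) = Ident A (y \<odot>\<^bsub>A\<^esub> x) \<bullet>\<^bsub>A\<^esub> Braid A x y"
    if "x \<in> Obj A" "y \<in> Obj A" for x y
  proof -
    have "Braid A x y \<in> Hom A (x \<odot>\<^bsub>A\<^esub> y) (y \<odot>\<^bsub>A\<^esub> x)"
      using A.braid_iso[OF that] by (auto simp: is_iso_def inverse_pair_def)
    then show ?thesis using that A.tens_obj A.comp_ident A.ident_comp by metis
  qed
  ultimately show ?thesis using A by (simp add: braided_tensor_equivalence_def)
qed


section \<open>Comparison of the two centers\<close>

context associator_twist
begin

text \<open>
  For a homogeneous \<open>Y\<close> the unitors of the twisted category differ from those of \<open>C\<close> by scalars. If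
  \<open>\<delta>\<close> takes up these scalars, twisting by it maps the unit of one center to that of the other.
\<close>

lemma T_lu: assumes Y: "Y \<in> D h" shows "T.lu Y = scl (inverse (\<omega> 0 0 h)) (lu Y)"
  using Y unit_degree \<omega>_nonzero
  by (intro T.lu_eqI) (simp_all add: lu(2) aw_homogeneous[OF unit_degree unit_degree Y] iso_scl homogeneousD)

lemma T_ru: assumes Y: "Y \<in> D h" shows "T.ru Y = scl (\<omega> h 0 0) (ru Y)"
  using Y unit_degree
  by (intro T.ru_eqI) (simp_all add: ru(2) aw_homogeneous[OF Y unit_degree unit_degree] homogeneousD)

lemma T_uhb:
  assumes Y: "Y \<in> D h"
  shows "T.uhb Y = scl (inverse (\<omega> h 0 0) * inverse (\<omega> 0 0 h)) (uhb Y)"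
  using homogeneousD[OF Y] \<omega>_nonzero by (simp add: T.uhb_def uhb_def T_lu[OF Y] T_ru[OF Y] iso_scl mult.commute)

lemma twh_T_uhb:
  assumes nz: "\<And>g h. \<delta> g h \<noteq> 0" and \<delta>: "\<And>h. \<delta> 0 h * inverse (\<omega> h 0 0) * inverse (\<omega> 0 0 h) = 1"
    and Y: "Y \<in> Obj C"
  shows "twh \<delta> I T.uhb Y = uhb Y"
proof -
  have N: "nf I T.uhb" using T.hb_nf[OF T.hb_uhb] by simp
  have M: "nf I uhb" using hb_nf[OF hb_uhb] .
  note L = nf_twh[OF N, of \<delta>, OF nz]
  note [simp] = nfD(1-5)[OF N] nfD(1-5)[OF M] nfD(1-5)[OF L]
  show ?thesis
  proof (rule homogeneous_ext2[of I Y])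
    fix i j g h assume ij [simp]: "arr i" "cd i = I" "arr j" "cd j = Y" and h: "dm j \<in> D h"
    have "twh \<delta> I T.uhb (dm j) = uhb (dm j)"
      using \<delta>[of h] by (simp add: twh_homogeneous[OF N unit_degree h] T_uhb[OF h] ac_simps)
    moreover have "i \<boxtimes> j = (I \<rhd> j) \<cdot> (i \<lhd> dm j)" by (simp add: tns_wh)
    ultimately show "twh \<delta> I T.uhb Y \<cdot> (i \<boxtimes> j) = uhb Y \<cdot> (i \<boxtimes> j)"
      using tl2[OF nfD(6)[OF L ij(3), of Y]] tl2[OF nfD(6)[OF M ij(3), of Y]] Y by simp
  qed (use Y in simp_all)
qed

lemma T_thb: "T.thb X P X' P' Y = aw Y X X' \<cdot> (P Y \<lhd> X') \<cdot> iv (aw X Y X') \<cdot> (X \<rhd> P' Y) \<cdot> aw X X' Y"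
  by (simp add: T.thb_def)

text \<open>
  Twisting by \<open>\<delta>\<close> is compatible with tensor products. Both sides are natural in \<open>Y\<close> and, with
  respect to intertwiners, in both half-braidings; on homogeneous objects the assertion is the
  equation assumed for \<open>\<delta>\<close>, which is the second hexagon for \<open>\<gamma> = \<delta>\<^sup>-\<^sup>1\<close>.
\<close>

lemma twh_T_thb:
  assumes x: "x \<in> Obj center_T" and x': "x' \<in> Obj center_T"
    and obj: "\<And>z. z \<in> Obj center_T \<Longrightarrow> ctw \<delta> z \<in> Obj (center C)"
    and nz: "\<And>g h. \<delta> g h \<noteq> 0"
    and \<delta>: "\<And>g h k. \<delta> (g + h) k * \<omega> k g h * inverse (\<omega> g k h) * \<omega> g h k = \<delta> g k * \<delta> h k"
    and Y: "Y \<in> Obj C"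
  shows "thb (fst x) (twh \<delta> (fst x) (hbp x)) (fst x') (twh \<delta> (fst x') (hbp x')) Y
    = twh \<delta> (fst x \<odot> fst x') (T.thb (fst x) (hbp x) (fst x') (hbp x')) Y"
proof -
  let ?t = "\<lambda>z. twh \<delta> (fst z) (hbp z)"
  let ?L = "\<lambda>z z'. thb (fst z) (?t z) (fst z') (?t z')"
  let ?S = "\<lambda>z z'. T.thb (fst z) (hbp z) (fst z') (hbp z')"
  let ?R = "\<lambda>z z'. twh \<delta> (fst z \<odot> fst z') (?S z z')"
  have hb: "hb (fst z) (?t z)" if "z \<in> Obj center_T" for z
    using center_objD(2)[OF obj[OF that]] hb_cong[of "hbp (ctw \<delta> z)" "?t z"] by (simp add: hbp_ctw)
  have Thb: "T.hb (fst z) (hbp z)" if "z \<in> Obj center_T" for z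
    using T.center_objD(2)[OF that] by simp
  have nf: "nf (fst z) (hbp z)" if "z \<in> Obj center_T" for z
    using T.hb_nf[OF Thb[OF that]] by simp
  have L: "nf (fst z \<odot> fst z') (?L z z')" and S: "nf (fst z \<odot> fst z') (?S z z')"
    and R: "nf (fst z \<odot> fst z') (?R z z')"
    if "z \<in> Obj center_T" "z' \<in> Obj center_T" for z z'
  proof -
    show "nf (fst z \<odot> fst z') (?L z z')" using hb_nf[OF hb_thb[OF hb[OF that(1)] hb[OF that(2)]]] .
    show S: "nf (fst z \<odot> fst z') (?S z z')"
      using T.hb_nf[OF T.hb_thb[OF Thb[OF that(1)] Thb[OF that(2)]]] by simp
    show "nf (fst z \<odot> fst z') (?R z z')" using nf_twh[OF S, of \<delta>, OF nz] .
  qed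
  have cov: "covers (fst z) (T.chom z)" if "z \<in> Obj center_T" for z
    using T.covers_chom[OF that] by (simp add: T_covers)
  show ?thesis
  proof (rule covers_ext[OF covers_tns[OF covers_tns[OF cov[OF x] cov[OF x']] covers_homs[OF Y]]])
    fix s assume "s \<in> {u \<boxtimes> k |u k. u \<in> {i \<boxtimes> j |i j. i \<in> T.chom x \<and> j \<in> T.chom x'} \<and> k \<in> homs Y}"
    then obtain i i' j where s: "s = (i \<boxtimes> i') \<boxtimes> j" and i: "i \<in> T.chom x" and i': "i' \<in> T.chom x'" and j: "j \<in> homs Y"
      by blast
    from i obtain y g where i [simp]: "arr i" "cd i = fst x" "dm i = fst y" and y: "y \<in> Obj center_T"
      and g: "fst y \<in> D g" and im: "im (hbp y) (hbp x) i" unfolding T.chom_def T_simps by blast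
    from i' obtain y' g' where i' [simp]: "arr i'" "cd i' = fst x'" "dm i' = fst y'" and y': "y' \<in> Obj center_T"
      and g': "fst y' \<in> D g'" and im': "im (hbp y') (hbp x') i'" unfolding T.chom_def T_simps by blast
    from j obtain k where j [simp]: "arr j" "cd j = Y" and k: "dm j \<in> D k" unfolding homs_def by blast
    have imL: "im (?L y y') (?L x x') (i \<boxtimes> i')"
      using im_twh[OF nf[OF y] nf[OF x] i(1,3,2) im, of \<delta>] im_twh[OF nf[OF y'] nf[OF x'] i'(1,3,2) im', of \<delta>]
      by (intro im_tns hb x x' y y') simp_all
    have "T.im (?S y y') (?S x x') (T.tns i i')"
      using im im' by (intro T.im_tns Thb x x' y y') simp_all
    then have imR: "im (?R y y') (?R x x') (i \<boxtimes> i')"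
      by (intro im_twh S x x' y y') simp_all
    have Yo: "dm j \<in> Obj C" using homogeneousD[OF k] .
    note t = twh_homogeneous[OF nf[OF y] g k, of \<delta>] twh_homogeneous[OF nf[OF y'] g' k, of \<delta>]
      twh_homogeneous[OF S[OF y y'] tens_degree[OF g g'] k, of \<delta>]
    note w = aw_homogeneous[OF k g g'] aw_homogeneous[OF g k g'] aw_homogeneous[OF g g' k]
    note [simp] = nfD(1-5)[OF nf[OF y]] nfD(1-5)[OF nf[OF y']]
    have "?L y y' (dm j) = ?R y y' (dm j)"
      using \<delta>[of g g' k] \<omega>_nonzero Yo
      by (simp add: t T_thb w thb_def iso_scl ac_simps)
    then show "?L x x' Y \<cdot> s = ?R x x' Y \<cdot> s"
      unfolding s using im_natural[OF L[OF x x'] L[OF y y'] _ _ _ imL j]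
        im_natural[OF R[OF x x'] R[OF y y'] _ _ _ imR j] by simp
  qed (use nfD[OF L[OF x x']] nfD[OF R[OF x x']] Y in simp_all)
qed

end


lemma (in graded_monoidal_category) center_grading_iff:
  "x \<in> center_grading C D g \<longleftrightarrow> x \<in> Obj (center C) \<and> fst x \<in> D g"
  by (simp add: center_grading_def case_prod_beta)

lemma monoidal_braid_update:
  "monoidal_category R \<Longrightarrow> monoidal_category (R\<lparr>Braid := b\<rparr>)"
proof -
  assume R: "monoidal_category R"
  have i: "is_iso (R\<lparr>Braid := b\<rparr>) = is_iso R"
    by (intro ext) (simp add: is_iso_def inverse_pair_def)
  have e: "is_equivalence (R\<lparr>Braid := b\<rparr>) (R\<lparr>Braid := b\<rparr>) = is_equivalence R R"
    by (intro ext) (simp add: is_equivalence_def is_functor_def natural_iso_def i)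
  have "linear_category (R\<lparr>Braid := b\<rparr>) = linear_category R"
    by (simp add: linear_category_def hom_group_def)
  moreover have "monoidal_category_axioms (R\<lparr>Braid := b\<rparr>) = monoidal_category_axioms R"
    unfolding monoidal_category_axioms_def i e by simp
  ultimately show ?thesis using R by (simp add: monoidal_category_def)
qed

context associator_twist
begin

text \<open>
  The twist by \<open>\<omega>\<close> of the associator of the center, formed with the grading of the center, is the
  twisted associator of \<open>C\<close> on the underlying objects: both are natural in morphisms of the center
  and agree on homogeneous objects.
\<close>

lemma center_assoc_twist:
  assumes x: "x \<in> Obj (center C)" and y: "y \<in> Obj (center C)" and z: "z \<in> Obj (center C)"
  shows "Assoc (assoc_twist (center C) (center_grading C D) \<omega>) x y z = A (fst x) (fst y) (fst z)"
proof -
  interpret Z: graded_monoidal_category "center C" "center_grading C D" by (rule center_graded_monoidal)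
  define b where "b x y z = ((fst x \<odot> fst y) \<odot> fst z,
    Assoc (assoc_twist (center C) (center_grading C D) \<omega>) x y z, fst x \<odot> (fst y \<odot> fst z))" for x y z
  have ends [simp]: "dm (b x y z) = (fst x \<odot> fst y) \<odot> fst z" "cd (b x y z) = fst x \<odot> (fst y \<odot> fst z)" for x y z
    by (simp_all add: b_def)
  have arb: "arr (b x y z)"
    using Z.tw3(1)[OF x y z, of \<omega>] x y z center_homD unfolding b_def Z.tw3_def Z.arr_triple
    by (fastforce simp: arr_triple dest: center_homD)
  have "b x y z = aw (fst x) (fst y) (fst z)"
  proof (rule covers_ext[OF covers_tns[OF covers_tns[OF covers_chom[OF x] covers_chom[OF y]] covers_chom[OF z]]])
    fix s assume "s \<in> {u \<boxtimes> k |u k. u \<in> {i \<boxtimes> j |i j. i \<in> chom x \<and> j \<in> chom y} \<and> k \<in> chom z}"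
    then obtain i j k where s: "s = (i \<boxtimes> j) \<boxtimes> k" and i: "i \<in> chom x" and j: "j \<in> chom y" and k: "k \<in> chom z"
      by blast
    from i obtain x' g where i [simp]: "arr i" "cd i = fst x" "dm i = fst x'" and x': "x' \<in> Obj (center C)"
      and g: "fst x' \<in> D g" and imi: "im (hbp x') (hbp x) i" unfolding chom_def by blast
    from j obtain y' h where j [simp]: "arr j" "cd j = fst y" "dm j = fst y'" and y': "y' \<in> Obj (center C)"
      and h: "fst y' \<in> D h" and imj: "im (hbp y') (hbp y) j" unfolding chom_def by blast
    from k obtain z' l where k [simp]: "arr k" "cd k = fst z" "dm k = fst z'" and z': "z' \<in> Obj (center C)"
      and l: "fst z' \<in> D l" and imk: "im (hbp z') (hbp z) k" unfolding chom_def by blast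
    have "Z.arr (x', mo i, x)" "Z.arr (y', mo j, y)" "Z.arr (z', mo k, z)"
      using x y z x' y' z' imi imj imk by (simp_all add: Z.arr_triple center_homI)
    from Z.tw3_nat[OF this refl refl refl, of \<omega>]
    have "b x y z \<cdot> s = (i \<boxtimes> (j \<boxtimes> k)) \<cdot> b x' y' z'"
      unfolding s by (intro triple_eqI) (simp_all add: mo_sel Z.tw3_def Z.cmp_def Z.tns_def b_def)
    moreover have "b x' y' z' = scl (\<omega> g h l) (as (fst x') (fst y') (fst z'))"
      using Z.assoc_twist_homogeneous[of x' g y' h z' l \<omega>] g h l x' y' z'
      by (simp add: center_grading_iff b_def scl_def as_def)
    moreover have "aw (fst x) (fst y) (fst z) \<cdot> s = (i \<boxtimes> (j \<boxtimes> k)) \<cdot> aw (fst x') (fst y') (fst z')"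
      unfolding s by (simp add: aw_nat)
    ultimately show "b x y z \<cdot> s = aw (fst x) (fst y) (fst z) \<cdot> s"
      by (simp add: aw_homogeneous[OF g h l])
  qed (use x y z arb in simp_all)
  then show ?thesis by (simp add: b_def aw_def)
qed

text \<open>
  The braiding of the center of \<open>C\<close>, at objects twisted by \<open>\<delta> = \<gamma>\<^sup>-\<^sup>1\<close>, becomes the braiding of the center
  of the twisted category when it is twisted by \<open>\<gamma>\<close>.
\<close>

lemma center_braid_twist:
  assumes x: "x \<in> Obj center_T" and y: "y \<in> Obj center_T"
    and obj: "\<And>z. z \<in> Obj center_T \<Longrightarrow> ctw \<delta> z \<in> Obj (center C)"
    and \<delta>: "\<And>g h. \<gamma> g h * \<delta> g h = 1"
  shows "twist2 (center C) (center_grading C D) \<gamma> (ctw \<delta> x) (ctw \<delta> y)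
    (Braid (center C) (ctw \<delta> x) (ctw \<delta> y)) = snd x (fst y)"
proof -
  interpret Z: graded_monoidal_category "center C" "center_grading C D" by (rule center_graded_monoidal)
  interpret ZB: braided_monoidal_category "center C" by (rule center_braided)
  let ?u = "ctw \<delta> x" and ?v = "ctw \<delta> y"
  note u = obj[OF x] and v = obj[OF y]
  have N: "nf (fst x) (hbp x)" using T.hb_nf[OF T.center_objD(2)[OF x]] by simp
  have Y: "fst y \<in> Obj C" using center_objD(1)[OF v] by simp
  note [simp] = nfD(1-5)[OF N] Y
  define f where "f = (?u \<odot>\<^bsub>center C\<^esub> ?v, Braid (center C) ?u ?v, ?v \<odot>\<^bsub>center C\<^esub> ?u)"
  have f: "Z.arr f" "dm f = ?u \<odot>\<^bsub>center C\<^esub> ?v" "cd f = ?v \<odot>\<^bsub>center C\<^esub> ?u"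
    using ZB.braid_iso[OF u v] Z.tens_obj[OF u v] Z.tens_obj[OF v u]
    by (auto simp: f_def Z.arr_triple is_iso_def inverse_pair_def)
  define b where "b = (fst x \<odot> fst y, twist2 (center C) (center_grading C D) \<gamma> ?u ?v (Braid (center C) ?u ?v), fst y \<odot> fst x)"
  have ends [simp]: "dm b = fst x \<odot> fst y" "cd b = fst y \<odot> fst x" by (simp_all add: b_def)
  have arb: "arr b"
    using Z.tw2(1)[OF u v f, of \<gamma>] unfolding b_def Z.tw2_def Z.arr_triple
    by (auto simp: arr_triple f_def dest!: center_homD)
  have "b = hbp x (fst y)"
  proof (rule covers_ext[OF covers_tns[OF covers_chom[OF u, unfolded fst_ctw] covers_chom[OF v, unfolded fst_ctw]]])
    fix s assume "s \<in> {i \<boxtimes> j |i j. i \<in> chom ?u \<and> j \<in> chom ?v}"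
    then obtain i j where s: "s = i \<boxtimes> j" and i: "i \<in> chom ?u" and j: "j \<in> chom ?v" by blast
    from i obtain x' g where i [simp]: "arr i" "cd i = fst x" "dm i = fst x'" and x': "x' \<in> Obj (center C)"
      and g: "fst x' \<in> D g" and imi: "im (hbp x') (hbp ?u) i" unfolding chom_def fst_ctw by blast
    from j obtain y' h where j [simp]: "arr j" "cd j = fst y" "dm j = fst y'" and y': "y' \<in> Obj (center C)"
      and h: "fst y' \<in> D h" and imj: "im (hbp y') (hbp ?v) j" unfolding chom_def fst_ctw by blast
    have "Z.arr (x', mo i, ?u)" "Z.arr (y', mo j, ?v)"
      using u v x' y' imi imj by (simp_all add: Z.arr_triple center_homI)
    from Z.tw2(2)[OF u v f this(1) _ _ this(2), of g h \<gamma>] g h x' y'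
    have "b \<cdot> s = scl (\<gamma> g h) (hbp ?u (fst y) \<cdot> s)"
      unfolding s
      by (intro triple_eqI) (simp_all add: mo_sel Z.tw2_def Z.cmp_def Z.tns_def Z.scl_def b_def f_def
          center_grading_iff hbt_def)
    also have "hbp ?u (fst y) \<cdot> s = scl (\<delta> g h) (hbp x (fst y) \<cdot> s)"
      using twh_test[OF N, of i g j "fst y" h \<delta>] g h by (simp add: hbp_ctw s)
    finally show "b \<cdot> s = hbp x (fst y) \<cdot> s" using \<delta>[of g h] by (simp add: s)
  qed (use arb in simp_all)
  then show ?thesis by (simp add: b_def hbt_def)
qed

end

text \<open>
  The cocycle is not assumed to be normalized. The pentagon at \<open>(0, 0, h, 0)\<close> gives \<open>\<omega> 0 h 0 = 1\<close>, and the
  second hexagon at \<open>(0, 0, h)\<close> then determines \<open>\<gamma> 0 h\<close>.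
\<close>

lemma abelian_cocycle_unit:
  assumes "abelian_3_cocycle \<omega> \<gamma>"
  shows "inverse (\<gamma> 0 h) * inverse (\<omega> h 0 0) * inverse (\<omega> 0 0 h) = 1"
proof -
  have nz: "\<omega> a b c \<noteq> 0" "\<gamma> a b \<noteq> 0" for a b c
    using assms by (simp_all add: abelian_3_cocycle_def)
  have "\<omega> 0 0 h * \<omega> 0 (0 + h) 0 * \<omega> 0 h 0 = \<omega> (0 + 0) h 0 * \<omega> 0 0 (h + 0)"
    using assms unfolding abelian_3_cocycle_def by blast
  then have "\<omega> 0 h 0 = 1" using nz by simp
  moreover have "inverse (\<omega> h 0 0) * \<gamma> (0 + 0) h * inverse (\<omega> 0 0 h) = \<gamma> 0 h * inverse (\<omega> 0 h 0) * \<gamma> 0 h"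
    using assms unfolding abelian_3_cocycle_def by blast
  ultimately show ?thesis using nz by (simp add: field_simps)
qed

theorem proposition2p27:
  fixes C :: "('o, 'm, 'k::alg_closed_field) mon_cat"
    and D :: "'g::ab_group_add \<Rightarrow> 'o set"
    and \<omega> :: "'g \<Rightarrow> 'g \<Rightarrow> 'g \<Rightarrow> 'k"
    and \<gamma> :: "'g \<Rightarrow> 'g \<Rightarrow> 'k"
  assumes "graded_monoidal_category C D"
    and "abelian_3_cocycle \<omega> \<gamma>"
  shows "\<exists>Fm J. braided_tensor_equivalence
    (center (assoc_twist C D \<omega>))
    (braided_twist (center C) (center_grading C D) \<omega> \<gamma>)
    (\<lambda>(X, \<phi>). (X, half_braiding_twist C D (\<lambda>g h. inverse (\<gamma> g h)) X \<phi>))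
    Fm J"
proof -
  interpret graded_monoidal_category C D by (rule assms(1))
  define A where "A = Assoc (assoc_twist C D \<omega>)"
  have eq: "assoc_twist C D \<omega> = C\<lparr>Assoc := A\<rparr>" by (simp add: A_def assoc_twist_def)
  note coc = assms(2)[unfolded abelian_3_cocycle_def]
  have nz: "\<omega> a b c \<noteq> 0" "\<gamma> a b \<noteq> 0" for a b c using coc by blast+
  have coc3: "\<omega> g1 g2 g3 * \<omega> g1 (g2 + g3) g4 * \<omega> g2 g3 g4 = \<omega> (g1 + g2) g3 g4 * \<omega> g1 g2 (g3 + g4)"
    for g1 g2 g3 g4 using coc by blast
  have hex1: "\<omega> h k g * \<gamma> g (h + k) * \<omega> g h k = \<gamma> g k * \<omega> h g k * \<gamma> g h" for g h k
    using coc by blast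
  have hex2: "inverse (\<omega> k g h) * \<gamma> (g + h) k * inverse (\<omega> g h k) = \<gamma> g k * inverse (\<omega> g k h) * \<gamma> h k"
    for g h k using coc by blast
  interpret W: associator_twist C D A \<omega>
  proof -
    have "graded_monoidal_category (C\<lparr>Assoc := A\<rparr>) D"
      using assoc_twist_graded_monoidal[of \<omega>, OF nz(1) coc3] by (simp add: eq)
    then show "associator_twist C D A \<omega>"
      unfolding associator_twist_def associator_twist_axioms_def
      using assms(1) nz assoc_twist_homogeneous by (simp add: A_def)
  qed
  interpret R: associator_twist "C\<lparr>Assoc := A\<rparr>" D "Assoc C" "\<lambda>g h k. inverse (\<omega> g h k)"
    by (rule W.reverse)
  define \<delta> where "\<delta> g h = inverse (\<gamma> g h)" for g h
  have dnz: "\<delta> g h \<noteq> 0" and gd: "\<gamma> g h * \<delta> g h = 1" and dg: "\<delta> g h * \<gamma> g h = 1" for g h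
    using nz by (simp_all add: \<delta>_def)
  have dhex1: "inverse (\<omega> h k g) * \<delta> g (h + k) * inverse (\<omega> g h k) = \<delta> g k * inverse (\<omega> h g k) * \<delta> g h"
    for g h k
    using arg_cong[OF hex1[of h k g], of inverse] by (simp add: \<delta>_def)
  have dhex2: "\<delta> (g + h) k * \<omega> k g h * inverse (\<omega> g k h) * \<omega> g h k = \<delta> g k * \<delta> h k" for g h k
    using hex2[of k g h] nz by (simp add: \<delta>_def field_simps)
  let ?Z' = "center (C\<lparr>Assoc := A\<rparr>)" and ?B = "braided_twist (center C) (center_grading C D) \<omega> \<gamma>"
  have F: "ctw \<delta> x \<in> Obj (center C)" if "x \<in> Obj ?Z'" for x
    using R.ctw_obj[OF that, of \<delta>] dnz dhex1 by simp
  have G: "ctw \<gamma> x \<in> Obj ?Z'" if "x \<in> Obj (center C)" for x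
    using W.ctw_obj[OF that, of \<gamma>] nz hex1 by simp
  have FG: "ctw \<delta> (ctw \<gamma> x) = x" if "x \<in> Obj (center C)" for x
    using that center_obj_hb[of x] nz dg by (intro ctw_ctw hb_nf) simp_all
  have GF: "ctw \<gamma> (ctw \<delta> x) = x" if x: "x \<in> Obj ?Z'" for x
  proof -
    have "nf (fst x) (hbp x)" "snd x \<in> extensional (Obj C)"
      using W.T.hb_nf[of "fst x" "hbp x"] x W.T.center_obj_hb[of x] by simp_all
    then show ?thesis using dnz gd by (intro ctw_ctw) simp_all
  qed
  have hom: "Hom (center C) (ctw \<delta> x) (ctw \<delta> y) = Hom ?Z' x y" if xy: "x \<in> Obj ?Z'" "y \<in> Obj ?Z'" for x y
    using R.ctw_hom[OF xy, of _ \<delta>] W.ctw_hom[OF F[OF xy(1)] F[OF xy(2)], of _ \<gamma>] GF[OF xy(1)] GF[OF xy(2)]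
    by auto
  have obj_eqI: "p = q" if "fst p = fst q" "snd p \<in> extensional (Obj C)" "snd q \<in> extensional (Obj C)"
    "\<And>Y. Y \<in> Obj C \<Longrightarrow> hbt (fst p) (snd p) Y = hbt (fst q) (snd q) Y" for p q :: "'o \<times> ('o \<Rightarrow> 'm)"
    using that by (intro prod_eqI extensionalityI[of _ "Obj C"]) (auto simp: hbt_def)
  have tens: "ctw \<delta> x \<odot>\<^bsub>center C\<^esub> ctw \<delta> y = ctw \<delta> (x \<odot>\<^bsub>?Z'\<^esub> y)"
    if xy: "x \<in> Obj ?Z'" "y \<in> Obj ?Z'" for x y
  proof (rule obj_eqI)
    fix Y assume Y: "Y \<in> Obj C"
    have "hbp (ctw \<delta> x \<odot>\<^bsub>center C\<^esub> ctw \<delta> y) Y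
      = thb (fst x) (twh \<delta> (fst x) (hbp x)) (fst y) (twh \<delta> (fst y) (hbp y)) Y"
      using Y by (simp add: hbt_tens thb_def hbp_ctw)
    also have "\<dots> = twh \<delta> (fst x \<odot>\<^bsub>C\<^esub> fst y) (W.T.thb (fst x) (hbp x) (fst y) (hbp y)) Y"
      using W.twh_T_thb[OF xy F dnz dhex2 Y] .
    also have "\<dots> = hbp (ctw \<delta> (x \<odot>\<^bsub>?Z'\<^esub> y)) Y"
      using Y W.T.hbt_tens[of Y "fst x" "fst y" "snd x" "snd y"] by (simp add: hbp_ctw twh_def)
    finally show "hbp (ctw \<delta> x \<odot>\<^bsub>center C\<^esub> ctw \<delta> y) Y = hbp (ctw \<delta> (x \<odot>\<^bsub>?Z'\<^esub> y)) Y" .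
  qed (simp_all add: tens_half_braiding_def ctw_def half_braiding_twist_def)
  have unit: "UnitO (center C) = ctw \<delta> (UnitO ?Z')"
  proof (rule obj_eqI)
    fix Y assume Y: "Y \<in> Obj C"
    have "hbp (ctw \<delta> (UnitO ?Z')) Y = twh \<delta> I W.T.uhb Y"
      using Y W.T.hbt_unit[of Y] by (simp add: hbp_ctw twh_def)
    also have "\<dots> = uhb Y"
      using abelian_cocycle_unit[OF assms(2)] by (intro W.twh_T_uhb[OF dnz _ Y]) (simp add: \<delta>_def)
    finally show "hbp (UnitO (center C)) Y = hbp (ctw \<delta> (UnitO ?Z')) Y" using Y by (simp add: hbt_unit)
  qed (simp_all add: unit_half_braiding_def ctw_def half_braiding_twist_def)
  interpret ZC: graded_monoidal_category "center C" "center_grading C D" by (rule center_graded_monoidal)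
  have "monoidal_category (assoc_twist (center C) (center_grading C D) \<omega>)"
    using ZC.assoc_twist_graded_monoidal[of \<omega>, OF nz(1) coc3] by (rule graded_monoidal_category.axioms(1))
  then have B: "monoidal_category ?B" unfolding braided_twist_def by (rule monoidal_braid_update)
  have sel: "Obj ?B = Obj (center C)" "Hom ?B = Hom (center C)" "Ident ?B = Ident (center C)"
    "Comp ?B = Comp C" "AddM ?B = AddM C" "Scale ?B = Scale C" "TensM ?B = TensM C"
    "TensO ?B = TensO (center C)" "UnitO ?B = UnitO (center C)"
    "Assoc ?B = Assoc (assoc_twist (center C) (center_grading C D) \<omega>)"
    "Braid ?B x y = twist2 (center C) (center_grading C D) \<gamma> x y (Braid (center C) x y)" for x y
    by (simp_all add: braided_twist_def assoc_twist_def)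
  have "braided_tensor_equivalence ?Z' ?B (ctw \<delta>) (\<lambda>f. f) (\<lambda>x y. Ident ?Z' (x \<odot>\<^bsub>?Z'\<^esub> y))"
  proof (rule strict_iso_braided_tensor_equivalence[where G = "ctw \<gamma>"])
    show "braided_monoidal_category ?Z'" by (rule W.T.center_braided)
    show "monoidal_category ?B" by (rule B)
    show "Assoc ?B (ctw \<delta> x) (ctw \<delta> y) (ctw \<delta> z) = Assoc ?Z' x y z"
      if "x \<in> Obj ?Z'" "y \<in> Obj ?Z'" "z \<in> Obj ?Z'" for x y z
      using W.center_assoc_twist[OF F[OF that(1)] F[OF that(2)] F[OF that(3)]] by (simp add: sel)
    show "Braid ?B (ctw \<delta> x) (ctw \<delta> y) = Braid ?Z' x y" if "x \<in> Obj ?Z'" "y \<in> Obj ?Z'" for x y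
      using W.center_braid_twist[OF that F gd] by (simp add: sel del: center_sel(6))
  qed (use F G FG GF hom tens unit in \<open>simp_all add: sel del: center_sel(6,9)\<close>)
  moreover have "ctw \<delta> = (\<lambda>(X, \<phi>). (X, half_braiding_twist C D (\<lambda>g h. inverse (\<gamma> g h)) X \<phi>))"
  proof
    have "\<delta> = (\<lambda>g h. inverse (\<gamma> g h))" by (intro ext) (simp add: \<delta>_def)
    then show "ctw \<delta> x = (\<lambda>(X, \<phi>). (X, half_braiding_twist C D (\<lambda>g h. inverse (\<gamma> g h)) X \<phi>)) x" for x
      by (simp add: ctw_def case_prod_beta)
  qed
  ultimately show ?thesis unfolding eq by auto
qed

end
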